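(* There exists a pivotal fusion category $\mathcal C$ with the following property: there is no weak bialgebra structure on the algebra $\mathrm{Tube}_{\mathcal C}$ such that the induced monoidal structure on $\mathrm{Rep}(\mathrm{Tube}_{\mathcal C})$ renders the equivalence of categories $J\colon\mathcal Z(\mathcal C)\to\mathrm{Rep}(\mathrm{Tube}_{\mathcal C})$, $(z,\gamma_{-,z})\mapsto\bigoplus_{x\in\mathrm{Irr}(\mathcal C)}\mathcal C(x,z)$, a monoidal equivalence.
   Context: $k$ is an algebraically closed field of characteristic $0$; fusion categories are over $k$; algebras and modules are finite-dimensional. $\mathrm{Irr}(\mathcal C)$: complete set of pairwise non-isomorphic simple objects. $w^L$ is the left dual ($\mathrm{ev}\colon w^Lw\to\mathbf 1$, $\mathrm{coev}\colon\mathbf 1\to ww^L$), $w^R$ the right dual ($\mathrm{ev}\colon ww^R\to\mathbf 1$, $\mathrm{coev}\colon\mathbf 1\to w^Rw$). A pivotal structure is a monoidal natural isomorphism $\mathbf a\colon\mathrm{Id}_{\mathcal C}\Rightarrow(-)^{RR}$; so $\mathbf a_{w^L}\colon w^L\to w^R$. Tube algebra: $\mathrm{Tube}_{\mathcal C}=\bigoplus_{x,y,w\in\mathrm{Irr}(\mathcal C)}Y_{w|x|y}$, $Y_{w|x|y}=\mathcal C(x\otimes w,w\otimes y)$. For $h\in Y_{w'|x'|y'}$, $g\in Y_{w|x|y}$, $$h\cdot g=\delta_{x,y'}\sum_{t\in\mathrm{Irr}(\mathcal C)}\sum_{\alpha=1}^{n_t}\bigl(x't\xrightarrow{1I^\alpha_t}x'w'w\xrightarrow{h1}w'y'w\xrightarrow{1g}w'wy\xrightarrow{P^\alpha_t1}ty\bigr),$$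 the $t$-th term in $Y_{t|x'|y}$, with $I^\alpha_t,P^\alpha_t$ inclusions and projections of a decomposition $w'w\cong\bigoplus_tt^{\oplus n_t}$. Unit: $\sum_x\mathrm{id}_x$, $\mathrm{id}_x\in Y_{\mathbf 1|x|x}$. Drinfeld center $\mathcal Z(\mathcal C)$: objects $(z,\gamma_{-,z})$, half-braiding $\gamma_{w,z}\colon wz\xrightarrow{\sim}zw$. The functor $J$, which is an equivalence of categories for pivotal $\mathcal C$, has the $\mathrm{Tube}_{\mathcal C}$-action: for $g\in Y_{w|x|y}$ and $s\colon x_0\to z$ with $x_0\in\mathrm{Irr}(\mathcal C)$, $$g.s=\delta_{x_0,y}\bigl(x\xrightarrow{1\mathrm{coev}}xww^L\xrightarrow{g1}wyw^L\xrightarrow{1s1}wzw^L\xrightarrow{\gamma_{w,z}1}zww^L\xrightarrow{1\mathbf a_{w^L}}zww^R\xrightarrow{1\mathrm{ev}}z\bigr).$$ A weak bialgebra is an algebra $A$ with a coalgebra structure $(\Delta,\epsilon)$ such that $\Delta(xy)=\Delta(x)\Delta(y)$; $\epsilon(xy_{(1)})\epsilon(y_{(2)}z)=\epsilon(xyz)=\epsilon(xy_{(2)})\epsilon(y_{(1)}z)$; $1_{(1)}\otimes1_{(2)}1_{(1')}\otimes1_{(2')}=1_{(1)}\otimes1_{(2)}\otimes1_{(3)}=1_{(1)}\otimes1_{(1')}1_{(2)}\otimes1_{(2')}$. A weak bialgebra structure on an algebra means such a $(\Delta,\epsilon)$. The induced monoidal structure on $\mathrm{Rep}(A)$ (finite-dimensional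 left modules) has $V\overline\otimes W$ = image of $v\otimes w\mapsto1_{(1)}.v\otimes1_{(2)}.w$ on $V\otimes W$, with $A$ acting through $\Delta$, and unit $A^l=\epsilon^{lr}(A)$, $\epsilon^{lr}(x)=\epsilon(1_{(1)}x)1_{(2)}$, with action $x\otimes y\mapsto\epsilon^{lr}(xy)$. *)

theory Defs
  imports
    "HOL-Computational_Algebra.Polynomial"
    "HOL-Library.Function_Algebras"
    "HOL-Library.FuncSet"
    "HOL-Library.Nat_Bijection"
begin

section \<open>Vector spaces inside \<open>k\<^sup>\<nat>\<close>\<close>

text \<open>All vector spaces are subspaces of one ambient space, the functions \<^typ>\<open>nat \<Rightarrow> 'k\<close> with
  pointwise addition. Every finite-dimensional space is isomorphic to such a subspace, and the
  bijection between \<^typ>\<open>nat \<times> nat\<close> and \<^typ>\<open>nat\<close> keeps direct sums and tensor products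
  inside the ambient space.\<close>

type_synonym 'k vec = "nat \<Rightarrow> 'k"

definition scl :: "'k::field \<Rightarrow> 'k vec \<Rightarrow> 'k vec" (infixr "*\<^sub>v" 75)
  where "c *\<^sub>v v = (\<lambda>n. c * v n)"

interpretation vs: vector_space scl
  by unfold_locales (auto simp: scl_def fun_eq_iff algebra_simps)

definition fin_dim_subspace :: "'k::field vec set \<Rightarrow> bool"
  where "fin_dim_subspace V \<longleftrightarrow> (\<exists>B. finite B \<and> V = vs.span B)"

definition linear_on :: "'k::field vec set \<Rightarrow> ('k vec \<Rightarrow> 'k vec) \<Rightarrow> bool"
  where "linear_on V f \<longleftrightarrow>
    (\<forall>u\<in>V. \<forall>v\<in>V. f (u + v) = f u + f v) \<and> (\<forall>c. \<forall>v\<in>V. f (c *\<^sub>v v) = c *\<^sub>v f v)"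

definition linear_form_on :: "'k::field vec set \<Rightarrow> ('k vec \<Rightarrow> 'k) \<Rightarrow> bool"
  where "linear_form_on V f \<longleftrightarrow>
    (\<forall>u\<in>V. \<forall>v\<in>V. f (u + v) = f u + f v) \<and> (\<forall>c. \<forall>v\<in>V. f (c *\<^sub>v v) = c * f v)"

definition bilinear_on :: "'k::field vec set \<Rightarrow> 'k vec set \<Rightarrow> ('k vec \<Rightarrow> 'k vec \<Rightarrow> 'k vec) \<Rightarrow> bool"
  where "bilinear_on U V b \<longleftrightarrow> (\<forall>u\<in>U. linear_on V (b u)) \<and> (\<forall>v\<in>V. linear_on U (\<lambda>u. b u v))"

definition inj_at :: "nat \<Rightarrow> 'k::zero vec \<Rightarrow> 'k vec"
  where "inj_at i v = (\<lambda>n. case prod_decode n of (j, m) \<Rightarrow> if j = i then v m else 0)"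

definition proj_at :: "nat \<Rightarrow> 'k vec \<Rightarrow> 'k vec"
  where "proj_at i v = (\<lambda>m. v (prod_encode (i, m)))"

text \<open>The direct sum of the family \<open>V\<close> over \<open>I\<close>, for finite \<open>I\<close>.\<close>

definition direct_sum :: "nat set \<Rightarrow> (nat \<Rightarrow> 'k::zero vec set) \<Rightarrow> 'k vec set"
  where "direct_sum I V = {v. \<forall>i. proj_at i v \<in> (if i \<in> I then V i else {\<lambda>n. 0})}"

definition tens :: "'k::times vec \<Rightarrow> 'k vec \<Rightarrow> 'k vec" (infixr "\<otimes>\<^sub>v" 76)
  where "v \<otimes>\<^sub>v w = (\<lambda>n. case prod_decode n of (i, j) \<Rightarrow> v i * w j)"

definition tens_space :: "'k::field vec set \<Rightarrow> 'k vec set \<Rightarrow> 'k vec set" (infixr "\<otimes>\<^sub>V" 76)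
  where "V \<otimes>\<^sub>V W = vs.span {v \<otimes>\<^sub>v w | v w. v \<in> V \<and> w \<in> W}"

text \<open>\<open>sweedler V W b t\<close> is the value at \<open>t \<in> V \<otimes> W\<close> of the linear map induced by the bilinear map
  \<open>b\<close> on \<open>V \<times> W\<close>, that is \<open>b t\<^sub>1 t\<^sub>2\<close> for \<open>t = t\<^sub>1 \<otimes> t\<^sub>2\<close> (sum suppressed). The value does not
  depend on the chosen expression of \<open>t\<close>, because \<open>V \<otimes>\<^sub>V W\<close> is a tensor product of \<open>V\<close> and \<open>W\<close>.\<close>

definition sweedler ::
    "'k::field vec set \<Rightarrow> 'k vec set \<Rightarrow> ('k vec \<Rightarrow> 'k vec \<Rightarrow> 'c::comm_monoid_add) \<Rightarrow> 'k vec \<Rightarrow> 'c"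
  where "sweedler V W b t =
    (let L = (SOME L. set L \<subseteq> V \<times> W \<and> t = (\<Sum>(v, w)\<leftarrow>L. v \<otimes>\<^sub>v w)) in \<Sum>(v, w)\<leftarrow>L. b v w)"

text \<open>\<open>(u \<otimes> v) \<otimes> w \<mapsto> u \<otimes> (v \<otimes> w)\<close>\<close>

definition reassoc :: "'k vec \<Rightarrow> 'k vec"
  where "reassoc t = (\<lambda>n. case prod_decode n of (i, m) \<Rightarrow>
    case prod_decode m of (j, l) \<Rightarrow> t (prod_encode (prod_encode (i, j), l)))"


section \<open>Monoidal categories\<close>

text \<open>Composition is diagrammatic: \<open>f \<Zsemi> g\<close> is first \<open>f\<close>, then \<open>g\<close>. Hom-sets need not be disjoint.
  \<open>\<alpha> x y z: (x \<otimes> y) \<otimes> z \<rightarrow> x \<otimes> (y \<otimes> z)\<close>, \<open>\<ll> x: \<one> \<otimes> x \<rightarrow> x\<close>, \<open>\<rho> x: x \<otimes> \<one> \<rightarrow> x\<close>.\<close>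

record ('o, 'm) moncat =
  ob :: "'o set"
  hom :: "'o \<Rightarrow> 'o \<Rightarrow> 'm set"
  ident :: "'o \<Rightarrow> 'm" ("\<iota>\<index>")
  seq :: "'m \<Rightarrow> 'm \<Rightarrow> 'm" (infixl "\<Zsemi>\<index>" 60)
  ten :: "'o \<Rightarrow> 'o \<Rightarrow> 'o" (infixl "\<otimes>\<index>" 70)
  tmor :: "'m \<Rightarrow> 'm \<Rightarrow> 'm" (infixl "\<boxtimes>\<index>" 70)
  unt :: "'o" ("\<one>\<index>")
  asc :: "'o \<Rightarrow> 'o \<Rightarrow> 'o \<Rightarrow> 'm" ("\<alpha>\<index>")
  lun :: "'o \<Rightarrow> 'm" ("\<ll>\<index>")
  run :: "'o \<Rightarrow> 'm" ("\<rho>\<index>")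

definition category :: "('o, 'm) moncat \<Rightarrow> bool"
  where "category C \<longleftrightarrow>
    (\<forall>x\<in>ob C. \<iota> x \<in> hom C x x) \<and>
    (\<forall>x\<in>ob C. \<forall>y\<in>ob C. \<forall>f\<in>hom C x y. \<iota> x \<Zsemi> f = f \<and> f \<Zsemi> \<iota> y = f) \<and>
    (\<forall>x\<in>ob C. \<forall>y\<in>ob C. \<forall>z\<in>ob C. \<forall>f\<in>hom C x y. \<forall>g\<in>hom C y z. f \<Zsemi> g \<in> hom C x z) \<and>
    (\<forall>w\<in>ob C. \<forall>x\<in>ob C. \<forall>y\<in>ob C. \<forall>z\<in>ob C.
      \<forall>f\<in>hom C w x. \<forall>g\<in>hom C x y. \<forall>h\<in>hom C y z. f \<Zsemi> g \<Zsemi> h = f \<Zsemi> (g \<Zsemi> h))"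
  for C (structure)

definition inverse_pair :: "('o, 'm) moncat \<Rightarrow> 'o \<Rightarrow> 'o \<Rightarrow> 'm \<Rightarrow> 'm \<Rightarrow> bool"
  where "inverse_pair C x y f g \<longleftrightarrow>
    f \<in> hom C x y \<and> g \<in> hom C y x \<and> f \<Zsemi> g = \<iota> x \<and> g \<Zsemi> f = \<iota> y"
  for C (structure)

definition is_iso :: "('o, 'm) moncat \<Rightarrow> 'o \<Rightarrow> 'o \<Rightarrow> 'm \<Rightarrow> bool"
  where "is_iso C x y f \<longleftrightarrow> (\<exists>g. inverse_pair C x y f g)"

definition inv_mor :: "('o, 'm) moncat \<Rightarrow> 'o \<Rightarrow> 'o \<Rightarrow> 'm \<Rightarrow> 'm"
  where "inv_mor C x y f = (THE g. inverse_pair C x y f g)"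

definition isomorphic :: "('o, 'm) moncat \<Rightarrow> 'o \<Rightarrow> 'o \<Rightarrow> bool"
  where "isomorphic C x y \<longleftrightarrow> (\<exists>f. is_iso C x y f)"

definition asc_inv :: "('o, 'm) moncat \<Rightarrow> 'o \<Rightarrow> 'o \<Rightarrow> 'o \<Rightarrow> 'm" ("\<alpha>\<^sup>-\<index>")
  where "\<alpha>\<^sup>- x y z = inv_mor C (x \<otimes> y \<otimes> z) (x \<otimes> (y \<otimes> z)) (\<alpha> x y z)" for C (structure)

definition lun_inv :: "('o, 'm) moncat \<Rightarrow> 'o \<Rightarrow> 'm" ("\<ll>\<^sup>-\<index>")
  where "\<ll>\<^sup>- x = inv_mor C (\<one> \<otimes> x) x (\<ll> x)" for C (structure)

definition run_inv :: "('o, 'm) moncat \<Rightarrow> 'o \<Rightarrow> 'm" ("\<rho>\<^sup>-\<index>")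
  where "\<rho>\<^sup>- x = inv_mor C (x \<otimes> \<one>) x (\<rho> x)" for C (structure)

definition monoidal_category :: "('o, 'm) moncat \<Rightarrow> bool"
  where "monoidal_category C \<longleftrightarrow> category C \<and>
    \<one> \<in> ob C \<and> (\<forall>x\<in>ob C. \<forall>y\<in>ob C. x \<otimes> y \<in> ob C) \<and>
    (\<forall>x\<in>ob C. \<forall>y\<in>ob C. \<iota> x \<boxtimes> \<iota> y = \<iota> (x \<otimes> y)) \<and>
    (\<forall>x\<in>ob C. \<forall>y\<in>ob C. \<forall>x'\<in>ob C. \<forall>y'\<in>ob C. \<forall>f\<in>hom C x y. \<forall>f'\<in>hom C x' y'.
      f \<boxtimes> f' \<in> hom C (x \<otimes> x') (y \<otimes> y')) \<and>
    (\<forall>x\<in>ob C. \<forall>y\<in>ob C. \<forall>z\<in>ob C. \<forall>x'\<in>ob C. \<forall>y'\<in>ob C. \<forall>z'\<in>ob C.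
      \<forall>f\<in>hom C x y. \<forall>g\<in>hom C y z. \<forall>f'\<in>hom C x' y'. \<forall>g'\<in>hom C y' z'.
      (f \<Zsemi> g) \<boxtimes> (f' \<Zsemi> g') = f \<boxtimes> f' \<Zsemi> g \<boxtimes> g') \<and>
    (\<forall>x\<in>ob C. \<forall>y\<in>ob C. \<forall>z\<in>ob C. is_iso C (x \<otimes> y \<otimes> z) (x \<otimes> (y \<otimes> z)) (\<alpha> x y z)) \<and>
    (\<forall>x\<in>ob C. is_iso C (\<one> \<otimes> x) x (\<ll> x) \<and> is_iso C (x \<otimes> \<one>) x (\<rho> x)) \<and>
    (\<forall>x\<in>ob C. \<forall>y\<in>ob C. \<forall>z\<in>ob C. \<forall>x'\<in>ob C. \<forall>y'\<in>ob C. \<forall>z'\<in>ob C.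
      \<forall>f\<in>hom C x x'. \<forall>g\<in>hom C y y'. \<forall>h\<in>hom C z z'.
      f \<boxtimes> g \<boxtimes> h \<Zsemi> \<alpha> x' y' z' = \<alpha> x y z \<Zsemi> f \<boxtimes> (g \<boxtimes> h)) \<and>
    (\<forall>x\<in>ob C. \<forall>y\<in>ob C. \<forall>f\<in>hom C x y.
      \<iota> \<one> \<boxtimes> f \<Zsemi> \<ll> y = \<ll> x \<Zsemi> f \<and> f \<boxtimes> \<iota> \<one> \<Zsemi> \<rho> y = \<rho> x \<Zsemi> f) \<and>
    (\<forall>w\<in>ob C. \<forall>x\<in>ob C. \<forall>y\<in>ob C. \<forall>z\<in>ob C.
      \<alpha> w x y \<boxtimes> \<iota> z \<Zsemi> \<alpha> w (x \<otimes> y) z \<Zsemi> \<iota> w \<boxtimes> \<alpha> x y z = \<alpha> (w \<otimes> x) y z \<Zsemi> \<alpha> w x (y \<otimes> z)) \<and>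
    (\<forall>x\<in>ob C. \<forall>y\<in>ob C. \<alpha> x \<one> y \<Zsemi> \<iota> x \<boxtimes> \<ll> y = \<rho> x \<boxtimes> \<iota> y)"
  for C (structure)


section \<open>Functors\<close>

text \<open>The action of a functor on morphisms takes source and target as arguments, since a morphism
  need not determine them.\<close>

record ('o, 'm, 'p, 'n) functor_data =
  fob :: "'o \<Rightarrow> 'p"
  fmor :: "'o \<Rightarrow> 'o \<Rightarrow> 'm \<Rightarrow> 'n"

definition is_functor ::
    "('o, 'm) moncat \<Rightarrow> ('p, 'n) moncat \<Rightarrow> ('o, 'm, 'p, 'n) functor_data \<Rightarrow> bool"
  where "is_functor C D F \<longleftrightarrow>
    (\<forall>x\<in>ob C. fob F x \<in> ob D) \<and>
    (\<forall>x\<in>ob C. \<forall>y\<in>ob C. \<forall>f\<in>hom C x y. fmor F x y f \<in> hom D (fob F x) (fob F y)) \<and>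
    (\<forall>x\<in>ob C. fmor F x x (ident C x) = ident D (fob F x)) \<and>
    (\<forall>x\<in>ob C. \<forall>y\<in>ob C. \<forall>z\<in>ob C. \<forall>f\<in>hom C x y. \<forall>g\<in>hom C y z.
      fmor F x z (f \<Zsemi>\<^bsub>C\<^esub> g) = fmor F x y f \<Zsemi>\<^bsub>D\<^esub> fmor F y z g)"

definition is_equivalence ::
    "('o, 'm) moncat \<Rightarrow> ('p, 'n) moncat \<Rightarrow> ('o, 'm, 'p, 'n) functor_data \<Rightarrow> bool"
  where "is_equivalence C D F \<longleftrightarrow> is_functor C D F \<and>
    (\<forall>x\<in>ob C. \<forall>y\<in>ob C. bij_betw (fmor F x y) (hom C x y) (hom D (fob F x) (fob F y))) \<and>
    (\<forall>z\<in>ob D. \<exists>x\<in>ob C. isomorphic D (fob F x) z)"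

text \<open>\<open>\<mu> x y: F x \<otimes> F y \<rightarrow> F (x \<otimes> y)\<close> and \<open>\<eta>: \<one> \<rightarrow> F \<one>\<close>\<close>

definition is_monoidal_functor ::
    "('o, 'm) moncat \<Rightarrow> ('p, 'n) moncat \<Rightarrow> ('o, 'm, 'p, 'n) functor_data \<Rightarrow>
     ('o \<Rightarrow> 'o \<Rightarrow> 'n) \<Rightarrow> 'n \<Rightarrow> bool"
  where "is_monoidal_functor C D F \<mu> \<eta> \<longleftrightarrow> is_functor C D F \<and>
    (\<forall>x\<in>ob C. \<forall>y\<in>ob C. is_iso D (fob F x \<otimes>\<^bsub>D\<^esub> fob F y) (fob F (x \<otimes>\<^bsub>C\<^esub> y)) (\<mu> x y)) \<and>
    is_iso D \<one>\<^bsub>D\<^esub> (fob F \<one>\<^bsub>C\<^esub>) \<eta> \<and>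
    (\<forall>x\<in>ob C. \<forall>y\<in>ob C. \<forall>x'\<in>ob C. \<forall>y'\<in>ob C. \<forall>f\<in>hom C x x'. \<forall>g\<in>hom C y y'.
      (fmor F x x' f \<boxtimes>\<^bsub>D\<^esub> fmor F y y' g) \<Zsemi>\<^bsub>D\<^esub> \<mu> x' y' =
      \<mu> x y \<Zsemi>\<^bsub>D\<^esub> fmor F (x \<otimes>\<^bsub>C\<^esub> y) (x' \<otimes>\<^bsub>C\<^esub> y') (f \<boxtimes>\<^bsub>C\<^esub> g)) \<and>
    (\<forall>x\<in>ob C. \<forall>y\<in>ob C. \<forall>z\<in>ob C.
      \<mu> x y \<boxtimes>\<^bsub>D\<^esub> ident D (fob F z) \<Zsemi>\<^bsub>D\<^esub> \<mu> (x \<otimes>\<^bsub>C\<^esub> y) z \<Zsemi>\<^bsub>D\<^esub>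
        fmor F (x \<otimes>\<^bsub>C\<^esub> y \<otimes>\<^bsub>C\<^esub> z) (x \<otimes>\<^bsub>C\<^esub> (y \<otimes>\<^bsub>C\<^esub> z)) (asc C x y z) =
      asc D (fob F x) (fob F y) (fob F z) \<Zsemi>\<^bsub>D\<^esub>
        ident D (fob F x) \<boxtimes>\<^bsub>D\<^esub> \<mu> y z \<Zsemi>\<^bsub>D\<^esub> \<mu> x (y \<otimes>\<^bsub>C\<^esub> z)) \<and>
    (\<forall>x\<in>ob C.
      \<eta> \<boxtimes>\<^bsub>D\<^esub> ident D (fob F x) \<Zsemi>\<^bsub>D\<^esub> \<mu> \<one>\<^bsub>C\<^esub> x \<Zsemi>\<^bsub>D\<^esub> fmor F (\<one>\<^bsub>C\<^esub> \<otimes>\<^bsub>C\<^esub> x) x (lun C x) =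
        lun D (fob F x) \<and>
      ident D (fob F x) \<boxtimes>\<^bsub>D\<^esub> \<eta> \<Zsemi>\<^bsub>D\<^esub> \<mu> x \<one>\<^bsub>C\<^esub> \<Zsemi>\<^bsub>D\<^esub> fmor F (x \<otimes>\<^bsub>C\<^esub> \<one>\<^bsub>C\<^esub>) x (run C x) =
        run D (fob F x))"

definition is_monoidal_equivalence ::
    "('o, 'm) moncat \<Rightarrow> ('p, 'n) moncat \<Rightarrow> ('o, 'm, 'p, 'n) functor_data \<Rightarrow>
     ('o \<Rightarrow> 'o \<Rightarrow> 'n) \<Rightarrow> 'n \<Rightarrow> bool"
  where "is_monoidal_equivalence C D F \<mu> \<eta> \<longleftrightarrow>
    is_monoidal_functor C D F \<mu> \<eta> \<and> is_equivalence C D F"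


section \<open>Pivotal fusion categories\<close>

text \<open>A \<open>k\<close>-linear category has its hom-spaces inside \<open>k\<^sup>\<nat>\<close>, with the vector space structure of
  \<open>k\<^sup>\<nat>\<close>.\<close>

definition linear_monoidal :: "('o, 'k::field vec) moncat \<Rightarrow> bool"
  where "linear_monoidal C \<longleftrightarrow> monoidal_category C \<and>
    (\<forall>x\<in>ob C. \<forall>y\<in>ob C. fin_dim_subspace (hom C x y)) \<and>
    (\<forall>x\<in>ob C. \<forall>y\<in>ob C. \<forall>z\<in>ob C. bilinear_on (hom C x y) (hom C y z) (seq C)) \<and>
    (\<forall>x\<in>ob C. \<forall>y\<in>ob C. \<forall>x'\<in>ob C. \<forall>y'\<in>ob C. bilinear_on (hom C x y) (hom C x' y') (tmor C))"

text \<open>\<open>D\<close> lists the summands of \<open>u\<close>, each with its inclusion and its projection.\<close>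

definition is_direct_sum ::
    "('o, 'k::field vec) moncat \<Rightarrow> 'o \<Rightarrow> ('o \<times> 'k vec \<times> 'k vec) list \<Rightarrow> bool"
  where "is_direct_sum C u D \<longleftrightarrow> u \<in> ob C \<and>
    (\<forall>(t, i, p)\<in>set D. t \<in> ob C \<and> i \<in> hom C t u \<and> p \<in> hom C u t) \<and>
    (\<forall>a<length D. \<forall>b<length D. case D ! a of (t, i, p) \<Rightarrow> case D ! b of (t', i', p') \<Rightarrow>
      i \<Zsemi> p' = (if a = b then \<iota> t else 0)) \<and>
    (\<Sum>(t, i, p)\<leftarrow>D. p \<Zsemi> i) = \<iota> u"
  for C (structure)

definition mono_mor :: "('o, 'm) moncat \<Rightarrow> 'o \<Rightarrow> 'o \<Rightarrow> 'm \<Rightarrow> bool"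
  where "mono_mor C x y f \<longleftrightarrow> f \<in> hom C x y \<and>
    (\<forall>u\<in>ob C. \<forall>g\<in>hom C u x. \<forall>h\<in>hom C u x. g \<Zsemi> f = h \<Zsemi> f \<longrightarrow> g = h)"
  for C (structure)

definition epi_mor :: "('o, 'm) moncat \<Rightarrow> 'o \<Rightarrow> 'o \<Rightarrow> 'm \<Rightarrow> bool"
  where "epi_mor C x y f \<longleftrightarrow> f \<in> hom C x y \<and>
    (\<forall>u\<in>ob C. \<forall>g\<in>hom C y u. \<forall>h\<in>hom C y u. f \<Zsemi> g = f \<Zsemi> h \<longrightarrow> g = h)"
  for C (structure)

definition is_kernel :: "('o, 'k::field vec) moncat \<Rightarrow> 'o \<Rightarrow> 'o \<Rightarrow> 'k vec \<Rightarrow> 'o \<Rightarrow> 'k vec \<Rightarrow> bool"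
  where "is_kernel C x y f n i \<longleftrightarrow> n \<in> ob C \<and> i \<in> hom C n x \<and> i \<Zsemi> f = 0 \<and>
    (\<forall>u\<in>ob C. \<forall>g\<in>hom C u x. g \<Zsemi> f = 0 \<longrightarrow> (\<exists>!h. h \<in> hom C u n \<and> h \<Zsemi> i = g))"
  for C (structure)

definition is_cokernel :: "('o, 'k::field vec) moncat \<Rightarrow> 'o \<Rightarrow> 'o \<Rightarrow> 'k vec \<Rightarrow> 'o \<Rightarrow> 'k vec \<Rightarrow> bool"
  where "is_cokernel C x y f n p \<longleftrightarrow> n \<in> ob C \<and> p \<in> hom C y n \<and> f \<Zsemi> p = 0 \<and>
    (\<forall>u\<in>ob C. \<forall>g\<in>hom C y u. f \<Zsemi> g = 0 \<longrightarrow> (\<exists>!h. h \<in> hom C n u \<and> p \<Zsemi> h = g))"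
  for C (structure)

definition abelian :: "('o, 'k::field vec) moncat \<Rightarrow> bool"
  where "abelian C \<longleftrightarrow>
    (\<exists>z\<in>ob C. \<forall>x\<in>ob C. hom C z x = {0} \<and> hom C x z = {0}) \<and>
    (\<forall>x\<in>ob C. \<forall>y\<in>ob C. \<exists>s\<in>ob C. \<exists>i p j q. is_direct_sum C s [(x, i, p), (y, j, q)]) \<and>
    (\<forall>x\<in>ob C. \<forall>y\<in>ob C. \<forall>f\<in>hom C x y.
      (\<exists>n i. is_kernel C x y f n i) \<and> (\<exists>n p. is_cokernel C x y f n p)) \<and>
    (\<forall>x\<in>ob C. \<forall>y\<in>ob C. \<forall>f. mono_mor C x y f \<longrightarrow> (\<exists>z\<in>ob C. \<exists>g\<in>hom C y z. is_kernel C y z g x f)) \<and>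
    (\<forall>x\<in>ob C. \<forall>y\<in>ob C. \<forall>f. epi_mor C x y f \<longrightarrow> (\<exists>z\<in>ob C. \<exists>g\<in>hom C z x. is_cokernel C z x g y f))"

definition simple :: "('o, 'k::field vec) moncat \<Rightarrow> 'o \<Rightarrow> bool"
  where "simple C x \<longleftrightarrow> x \<in> ob C \<and> ident C x \<noteq> 0 \<and>
    (\<forall>u\<in>ob C. \<forall>i. mono_mor C u x i \<longrightarrow> i = 0 \<or> is_iso C u x i)"

definition semisimple :: "('o, 'k::field vec) moncat \<Rightarrow> bool"
  where "semisimple C \<longleftrightarrow> abelian C \<and>
    (\<forall>x\<in>ob C. \<exists>D. is_direct_sum C x D \<and> (\<forall>(t, i, p)\<in>set D. simple C t))"

definition complete_simples :: "('o, 'k::field vec) moncat \<Rightarrow> 'o set \<Rightarrow> bool"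
  where "complete_simples C I \<longleftrightarrow> (\<forall>x\<in>I. simple C x) \<and>
    (\<forall>x\<in>I. \<forall>y\<in>I. isomorphic C x y \<longrightarrow> x = y) \<and>
    (\<forall>x. simple C x \<longrightarrow> (\<exists>y\<in>I. isomorphic C x y))"

text \<open>\<open>u\<close> is a right dual of \<open>x\<close> with \<open>e: x \<otimes> u \<rightarrow> \<one>\<close> and \<open>c: \<one> \<rightarrow> u \<otimes> x\<close>; equivalently, \<open>x\<close> is a
  left dual of \<open>u\<close>.\<close>

definition is_dual :: "('o, 'm) moncat \<Rightarrow> 'o \<Rightarrow> 'o \<Rightarrow> 'm \<Rightarrow> 'm \<Rightarrow> bool"
  where "is_dual C x u e c \<longleftrightarrow> x \<in> ob C \<and> u \<in> ob C \<and>
    e \<in> hom C (x \<otimes> u) \<one> \<and> c \<in> hom C \<one> (u \<otimes> x) \<and>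
    \<rho>\<^sup>- x \<Zsemi> \<iota> x \<boxtimes> c \<Zsemi> \<alpha>\<^sup>- x u x \<Zsemi> e \<boxtimes> \<iota> x \<Zsemi> \<ll> x = \<iota> x \<and>
    \<ll>\<^sup>- u \<Zsemi> c \<boxtimes> \<iota> u \<Zsemi> \<alpha> u x u \<Zsemi> \<iota> u \<boxtimes> e \<Zsemi> \<rho> u = \<iota> u"
  for C (structure)

definition rigid :: "('o, 'm) moncat \<Rightarrow> bool"
  where "rigid C \<longleftrightarrow>
    (\<forall>x\<in>ob C. (\<exists>u e c. is_dual C x u e c) \<and> (\<exists>u e c. is_dual C u x e c))"

definition fusion_category :: "('o, 'k::field vec) moncat \<Rightarrow> bool"
  where "fusion_category C \<longleftrightarrow> linear_monoidal C \<and> semisimple C \<and> rigid C \<and>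
    simple C (unt C) \<and> (\<exists>I. finite I \<and> complete_simples C I)"

text \<open>Chosen duals \<open>x\<^sup>R\<close>, \<open>x\<^sup>L\<close> and the components \<open>x \<rightarrow> x\<^sup>R\<^sup>R\<close> of a pivotal structure.\<close>

record ('o, 'm) pivotal_data =
  rdual :: "'o \<Rightarrow> 'o"
  ev_r :: "'o \<Rightarrow> 'm"
  coev_r :: "'o \<Rightarrow> 'm"
  ldual :: "'o \<Rightarrow> 'o"
  ev_l :: "'o \<Rightarrow> 'm"
  coev_l :: "'o \<Rightarrow> 'm"
  piv :: "'o \<Rightarrow> 'm"

text \<open>The mate \<open>v \<rightarrow> u\<close> of \<open>f: x \<rightarrow> y\<close>, where \<open>u\<close> is a right dual of \<open>x\<close> with coevaluation
  \<open>c: \<one> \<rightarrow> u \<otimes> x\<close> and \<open>v\<close> is a right dual of \<open>y\<close> with evaluation \<open>e: y \<otimes> v \<rightarrow> \<one>\<close>. For \<open>f = \<iota> x\<close> it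
  is the canonical isomorphism between two right duals of \<open>x\<close>.\<close>

definition mate :: "('o, 'm) moncat \<Rightarrow> 'o \<Rightarrow> 'o \<Rightarrow> 'o \<Rightarrow> 'm \<Rightarrow> 'm \<Rightarrow> 'm \<Rightarrow> 'm"
  where "mate C u y v c e f =
    \<ll>\<^sup>- v \<Zsemi> c \<boxtimes> \<iota> v \<Zsemi> \<iota> u \<boxtimes> f \<boxtimes> \<iota> v \<Zsemi> \<alpha> u y v \<Zsemi> \<iota> u \<boxtimes> e \<Zsemi> \<rho> u"
  for C (structure)

definition rdual_mor :: "('o, 'm) moncat \<Rightarrow> ('o, 'm) pivotal_data \<Rightarrow> 'o \<Rightarrow> 'o \<Rightarrow> 'm \<Rightarrow> 'm"
  where "rdual_mor C P x y f = mate C (rdual P x) y (rdual P y) (coev_r P x) (ev_r P y) f"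

text \<open>\<open>y\<^sup>R \<otimes> x\<^sup>R\<close> as a right dual of \<open>x \<otimes> y\<close>, and the resulting canonical isomorphisms between
  \<open>y\<^sup>R \<otimes> x\<^sup>R\<close> and \<open>(x \<otimes> y)\<^sup>R\<close>, and between \<open>\<one>\<close> and \<open>\<one>\<^sup>R\<close>.\<close>

definition ev_ten :: "('o, 'm) moncat \<Rightarrow> ('o, 'm) pivotal_data \<Rightarrow> 'o \<Rightarrow> 'o \<Rightarrow> 'm"
  where "ev_ten C P x y = (let xr = rdual P x; yr = rdual P y in
    \<alpha> x y (yr \<otimes> xr) \<Zsemi> \<iota> x \<boxtimes> (\<alpha>\<^sup>- y yr xr \<Zsemi> ev_r P y \<boxtimes> \<iota> xr \<Zsemi> \<ll> xr) \<Zsemi> ev_r P x)"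
  for C (structure)

definition coev_ten :: "('o, 'm) moncat \<Rightarrow> ('o, 'm) pivotal_data \<Rightarrow> 'o \<Rightarrow> 'o \<Rightarrow> 'm"
  where "coev_ten C P x y = (let xr = rdual P x; yr = rdual P y in
    coev_r P y \<Zsemi> \<iota> yr \<boxtimes> (\<ll>\<^sup>- y \<Zsemi> coev_r P x \<boxtimes> \<iota> y \<Zsemi> \<alpha> xr x y) \<Zsemi> \<alpha>\<^sup>- yr xr (x \<otimes> y))"
  for C (structure)

definition rdual_ten :: "('o, 'm) moncat \<Rightarrow> ('o, 'm) pivotal_data \<Rightarrow> 'o \<Rightarrow> 'o \<Rightarrow> 'm"
  where "rdual_ten C P x y = mate C (rdual P (x \<otimes> y)) (x \<otimes> y) (rdual P y \<otimes> rdual P x)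
    (coev_r P (x \<otimes> y)) (ev_ten C P x y) (\<iota> (x \<otimes> y))"
  for C (structure)

definition rdual_ten_inv :: "('o, 'm) moncat \<Rightarrow> ('o, 'm) pivotal_data \<Rightarrow> 'o \<Rightarrow> 'o \<Rightarrow> 'm"
  where "rdual_ten_inv C P x y = mate C (rdual P y \<otimes> rdual P x) (x \<otimes> y) (rdual P (x \<otimes> y))
    (coev_ten C P x y) (ev_r P (x \<otimes> y)) (\<iota> (x \<otimes> y))"
  for C (structure)

definition rdual_unit :: "('o, 'm) moncat \<Rightarrow> ('o, 'm) pivotal_data \<Rightarrow> 'm"
  where "rdual_unit C P = mate C (rdual P \<one>) \<one> \<one> (coev_r P \<one>) (\<ll> \<one>) (\<iota> \<one>)" for C (structure)

definition rdual_unit_inv :: "('o, 'm) moncat \<Rightarrow> ('o, 'm) pivotal_data \<Rightarrow> 'm"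
  where "rdual_unit_inv C P = mate C \<one> \<one> (rdual P \<one>) (\<ll>\<^sup>- \<one>) (ev_r P \<one>) (\<iota> \<one>)" for C (structure)

text \<open>The monoidal functor \<open>(-)\<^sup>R\<^sup>R\<close>.\<close>

definition rr_functor :: "('o, 'm) moncat \<Rightarrow> ('o, 'm) pivotal_data \<Rightarrow> ('o, 'm, 'o, 'm) functor_data"
  where "rr_functor C P = \<lparr>fob = (\<lambda>x. rdual P (rdual P x)),
    fmor = (\<lambda>x y f. rdual_mor C P (rdual P y) (rdual P x) (rdual_mor C P x y f))\<rparr>"

definition rr_mu :: "('o, 'm) moncat \<Rightarrow> ('o, 'm) pivotal_data \<Rightarrow> 'o \<Rightarrow> 'o \<Rightarrow> 'm"
  where "rr_mu C P x y = rdual_ten C P (rdual P y) (rdual P x) \<Zsemi>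
    rdual_mor C P (rdual P (x \<otimes> y)) (rdual P y \<otimes> rdual P x) (rdual_ten_inv C P x y)"
  for C (structure)

definition rr_eta :: "('o, 'm) moncat \<Rightarrow> ('o, 'm) pivotal_data \<Rightarrow> 'm"
  where "rr_eta C P = rdual_unit C P \<Zsemi> rdual_mor C P (rdual P \<one>) \<one> (rdual_unit_inv C P)"
  for C (structure)

definition is_monoidal_nat_iso ::
    "('o, 'm) moncat \<Rightarrow> ('p, 'n) moncat \<Rightarrow>
     ('o, 'm, 'p, 'n) functor_data \<Rightarrow> ('o \<Rightarrow> 'o \<Rightarrow> 'n) \<Rightarrow> 'n \<Rightarrow>
     ('o, 'm, 'p, 'n) functor_data \<Rightarrow> ('o \<Rightarrow> 'o \<Rightarrow> 'n) \<Rightarrow> 'n \<Rightarrow> ('o \<Rightarrow> 'n) \<Rightarrow> bool"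
  where "is_monoidal_nat_iso C D F \<mu> \<eta> G \<nu> \<theta> a \<longleftrightarrow>
    (\<forall>x\<in>ob C. is_iso D (fob F x) (fob G x) (a x)) \<and>
    (\<forall>x\<in>ob C. \<forall>y\<in>ob C. \<forall>f\<in>hom C x y. fmor F x y f \<Zsemi>\<^bsub>D\<^esub> a y = a x \<Zsemi>\<^bsub>D\<^esub> fmor G x y f) \<and>
    (\<forall>x\<in>ob C. \<forall>y\<in>ob C. \<mu> x y \<Zsemi>\<^bsub>D\<^esub> a (x \<otimes>\<^bsub>C\<^esub> y) = a x \<boxtimes>\<^bsub>D\<^esub> a y \<Zsemi>\<^bsub>D\<^esub> \<nu> x y) \<and>
    \<eta> \<Zsemi>\<^bsub>D\<^esub> a \<one>\<^bsub>C\<^esub> = \<theta>"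

definition pivotal_structure :: "('o, 'm) moncat \<Rightarrow> ('o, 'm) pivotal_data \<Rightarrow> bool"
  where "pivotal_structure C P \<longleftrightarrow>
    (\<forall>x\<in>ob C. is_dual C x (rdual P x) (ev_r P x) (coev_r P x)) \<and>
    (\<forall>x\<in>ob C. is_dual C (ldual P x) x (ev_l P x) (coev_l P x)) \<and>
    is_monoidal_nat_iso C C
      \<lparr>fob = (\<lambda>x. x), fmor = (\<lambda>x y f. f)\<rparr> (\<lambda>x y. \<iota> (x \<otimes> y)) (\<iota> \<one>)
      (rr_functor C P) (rr_mu C P) (rr_eta C P) (piv P)"
  for C (structure)

definition pivotal_fusion_category ::
    "('o, 'k::field vec) moncat \<Rightarrow> ('o, 'k vec) pivotal_data \<Rightarrow> bool"
  where "pivotal_fusion_category C P \<longleftrightarrow> fusion_category C \<and> pivotal_structure C P"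

text \<open>The component \<open>w\<^sup>L \<rightarrow> w\<^sup>L\<^sup>R\<^sup>R\<close> of the pivotal structure, followed by the right dual
  \<open>w\<^sup>L\<^sup>R\<^sup>R \<rightarrow> w\<^sup>R\<close> of the canonical isomorphism \<open>w \<rightarrow> w\<^sup>L\<^sup>R\<close> (both are right duals of \<open>w\<^sup>L\<close>).\<close>

definition piv_lr :: "('o, 'm) moncat \<Rightarrow> ('o, 'm) pivotal_data \<Rightarrow> 'o \<Rightarrow> 'm"
  where "piv_lr C P w = (let wl = ldual P w in
    piv P wl \<Zsemi> rdual_mor C P w (rdual P wl)
      (mate C (rdual P wl) wl w (coev_r P wl) (ev_l P w) (\<iota> wl)))"
  for C (structure)


section \<open>The Drinfeld center\<close>

definition half_braiding :: "('o, 'm) moncat \<Rightarrow> 'o \<Rightarrow> ('o \<Rightarrow> 'm) \<Rightarrow> bool"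
  where "half_braiding C z \<gamma> \<longleftrightarrow> \<gamma> \<in> extensional (ob C) \<and>
    (\<forall>w\<in>ob C. is_iso C (w \<otimes> z) (z \<otimes> w) (\<gamma> w)) \<and>
    (\<forall>w\<in>ob C. \<forall>w'\<in>ob C. \<forall>f\<in>hom C w w'. f \<boxtimes> \<iota> z \<Zsemi> \<gamma> w' = \<gamma> w \<Zsemi> \<iota> z \<boxtimes> f) \<and>
    (\<forall>w\<in>ob C. \<forall>w'\<in>ob C. \<gamma> (w \<otimes> w') =
      \<alpha> w w' z \<Zsemi> \<iota> w \<boxtimes> \<gamma> w' \<Zsemi> \<alpha>\<^sup>- w z w' \<Zsemi> \<gamma> w \<boxtimes> \<iota> w' \<Zsemi> \<alpha> z w w')"
  for C (structure)

definition center :: "('o, 'm) moncat \<Rightarrow> ('o \<times> ('o \<Rightarrow> 'm), 'm) moncat"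
  where "center C = \<lparr>
    ob = {(z, \<gamma>). z \<in> ob C \<and> half_braiding C z \<gamma>},
    hom = (\<lambda>(z, \<gamma>) (z', \<gamma>').
      {f \<in> hom C z z'. \<forall>w\<in>ob C. \<iota> w \<boxtimes> f \<Zsemi> \<gamma>' w = \<gamma> w \<Zsemi> f \<boxtimes> \<iota> w}),
    ident = (\<lambda>(z, \<gamma>). \<iota> z),
    seq = seq C,
    ten = (\<lambda>(z, \<gamma>) (z', \<gamma>'). (z \<otimes> z', \<lambda>w\<in>ob C.
      \<alpha>\<^sup>- w z z' \<Zsemi> \<gamma> w \<boxtimes> \<iota> z' \<Zsemi> \<alpha> z w z' \<Zsemi> \<iota> z \<boxtimes> \<gamma>' w \<Zsemi> \<alpha>\<^sup>- z z' w)),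
    tmor = tmor C,
    unt = (\<one>, \<lambda>w\<in>ob C. \<rho> w \<Zsemi> \<ll>\<^sup>- w),
    asc = (\<lambda>(x, _) (y, _) (z, _). \<alpha> x y z),
    lun = (\<lambda>(z, _). \<ll> z),
    run = (\<lambda>(z, _). \<rho> z)\<rparr>"
  for C (structure)


section \<open>Weak bialgebras and their representations\<close>

record 'k alg =
  acar :: "'k vec set"
  amul :: "'k vec \<Rightarrow> 'k vec \<Rightarrow> 'k vec" (infixl "\<star>\<index>" 70)
  aone :: "'k vec" ("\<^bold>1\<index>")

text \<open>The product of \<open>A \<otimes> A\<close>.\<close>

definition mul2 :: "'k::field alg \<Rightarrow> 'k vec \<Rightarrow> 'k vec \<Rightarrow> 'k vec"
  where "mul2 A s t = sweedler (acar A) (acar A) (\<lambda>a b.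
    sweedler (acar A) (acar A) (\<lambda>c d. (a \<star>\<^bsub>A\<^esub> c) \<otimes>\<^sub>v (b \<star>\<^bsub>A\<^esub> d)) t) s"

text \<open>A coalgebra structure on the space \<open>A\<close>.\<close>

definition coalgebra_on :: "'k::field vec set \<Rightarrow> ('k vec \<Rightarrow> 'k vec) \<Rightarrow> ('k vec \<Rightarrow> 'k) \<Rightarrow> bool"
  where "coalgebra_on A \<Delta> \<epsilon> \<longleftrightarrow>
    linear_on A \<Delta> \<and> \<Delta> ` A \<subseteq> A \<otimes>\<^sub>V A \<and> linear_form_on A \<epsilon> \<and>
    (\<forall>x\<in>A. reassoc (sweedler A A (\<lambda>a b. \<Delta> a \<otimes>\<^sub>v b) (\<Delta> x)) = sweedler A A (\<lambda>a b. a \<otimes>\<^sub>v \<Delta> b) (\<Delta> x)) \<and>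
    (\<forall>x\<in>A. sweedler A A (\<lambda>a b. \<epsilon> a *\<^sub>v b) (\<Delta> x) = x \<and> sweedler A A (\<lambda>a b. \<epsilon> b *\<^sub>v a) (\<Delta> x) = x)"

definition weak_bialgebra_structure ::
    "'k::field alg \<Rightarrow> ('k vec \<Rightarrow> 'k vec) \<Rightarrow> ('k vec \<Rightarrow> 'k) \<Rightarrow> bool"
  where "weak_bialgebra_structure A \<Delta> \<epsilon> \<longleftrightarrow> (let A' = acar A in
    coalgebra_on A' \<Delta> \<epsilon> \<and>
    (\<forall>x\<in>A'. \<forall>y\<in>A'. \<Delta> (x \<star> y) = mul2 A (\<Delta> x) (\<Delta> y)) \<and>
    (\<forall>x\<in>A'. \<forall>y\<in>A'. \<forall>z\<in>A'.
      sweedler A' A' (\<lambda>a b. \<epsilon> (x \<star> a) * \<epsilon> (b \<star> z)) (\<Delta> y) = \<epsilon> (x \<star> y \<star> z) \<and>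
      sweedler A' A' (\<lambda>a b. \<epsilon> (x \<star> b) * \<epsilon> (a \<star> z)) (\<Delta> y) = \<epsilon> (x \<star> y \<star> z)) \<and>
    sweedler A' A' (\<lambda>a b. sweedler A' A' (\<lambda>c d. a \<otimes>\<^sub>v (b \<star> c) \<otimes>\<^sub>v d) (\<Delta> \<^bold>1)) (\<Delta> \<^bold>1) =
      sweedler A' A' (\<lambda>a b. a \<otimes>\<^sub>v \<Delta> b) (\<Delta> \<^bold>1) \<and>
    sweedler A' A' (\<lambda>a b. sweedler A' A' (\<lambda>c d. a \<otimes>\<^sub>v (c \<star> b) \<otimes>\<^sub>v d) (\<Delta> \<^bold>1)) (\<Delta> \<^bold>1) =
      sweedler A' A' (\<lambda>a b. a \<otimes>\<^sub>v \<Delta> b) (\<Delta> \<^bold>1))"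
  for A (structure)

text \<open>A module is a finite-dimensional subspace of \<open>k\<^sup>\<nat>\<close> with an action; a morphism is a triple of
  source, target and map.\<close>

type_synonym 'k rmod = "'k vec set \<times> ('k vec \<Rightarrow> 'k vec \<Rightarrow> 'k vec)"

definition is_module :: "'k::field alg \<Rightarrow> 'k rmod \<Rightarrow> bool"
  where "is_module A M \<longleftrightarrow> (case M of (V, act) \<Rightarrow>
    fin_dim_subspace V \<and> act \<in> acar A \<rightarrow>\<^sub>E (V \<rightarrow>\<^sub>E V) \<and> bilinear_on (acar A) V act \<and>
    (\<forall>v\<in>V. act \<^bold>1 v = v) \<and>
    (\<forall>a\<in>acar A. \<forall>b\<in>acar A. \<forall>v\<in>V. act (a \<star> b) v = act a (act b v)))"
  for A (structure)

text \<open>The action of \<open>t \<in> A \<otimes> A\<close> on \<open>V \<otimes> W\<close>.\<close>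

definition act2 :: "'k::field alg \<Rightarrow> 'k rmod \<Rightarrow> 'k rmod \<Rightarrow> 'k vec \<Rightarrow> 'k vec \<Rightarrow> 'k vec"
  where "act2 A M N t u = sweedler (acar A) (acar A) (\<lambda>a b.
    sweedler (fst M) (fst N) (\<lambda>v w. snd M a v \<otimes>\<^sub>v snd N b w) u) t"

definition rep_ten :: "'k::field alg \<Rightarrow> ('k vec \<Rightarrow> 'k vec) \<Rightarrow> 'k rmod \<Rightarrow> 'k rmod \<Rightarrow> 'k rmod"
  where "rep_ten A \<Delta> M N = (let U = act2 A M N (\<Delta> \<^bold>1) ` (fst M \<otimes>\<^sub>V fst N) in
    (U, \<lambda>a\<in>acar A. \<lambda>u\<in>U. act2 A M N (\<Delta> a) u))"
  for A (structure)

text \<open>\<open>\<epsilon>\<^sup>l\<^sup>r(x) = \<epsilon>(1\<^sub>1 x) 1\<^sub>2\<close> and \<open>\<epsilon>\<^sup>r\<^sup>l(x) = \<epsilon>(1\<^sub>2 x) 1\<^sub>1\<close>\<close>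

definition eps_lr :: "'k::field alg \<Rightarrow> ('k vec \<Rightarrow> 'k vec) \<Rightarrow> ('k vec \<Rightarrow> 'k) \<Rightarrow> 'k vec \<Rightarrow> 'k vec"
  where "eps_lr A \<Delta> \<epsilon> x = sweedler (acar A) (acar A) (\<lambda>a b. \<epsilon> (a \<star> x) *\<^sub>v b) (\<Delta> \<^bold>1)"
  for A (structure)

definition eps_rl :: "'k::field alg \<Rightarrow> ('k vec \<Rightarrow> 'k vec) \<Rightarrow> ('k vec \<Rightarrow> 'k) \<Rightarrow> 'k vec \<Rightarrow> 'k vec"
  where "eps_rl A \<Delta> \<epsilon> x = sweedler (acar A) (acar A) (\<lambda>a b. \<epsilon> (b \<star> x) *\<^sub>v a) (\<Delta> \<^bold>1)"
  for A (structure)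

definition rep_unit :: "'k::field alg \<Rightarrow> ('k vec \<Rightarrow> 'k vec) \<Rightarrow> ('k vec \<Rightarrow> 'k) \<Rightarrow> 'k rmod"
  where "rep_unit A \<Delta> \<epsilon> = (let U = eps_lr A \<Delta> \<epsilon> ` acar A in
    (U, \<lambda>a\<in>acar A. \<lambda>u\<in>U. eps_lr A \<Delta> \<epsilon> (a \<star> u)))"
  for A (structure)

text \<open>The associator is the restriction of the one of vector spaces. The unit constraints are
  \<open>z \<otimes> v \<mapsto> z.v\<close> and \<open>v \<otimes> z \<mapsto> \<epsilon>\<^sup>r\<^sup>l(z).v\<close> for \<open>z \<in> A\<^sup>l\<close>; in the weak Hopf case the latter is
  \<open>v \<otimes> z \<mapsto> S\<^sup>-\<^sup>1(z).v\<close>.\<close>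

definition Rep ::
    "'k::field alg \<Rightarrow> ('k vec \<Rightarrow> 'k vec) \<Rightarrow> ('k vec \<Rightarrow> 'k) \<Rightarrow>
     ('k rmod, 'k rmod \<times> 'k rmod \<times> ('k vec \<Rightarrow> 'k vec)) moncat"
  where "Rep A \<Delta> \<epsilon> = (let T = rep_ten A \<Delta>; E = rep_unit A \<Delta> \<epsilon> in \<lparr>
    ob = {M. is_module A M},
    hom = (\<lambda>M N. {(M, N, f) | f. f \<in> fst M \<rightarrow>\<^sub>E fst N \<and> linear_on (fst M) f \<and>
      (\<forall>a\<in>acar A. \<forall>v\<in>fst M. f (snd M a v) = snd N a (f v))}),
    ident = (\<lambda>M. (M, M, \<lambda>v\<in>fst M. v)),
    seq = (\<lambda>(M, _, f) (_, N, g). (M, N, compose (fst M) g f)),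
    ten = T,
    tmor = (\<lambda>(M, N, f) (M', N', f'). (T M M', T N N',
      \<lambda>t\<in>fst (T M M'). sweedler (fst M) (fst M') (\<lambda>v v'. f v \<otimes>\<^sub>v f' v') t)),
    unt = E,
    asc = (\<lambda>L M N. (T (T L M) N, T L (T M N), \<lambda>t\<in>fst (T (T L M) N). reassoc t)),
    lun = (\<lambda>M. (T E M, M, \<lambda>t\<in>fst (T E M). sweedler (fst E) (fst M) (\<lambda>z v. snd M z v) t)),
    run = (\<lambda>M. (T M E, M,
      \<lambda>t\<in>fst (T M E). sweedler (fst M) (fst E) (\<lambda>v z. snd M (eps_rl A \<Delta> \<epsilon> z) v) t))\<rparr>)"


section \<open>The tube algebra\<close>

text \<open>The component in \<open>Y\<^sub>w\<^sub>|\<^sub>x\<^sub>|\<^sub>y = C(x \<otimes> w, w \<otimes> y)\<close> of an element of the tube algebra sits at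
  position \<open>(w, x, y)\<close>.\<close>

definition pos :: "nat \<Rightarrow> nat \<Rightarrow> nat \<Rightarrow> nat"
  where "pos w x y = prod_encode (w, prod_encode (x, y))"

definition tube_space :: "(nat, 'k::field vec) moncat \<Rightarrow> nat set \<Rightarrow> 'k vec set"
  where "tube_space C I = direct_sum {pos w x y | w x y. w \<in> I \<and> x \<in> I \<and> y \<in> I}
    (\<lambda>n. case prod_decode n of (w, m) \<Rightarrow> case prod_decode m of (x, y) \<Rightarrow> hom C (x \<otimes> w) (w \<otimes> y))"
  for C (structure)

text \<open>A decomposition of \<open>u\<close> into objects of \<open>I\<close>; the product below does not depend on the choice.\<close>

definition decomp ::
    "(nat, 'k::field vec) moncat \<Rightarrow> nat set \<Rightarrow> nat \<Rightarrow> (nat \<times> 'k vec \<times> 'k vec) list"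
  where "decomp C I u = (SOME D. is_direct_sum C u D \<and> fst ` set D \<subseteq> I)"

definition tube_mult ::
    "(nat, 'k::field vec) moncat \<Rightarrow> nat set \<Rightarrow> 'k vec \<Rightarrow> 'k vec \<Rightarrow> 'k vec"
  where "tube_mult C I h g =
    (\<Sum>w'\<in>I. \<Sum>x'\<in>I. \<Sum>x\<in>I. \<Sum>w\<in>I. \<Sum>y\<in>I. \<Sum>(t, i, p)\<leftarrow>decomp C I (w' \<otimes> w).
      inj_at (pos t x' y)
        (\<iota> x' \<boxtimes> i \<Zsemi> \<alpha>\<^sup>- x' w' w \<Zsemi> proj_at (pos w' x' x) h \<boxtimes> \<iota> w \<Zsemi> \<alpha> w' x w \<Zsemi>
         \<iota> w' \<boxtimes> proj_at (pos w x y) g \<Zsemi> \<alpha>\<^sup>- w' w y \<Zsemi> p \<boxtimes> \<iota> y))"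
  for C (structure)

definition Tube :: "(nat, 'k::field vec) moncat \<Rightarrow> nat set \<Rightarrow> 'k alg"
  where "Tube C I = \<lparr>acar = tube_space C I, amul = tube_mult C I,
    aone = (\<Sum>x\<in>I. inj_at (pos \<one> x x) (\<rho> x \<Zsemi> \<ll>\<^sup>- x))\<rparr>"
  for C (structure)

text \<open>The functor \<open>J\<close>; the component in \<open>C(x, z)\<close> of an element of \<open>J(z)\<close> sits at position \<open>x\<close>.\<close>

definition J_act ::
    "(nat, 'k::field vec) moncat \<Rightarrow> (nat, 'k vec) pivotal_data \<Rightarrow> nat set \<Rightarrow>
     nat \<Rightarrow> (nat \<Rightarrow> 'k vec) \<Rightarrow> 'k vec \<Rightarrow> 'k vec \<Rightarrow> 'k vec"
  where "J_act C P I z \<gamma> g s =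
    (\<Sum>w\<in>I. \<Sum>x\<in>I. \<Sum>y\<in>I. let wl = ldual P w; wr = rdual P w in
      inj_at x
        (\<rho>\<^sup>- x \<Zsemi> \<iota> x \<boxtimes> coev_l P w \<Zsemi> \<alpha>\<^sup>- x w wl \<Zsemi> proj_at (pos w x y) g \<boxtimes> \<iota> wl \<Zsemi>
         \<iota> w \<boxtimes> proj_at y s \<boxtimes> \<iota> wl \<Zsemi> \<gamma> w \<boxtimes> \<iota> wl \<Zsemi> \<alpha> z w wl \<Zsemi>
         \<iota> z \<boxtimes> (\<iota> w \<boxtimes> piv_lr C P w) \<Zsemi> \<iota> z \<boxtimes> ev_r P w \<Zsemi> \<rho> z))"
  for C (structure)

definition J_ob ::
    "(nat, 'k::field vec) moncat \<Rightarrow> (nat, 'k vec) pivotal_data \<Rightarrow> nat set \<Rightarrow>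
     nat \<times> (nat \<Rightarrow> 'k vec) \<Rightarrow> 'k rmod"
  where "J_ob C P I = (\<lambda>(z, \<gamma>). let V = direct_sum I (\<lambda>x. hom C x z) in
    (V, \<lambda>g\<in>tube_space C I. \<lambda>s\<in>V. J_act C P I z \<gamma> g s))"

definition J_functor ::
    "(nat, 'k::field vec) moncat \<Rightarrow> (nat, 'k vec) pivotal_data \<Rightarrow> nat set \<Rightarrow>
     (nat \<times> (nat \<Rightarrow> 'k vec), 'k vec, 'k rmod, 'k rmod \<times> 'k rmod \<times> ('k vec \<Rightarrow> 'k vec)) functor_data"
  where "J_functor C P I = \<lparr>fob = J_ob C P I,
    fmor = (\<lambda>Z Z' f. (J_ob C P I Z, J_ob C P I Z',
      \<lambda>s\<in>fst (J_ob C P I Z). \<Sum>x\<in>I. inj_at x (proj_at x s \<Zsemi> f)))\<rparr>"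
  for C (structure)

end

theory Submission
  imports Defs "HOL-Library.Countable"
begin

text \<open>The category is \<open>Rep(S\<^sub>3)\<close>, and the obstruction is a comparison of dimensions. For every
  weak bialgebra structure on \<open>A\<close>, the tensor product of two \<open>A\<close>-modules is a subspace of the
  tensor product of the underlying vector spaces (lemma \<open>rep_ten_line\<close>), so it has at most the
  product of the two dimensions. The dimension of \<open>J(z)\<close>, on the other hand, is the length of \<open>z\<close>,
  the number of its simple summands. Hence, if \<open>J\<close> is monoidal, the length of \<open>z \<otimes> z\<close> is at most
  the square of the length of \<open>z\<close> for every object \<open>z\<close> of the center. The two-dimensional
  irreducible representation \<open>V\<close> of \<open>S\<^sub>3\<close>, with the flip as half-braiding (lemma
  \<open>half_braiding_swap_braiding\<close>), violates this: its length is \<open>1\<close>, while \<open>V \<otimes> V\<close> contains both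
  the trivial and the sign representation. In the end \<open>J(V)\<close> is a line (lemma \<open>hom_to_std_line\<close>),
  so that the module \<open>J(V) \<otimes> J(V)\<close> is contained in a line, and \<open>J(V \<otimes> V)\<close> has two independent
  vectors (lemma \<open>two_summands_of_std_squared\<close>).

  Most of the text constructs \<open>Rep(S\<^sub>3)\<close> as a pivotal fusion category. After the subgroup \<open>\<int>/3\<close> is
  diagonalized, a representation is a \<open>\<int>/3\<close>-graded space with an involution that negates degrees.
  All objects used here have a basis of homogeneous vectors which the involution permutes up to
  sign. Such an object is given by combinatorial data, a morphism is a matrix whose entries
  satisfy simple pointwise conditions, and every structure morphism of the category is the matrix
  of a bijection or a Kronecker delta. Objects are formal expressions built from the three
  irreducible representations by sums, tensor products and duals; there are countably many of
  them, so they have natural numbers as codes, and each of the operations required of the category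
  is a constructor.

  That the category is abelian and semisimple is deduced from two facts: each object is a direct sum
  of the three irreducible ones (lemma \<open>decomposition_RepS3\<close>, obtained from the orbits of the
  involution on the basis), and these three have scalar endomorphisms and no other morphisms
  between them. The deduction is an argument in arbitrary linear categories (locale
  \<open>schur_category\<close>): every morphism has a generalized inverse and every idempotent splits, and
  these two properties give kernels and cokernels.\<close>

section \<open>Semisimplicity from decompositions into Schur objects\<close>

locale linear_category =
  fixes C :: "('o, 'k::field vec) moncat" (structure)
  assumes linear: "linear_monoidal C"
begin

text \<open>Hom-sets may overlap, so source and target are part of the predicate.\<close>

definition arr :: "'o \<Rightarrow> 'o \<Rightarrow> 'k vec \<Rightarrow> bool"
  where "arr x y f \<longleftrightarrow> x \<in> ob C \<and> y \<in> ob C \<and> f \<in> hom C x y"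

lemma is_category: "category C"
  using linear by (simp add: linear_monoidal_def monoidal_category_def)

lemma arr_seq: "arr x y f \<Longrightarrow> arr y z g \<Longrightarrow> arr x z (f \<Zsemi> g)"
  using is_category unfolding arr_def category_def by metis

lemma arr_ident: "x \<in> ob C \<Longrightarrow> arr x x (\<iota> x)"
  using is_category unfolding arr_def category_def by metis

lemma ident_seq: "arr x y f \<Longrightarrow> \<iota> x \<Zsemi> f = f"
  using is_category unfolding arr_def category_def by metis

lemma seq_ident: "arr x y f \<Longrightarrow> f \<Zsemi> \<iota> y = f"
  using is_category unfolding arr_def category_def by metis

lemma seq_assoc: "arr w x f \<Longrightarrow> arr x y g \<Longrightarrow> arr y z h \<Longrightarrow> f \<Zsemi> g \<Zsemi> h = f \<Zsemi> (g \<Zsemi> h)"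
  using is_category unfolding arr_def category_def by metis

lemma hom_subspace:
  assumes "x \<in> ob C" "y \<in> ob C"
  shows "vs.subspace (hom C x y)"
proof -
  have "fin_dim_subspace (hom C x y)"
    using linear assms by (simp add: linear_monoidal_def)
  then show ?thesis by (auto simp: fin_dim_subspace_def)
qed

lemma arr_zero: "x \<in> ob C \<Longrightarrow> y \<in> ob C \<Longrightarrow> arr x y 0"
  using hom_subspace vs.subspace_0 by (auto simp: arr_def)

lemma arr_add: "arr x y f \<Longrightarrow> arr x y g \<Longrightarrow> arr x y (f + g)"
  using hom_subspace vs.subspace_add unfolding arr_def by blast

lemma arr_diff: "arr x y f \<Longrightarrow> arr x y g \<Longrightarrow> arr x y (f - g)"
  using hom_subspace vs.subspace_diff unfolding arr_def by blast

lemma arr_scl: "arr x y f \<Longrightarrow> arr x y (c *\<^sub>v f)"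
  using hom_subspace vs.subspace_scale unfolding arr_def by blast

lemma seq_bilinear:
  "x \<in> ob C \<Longrightarrow> y \<in> ob C \<Longrightarrow> z \<in> ob C \<Longrightarrow> bilinear_on (hom C x y) (hom C y z) (seq C)"
  using linear by (simp add: linear_monoidal_def)

lemma add_seq: "arr x y f \<Longrightarrow> arr x y f' \<Longrightarrow> arr y z g \<Longrightarrow> (f + f') \<Zsemi> g = (f \<Zsemi> g) + (f' \<Zsemi> g)"
  using seq_bilinear[of x y z] by (simp add: arr_def bilinear_on_def linear_on_def)

lemma seq_add: "arr x y f \<Longrightarrow> arr y z g \<Longrightarrow> arr y z g' \<Longrightarrow> f \<Zsemi> (g + g') = (f \<Zsemi> g) + (f \<Zsemi> g')"
  using seq_bilinear[of x y z] by (simp add: arr_def bilinear_on_def linear_on_def)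

lemma seq_scl: "arr x y f \<Longrightarrow> arr y z g \<Longrightarrow> f \<Zsemi> (c *\<^sub>v g) = c *\<^sub>v (f \<Zsemi> g)"
  using seq_bilinear[of x y z] by (simp add: arr_def bilinear_on_def linear_on_def)

lemma diff_seq:
  assumes "arr x y f" "arr x y f'" "arr y z g"
  shows "(f - f') \<Zsemi> g = (f \<Zsemi> g) - (f' \<Zsemi> g)"
  using add_seq[OF arr_diff[OF assms(1,2)] assms(2,3)] by simp

lemma seq_diff:
  assumes "arr x y f" "arr y z g" "arr y z g'"
  shows "f \<Zsemi> (g - g') = (f \<Zsemi> g) - (f \<Zsemi> g')"
  using seq_add[OF assms(1) arr_diff[OF assms(2,3)] assms(3)] by simp

lemma zero_seq: "arr y z g \<Longrightarrow> 0 \<Zsemi> g = 0"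
  using diff_seq[of y y 0 0 z g] arr_zero[of y y] by (simp add: arr_def)

lemma seq_zero: "arr x y f \<Longrightarrow> f \<Zsemi> 0 = 0"
  using seq_diff[of x y f y 0 0] arr_zero[of y y] by (simp add: arr_def)

lemma direct_sum_arrs:
  assumes "is_direct_sum C x D" "(t, i, p) \<in> set D"
  shows "arr t x i" "arr x t p" "i \<Zsemi> p = \<iota> t"
proof -
  obtain a where a: "a < length D" "D ! a = (t, i, p)"
    using assms(2) by (metis in_set_conv_nth)
  show "arr t x i" "arr x t p"
    using assms unfolding is_direct_sum_def arr_def by fastforce+
  note orth = assms(1)[unfolded is_direct_sum_def, THEN conjunct2, THEN conjunct2, THEN conjunct1]
  from orth[rule_format, OF a(1) a(1)] show "i \<Zsemi> p = \<iota> t" using a(2) by simp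
qed

text \<open>Composition with \<open>\<iota> x = \<Sum> p \<Zsemi> i\<close> shows that a morphism out of \<open>x\<close> is determined by its
  restrictions to the summands.\<close>

lemma arr_eq_zero_source:
  assumes D: "is_direct_sum C x D" and f: "arr x y f"
    and kill: "\<And>t i p. (t, i, p) \<in> set D \<Longrightarrow> i \<Zsemi> f = 0"
  shows "f = 0"
proof -
  have "arr x x (\<Sum>(t, i, p)\<leftarrow>L. p \<Zsemi> i) \<and> (\<Sum>(t, i, p)\<leftarrow>L. p \<Zsemi> i) \<Zsemi> f = 0" if "set L \<subseteq> set D" for L
    using that
  proof (induction L)
    case Nil
    have "arr x x 0" "0 \<Zsemi> f = 0" using f arr_zero zero_seq by (auto simp: arr_def)
    then show ?case by (simp add: zero_fun_def)
  next
    case (Cons d L)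
    obtain t i p where d: "d = (t, i, p)" by (cases d) auto
    then have d': "(t, i, p) \<in> set D" using Cons.prems by auto
    note ip = direct_sum_arrs[OF D d']
    have "p \<Zsemi> i \<Zsemi> f = 0"
      using seq_assoc[OF ip(2,1) f] kill[OF d'] seq_zero[OF ip(2)] f by (simp add: arr_def)
    moreover have "arr x x (\<Sum>(t, i, p)\<leftarrow>L. p \<Zsemi> i)" "(\<Sum>(t, i, p)\<leftarrow>L. p \<Zsemi> i) \<Zsemi> f = 0"
      using Cons by auto
    ultimately show ?case
      using add_seq[OF arr_seq[OF ip(2,1)] _ f] arr_add[OF arr_seq[OF ip(2,1)]] d
      by (simp only: list.map sum_list.Cons prod.case) simp
  qed
  from this[of D] D show ?thesis
    using ident_seq[OF f] by (simp add: is_direct_sum_def)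
qed

lemma arr_eq_zero_target:
  assumes D: "is_direct_sum C y D" and f: "arr x y f"
    and kill: "\<And>t i p. (t, i, p) \<in> set D \<Longrightarrow> f \<Zsemi> p = 0"
  shows "f = 0"
proof -
  have "arr y y (\<Sum>(t, i, p)\<leftarrow>L. p \<Zsemi> i) \<and> f \<Zsemi> (\<Sum>(t, i, p)\<leftarrow>L. p \<Zsemi> i) = 0" if "set L \<subseteq> set D" for L
    using that
  proof (induction L)
    case Nil
    have "arr y y 0" "f \<Zsemi> 0 = 0" using f arr_zero seq_zero by (auto simp: arr_def)
    then show ?case by (simp add: zero_fun_def)
  next
    case (Cons d L)
    obtain t i p where d: "d = (t, i, p)" by (cases d) auto
    then have d': "(t, i, p) \<in> set D" using Cons.prems by auto
    note ip = direct_sum_arrs[OF D d']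
    have "f \<Zsemi> (p \<Zsemi> i) = 0"
      using seq_assoc[OF f ip(2,1)] kill[OF d'] zero_seq[OF ip(1)] f by (simp add: arr_def)
    moreover have "arr y y (\<Sum>(t, i, p)\<leftarrow>L. p \<Zsemi> i)" "f \<Zsemi> (\<Sum>(t, i, p)\<leftarrow>L. p \<Zsemi> i) = 0"
      using Cons by auto
    ultimately show ?case
      using seq_add[OF f arr_seq[OF ip(2,1)]] arr_add[OF arr_seq[OF ip(2,1)]] d
      by (simp only: list.map sum_list.Cons prod.case) simp
  qed
  from this[of D] D show ?thesis
    using seq_ident[OF f] by (simp add: is_direct_sum_def)
qed

text \<open>If \<open>f \<Zsemi> g \<Zsemi> f = f\<close>, then \<open>f \<Zsemi> g\<close> and \<open>g \<Zsemi> f\<close> are idempotent, a splitting of \<open>\<iota> - f \<Zsemi> g\<close> is a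
  kernel of \<open>f\<close>, and a splitting of \<open>\<iota> - g \<Zsemi> f\<close> is a cokernel. Moreover a monomorphism \<open>f\<close> is a
  kernel of \<open>\<iota> - g \<Zsemi> f\<close> and an epimorphism \<open>f\<close> is a cokernel of \<open>\<iota> - f \<Zsemi> g\<close>.\<close>

lemma abelianI:
  assumes zero_ob: "\<exists>z\<in>ob C. \<forall>x\<in>ob C. hom C z x = {0} \<and> hom C x z = {0}"
    and sums: "\<And>x y. x \<in> ob C \<Longrightarrow> y \<in> ob C \<Longrightarrow>
      \<exists>s\<in>ob C. \<exists>i p j q. is_direct_sum C s [(x, i, p), (y, j, q)]"
    and regular: "\<And>x y f. arr x y f \<Longrightarrow> \<exists>g. arr y x g \<and> f \<Zsemi> g \<Zsemi> f = f"
    and split: "\<And>x e. arr x x e \<Longrightarrow> e \<Zsemi> e = e \<Longrightarrow>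
      \<exists>n i p. arr n x i \<and> arr x n p \<and> i \<Zsemi> p = \<iota> n \<and> p \<Zsemi> i = e"
  shows "abelian C"
proof -
  have compl: "arr x x (\<iota> x - e) \<and> (\<iota> x - e) \<Zsemi> (\<iota> x - e) = \<iota> x - e"
    if "arr x x e" "e \<Zsemi> e = e" for x e
  proof -
    have x: "arr x x (\<iota> x)" using that(1) arr_ident by (simp add: arr_def)
    have e: "arr x x (\<iota> x - e)" using arr_diff x that by blast
    have "(\<iota> x - e) \<Zsemi> (\<iota> x - e) = (\<iota> x - e) - (e \<Zsemi> (\<iota> x - e))"
      using diff_seq[OF x that(1) e] ident_seq[OF e] by simp
    also have "e \<Zsemi> (\<iota> x - e) = 0"
      using seq_diff[OF that(1) x that(1)] seq_ident[OF that(1)] that(2) by simp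
    finally show ?thesis using e by (simp only: diff_zero)
  qed
  have kernel: "\<exists>n i. is_kernel C x y f n i" if f: "arr x y f" for x y f
  proof -
    obtain g where g: "arr y x g" "f \<Zsemi> g \<Zsemi> f = f" using regular f by blast
    have fg: "arr x x (f \<Zsemi> g)" using arr_seq f g by blast
    have x: "arr x x (\<iota> x)" using f arr_ident by (simp add: arr_def)
    have "f \<Zsemi> g \<Zsemi> (f \<Zsemi> g) = f \<Zsemi> g" using seq_assoc[OF fg f g(1)] g(2) by simp
    then obtain n i p where n: "arr n x i" "arr x n p" "i \<Zsemi> p = \<iota> n" "p \<Zsemi> i = \<iota> x - (f \<Zsemi> g)"
      using split compl[OF fg] by meson
    have "p \<Zsemi> i \<Zsemi> f = 0"
      using n(4) diff_seq[OF x fg f] ident_seq[OF f] g(2) by simp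
    then have "i \<Zsemi> (p \<Zsemi> i \<Zsemi> f) = 0" using seq_zero[OF n(1)] f by (simp add: arr_def)
    moreover have "i \<Zsemi> (p \<Zsemi> i \<Zsemi> f) = i \<Zsemi> f"
      using seq_assoc[OF n(1,2) arr_seq[OF n(1) f]] seq_assoc[OF n(2,1) f] n(3)
        ident_seq[OF arr_seq[OF n(1) f]] by simp
    ultimately have "i \<Zsemi> f = 0" by simp
    moreover have "\<exists>!k. k \<in> hom C u n \<and> k \<Zsemi> i = h"
      if u: "u \<in> ob C" and "h \<in> hom C u x" and hf: "h \<Zsemi> f = 0" for u h
    proof
      have h: "arr u x h" using that f by (simp add: arr_def)
      have "h \<Zsemi> p \<Zsemi> i = (h \<Zsemi> \<iota> x) - (h \<Zsemi> (f \<Zsemi> g))"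
        using seq_assoc[OF h n(2,1)] n(4) seq_diff[OF h x fg] by simp
      also have "h \<Zsemi> (f \<Zsemi> g) = 0"
        using seq_assoc[OF h f g(1)] hf zero_seq[OF g(1)] by simp
      finally have "h \<Zsemi> p \<Zsemi> i = h" using seq_ident[OF h] by simp
      then show "h \<Zsemi> p \<in> hom C u n \<and> h \<Zsemi> p \<Zsemi> i = h"
        using arr_seq[OF h n(2)] by (simp add: arr_def)
      fix k assume k: "k \<in> hom C u n \<and> k \<Zsemi> i = h"
      then have ku: "arr u n k" using u n(1) by (simp add: arr_def)
      show "k = h \<Zsemi> p" using seq_assoc[OF ku n(1,2)] n(3) seq_ident[OF ku] k by simp
    qed
    ultimately show ?thesis using n(1) unfolding is_kernel_def arr_def by blast
  qed
  have cokernel: "\<exists>n p. is_cokernel C x y f n p" if f: "arr x y f" for x y f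
  proof -
    obtain g where g: "arr y x g" "f \<Zsemi> g \<Zsemi> f = f" using regular f by blast
    have gf: "arr y y (g \<Zsemi> f)" using arr_seq f g by blast
    have y: "arr y y (\<iota> y)" using f arr_ident by (simp add: arr_def)
    have fgf: "f \<Zsemi> (g \<Zsemi> f) = f" using seq_assoc[OF f g(1) f] g(2) by simp
    then have "g \<Zsemi> f \<Zsemi> (g \<Zsemi> f) = g \<Zsemi> f" using seq_assoc[OF g(1) f gf] by simp
    then obtain n i p where n: "arr n y i" "arr y n p" "i \<Zsemi> p = \<iota> n" "p \<Zsemi> i = \<iota> y - (g \<Zsemi> f)"
      using split compl[OF gf] by meson
    have "f \<Zsemi> (p \<Zsemi> i) = 0"
      using n(4) seq_diff[OF f y gf] seq_ident[OF f] fgf by simp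
    then have "f \<Zsemi> (p \<Zsemi> i) \<Zsemi> p = 0" using zero_seq[OF n(2)] f by (simp add: arr_def)
    moreover have "f \<Zsemi> (p \<Zsemi> i) \<Zsemi> p = f \<Zsemi> p"
      using seq_assoc[OF f arr_seq[OF n(2,1)] n(2)] seq_assoc[OF n(2,1,2)] n(3)
        seq_ident[OF n(2)] by simp
    ultimately have "f \<Zsemi> p = 0" by simp
    moreover have "\<exists>!k. k \<in> hom C n u \<and> p \<Zsemi> k = h"
      if u: "u \<in> ob C" and "h \<in> hom C y u" and fh: "f \<Zsemi> h = 0" for u h
    proof
      have h: "arr y u h" using that f by (simp add: arr_def)
      have "p \<Zsemi> (i \<Zsemi> h) = (\<iota> y \<Zsemi> h) - (g \<Zsemi> f \<Zsemi> h)"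
        using seq_assoc[OF n(2,1) h] n(4) diff_seq[OF y gf h] by simp
      also have "g \<Zsemi> f \<Zsemi> h = 0"
        using seq_assoc[OF g(1) f h] fh seq_zero[OF g(1)] by simp
      finally have "p \<Zsemi> (i \<Zsemi> h) = h" using ident_seq[OF h] by simp
      then show "i \<Zsemi> h \<in> hom C n u \<and> p \<Zsemi> (i \<Zsemi> h) = h"
        using arr_seq[OF n(1) h] by (simp add: arr_def)
      fix k assume k: "k \<in> hom C n u \<and> p \<Zsemi> k = h"
      then have ku: "arr n u k" using u n(1) by (simp add: arr_def)
      show "k = i \<Zsemi> h" using seq_assoc[OF n(1,2) ku] n(3) ident_seq[OF ku] k by simp
    qed
    ultimately show ?thesis using n(2) unfolding is_cokernel_def arr_def by blast
  qed
  have mono: "\<exists>z\<in>ob C. \<exists>g\<in>hom C y z. is_kernel C y z g x f"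
    if xy: "x \<in> ob C" "y \<in> ob C" and m: "mono_mor C x y f" for x y f
  proof -
    have f: "arr x y f" using that by (simp add: mono_mor_def arr_def)
    obtain g where g: "arr y x g" "f \<Zsemi> g \<Zsemi> f = f" using regular f by blast
    have y: "arr y y (\<iota> y)" using f arr_ident by (simp add: arr_def)
    have gf: "arr y y (g \<Zsemi> f)" using arr_seq f g by blast
    have "f \<Zsemi> (\<iota> y - (g \<Zsemi> f)) = 0"
      using seq_diff[OF f y gf] seq_ident[OF f] seq_assoc[OF f g(1) f] g(2) by simp
    moreover have "\<exists>!k. k \<in> hom C u x \<and> k \<Zsemi> f = h"
      if u: "u \<in> ob C" and "h \<in> hom C u y" and hz: "h \<Zsemi> (\<iota> y - (g \<Zsemi> f)) = 0" for u h
    proof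
      have h: "arr u y h" using that f by (simp add: arr_def)
      have "h \<Zsemi> g \<Zsemi> f = h"
        using seq_assoc[OF h g(1) f] seq_diff[OF h y gf] seq_ident[OF h] hz by simp
      then show "h \<Zsemi> g \<in> hom C u x \<and> h \<Zsemi> g \<Zsemi> f = h"
        using arr_seq[OF h g(1)] by (simp add: arr_def)
      then show "k = h \<Zsemi> g" if "k \<in> hom C u x \<and> k \<Zsemi> f = h" for k
        using m u that unfolding mono_mor_def by metis
    qed
    ultimately have "is_kernel C y y (\<iota> y - (g \<Zsemi> f)) x f"
      using f unfolding is_kernel_def arr_def by blast
    then show ?thesis using arr_diff[OF y gf] unfolding arr_def by blast
  qed
  have epi: "\<exists>z\<in>ob C. \<exists>g\<in>hom C z x. is_cokernel C z x g y f"
    if xy: "x \<in> ob C" "y \<in> ob C" and m: "epi_mor C x y f" for x y f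
  proof -
    have f: "arr x y f" using that by (simp add: epi_mor_def arr_def)
    obtain g where g: "arr y x g" "f \<Zsemi> g \<Zsemi> f = f" using regular f by blast
    have x: "arr x x (\<iota> x)" using f arr_ident by (simp add: arr_def)
    have fg: "arr x x (f \<Zsemi> g)" using arr_seq f g by blast
    have "(\<iota> x - (f \<Zsemi> g)) \<Zsemi> f = 0"
      using diff_seq[OF x fg f] ident_seq[OF f] g(2) by simp
    moreover have "\<exists>!k. k \<in> hom C y u \<and> f \<Zsemi> k = h"
      if u: "u \<in> ob C" and "h \<in> hom C x u" and hz: "(\<iota> x - (f \<Zsemi> g)) \<Zsemi> h = 0" for u h
    proof
      have h: "arr x u h" using that f by (simp add: arr_def)
      have "f \<Zsemi> (g \<Zsemi> h) = h"
        using seq_assoc[OF f g(1) h] diff_seq[OF x fg h] ident_seq[OF h] hz by simp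
      then show "g \<Zsemi> h \<in> hom C y u \<and> f \<Zsemi> (g \<Zsemi> h) = h"
        using arr_seq[OF g(1) h] by (simp add: arr_def)
      then show "k = g \<Zsemi> h" if "k \<in> hom C y u \<and> f \<Zsemi> k = h" for k
        using m u that unfolding epi_mor_def by metis
    qed
    ultimately have "is_cokernel C x x (\<iota> x - (f \<Zsemi> g)) y f"
      using f unfolding is_cokernel_def arr_def by blast
    then show ?thesis using arr_diff[OF x fg] unfolding arr_def by blast
  qed
  show ?thesis
    unfolding abelian_def using zero_ob sums kernel cokernel mono epi by (simp add: arr_def)
qed

lemma isomorphic_sym:
  assumes "isomorphic C x y"
  shows "isomorphic C y x"
proof -
  obtain f g where "inverse_pair C x y f g" using assms unfolding isomorphic_def is_iso_def by blast
  then have "inverse_pair C y x g f" unfolding inverse_pair_def by simp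
  then show ?thesis unfolding isomorphic_def is_iso_def by blast
qed

lemma isomorphic_trans:
  assumes x: "x \<in> ob C" "y \<in> ob C" "z \<in> ob C"
    and "isomorphic C x y" "isomorphic C y z"
  shows "isomorphic C x z"
proof -
  obtain f g where fg: "arr x y f" "arr y x g" "f \<Zsemi> g = \<iota> x" "g \<Zsemi> f = \<iota> y"
    using assms unfolding isomorphic_def is_iso_def inverse_pair_def arr_def by blast
  obtain h k where hk: "arr y z h" "arr z y k" "h \<Zsemi> k = \<iota> y" "k \<Zsemi> h = \<iota> z"
    using assms unfolding isomorphic_def is_iso_def inverse_pair_def arr_def by blast
  have fh: "arr x z (f \<Zsemi> h)" and kg: "arr z x (k \<Zsemi> g)" using arr_seq fg hk by blast+
  have "f \<Zsemi> h \<Zsemi> (k \<Zsemi> g) = \<iota> x"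
    using seq_assoc[OF fg(1) hk(1) kg] seq_assoc[OF hk(1,2) fg(2)] hk(3) ident_seq[OF fg(2)] fg(3)
      by simp
  moreover have "k \<Zsemi> g \<Zsemi> (f \<Zsemi> h) = \<iota> z"
    using seq_assoc[OF hk(2) fg(2) fh] seq_assoc[OF fg(2,1) hk(1)] fg(4) ident_seq[OF hk(1)] hk(4)
      by simp
  ultimately show ?thesis
    using fh kg unfolding isomorphic_def is_iso_def inverse_pair_def arr_def by blast
qed

text \<open>A decomposition of the image of the idempotent \<open>e\<close>, which need not be an object yet. The
  conditions \<open>i \<Zsemi> e = i\<close> and \<open>e \<Zsemi> p = p\<close> follow from the others; as part of the definition they
  make the extension by one summand a local computation.\<close>

definition partial_sum :: "'o \<Rightarrow> ('o \<times> 'k vec \<times> 'k vec) list \<Rightarrow> 'k vec \<Rightarrow> bool"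
  where "partial_sum x D e \<longleftrightarrow> arr x x e \<and>
    (\<forall>(t, i, p)\<in>set D. arr t x i \<and> arr x t p \<and> i \<Zsemi> e = i \<and> e \<Zsemi> p = p) \<and>
    (\<forall>a<length D. \<forall>b<length D. case D ! a of (t, i, p) \<Rightarrow> case D ! b of (t', i', p') \<Rightarrow>
      i \<Zsemi> p' = (if a = b then \<iota> t else 0)) \<and>
    (\<Sum>(t, i, p)\<leftarrow>D. p \<Zsemi> i) = e"

lemma partial_sum_Nil: "x \<in> ob C \<Longrightarrow> partial_sum x [] 0"
  using arr_zero[of x x] by (simp add: partial_sum_def)

lemma partial_sum_Cons:
  assumes D: "partial_sum x D e" and i: "arr t x i" and p: "arr x t p"
    and ip: "i \<Zsemi> p = \<iota> t" and ie: "i \<Zsemi> e = 0" and ep: "e \<Zsemi> p = 0"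
  shows "partial_sum x ((t, i, p) # D) ((p \<Zsemi> i) + e)"
proof -
  have e: "arr x x e" using D by (simp add: partial_sum_def)
  have pi: "arr x x (p \<Zsemi> i)" using arr_seq p i by blast
  have D': "arr t' x i'" "arr x t' p'" "i' \<Zsemi> e = i'" "e \<Zsemi> p' = p'"
    if "(t', i', p') \<in> set D" for t' i' p'
    using D that unfolding partial_sum_def by auto
  have cross: "i \<Zsemi> p' = 0" "i' \<Zsemi> p = 0" if d: "(t', i', p') \<in> set D" for t' i' p'
    using seq_assoc[OF i e D'(2)[OF d]] seq_assoc[OF D'(1)[OF d] e p] D'[OF d] ie ep
      zero_seq[OF D'(2)[OF d]] seq_zero[OF D'(1)[OF d]] by simp_all
  have stable: "i' \<Zsemi> ((p \<Zsemi> i) + e) = i'" "((p \<Zsemi> i) + e) \<Zsemi> p' = p'"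
    if d: "(t', i', p') \<in> set D" for t' i' p'
    using seq_add[OF D'(1)[OF d] pi e] add_seq[OF pi e D'(2)[OF d]] D'[OF d] cross[OF d]
      seq_assoc[OF D'(1)[OF d] p i] seq_assoc[OF p i D'(2)[OF d]] zero_seq[OF i] seq_zero[OF p]
    by simp_all
  have stable0: "i \<Zsemi> ((p \<Zsemi> i) + e) = i" "((p \<Zsemi> i) + e) \<Zsemi> p = p"
    using seq_add[OF i pi e] add_seq[OF pi e p] seq_assoc[OF i p i] seq_assoc[OF p i p] ip ie ep
      ident_seq[OF i] seq_ident[OF p] by simp_all
  define L where "L = (t, i, p) # D"
  have orth: "case L ! a of (t, i, p) \<Rightarrow> case L ! b of (t', i', p') \<Rightarrow> i \<Zsemi> p' =
    (if a = b then \<iota> t else 0)"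
    if "a < length L" "b < length L" for a b
  proof (cases a)
    case 0
    show ?thesis
    proof (cases b)
      case (Suc b')
      obtain t' i' p' where d: "D ! b' = (t', i', p')" by (cases "D ! b'")
      then have "(t', i', p') \<in> set D" using nth_mem[of b' D] that Suc L_def by simp
      from cross(1)[OF this] show ?thesis using 0 Suc d L_def by simp
    qed (use 0 ip L_def in simp)
  next
    case (Suc a')
    show ?thesis
    proof (cases b)
      case 0
      obtain t' i' p' where d: "D ! a' = (t', i', p')" by (cases "D ! a'")
      then have "(t', i', p') \<in> set D" using nth_mem[of a' D] that Suc L_def by simp
      from cross(2)[OF this] show ?thesis using 0 Suc d L_def by simp
    next
      case (Suc b')
      note orth = D[unfolded partial_sum_def, THEN conjunct2, THEN conjunct2, THEN conjunct1,
          rule_format, of a' b']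
      show ?thesis using orth Suc \<open>a = Suc a'\<close> that L_def by simp
    qed
  qed
  have sum: "(\<Sum>(t, i, p)\<leftarrow>D. p \<Zsemi> i) = e"
    using D[unfolded partial_sum_def] by (elim conjE)
  have "partial_sum x L ((p \<Zsemi> i) + e)"
    unfolding partial_sum_def
  proof (intro conjI ballI allI impI)
    show "arr x x ((p \<Zsemi> i) + e)" using arr_add pi e by blast
    show "case d of (t', i', p') \<Rightarrow> arr t' x i' \<and> arr x t' p' \<and> i' \<Zsemi> ((p \<Zsemi> i) + e) = i' \<and>
        ((p \<Zsemi> i) + e) \<Zsemi> p' = p'" if d: "d \<in> set L" for d
    proof -
      obtain t' i' p' where d': "d = (t', i', p')" by (cases d)
      show ?thesis
      proof (cases "(t', i', p') \<in> set D")
        case True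
        then show ?thesis using stable[OF True] D'(1,2)[OF True] d' by simp
      next
        case False
        then have "t' = t" "i' = i" "p' = p" using d d' L_def by auto
        then show ?thesis using stable0 i p d' by simp
      qed
    qed
    show "(\<Sum>(t, i, p)\<leftarrow>L. p \<Zsemi> i) = (p \<Zsemi> i) + e"
      unfolding L_def by (simp only: list.map sum_list.Cons prod.case sum)
  qed (rule orth)
  then show ?thesis by (simp only: L_def)
qed

lemma partial_sum_direct_sum: "partial_sum x D (\<iota> x) \<Longrightarrow> is_direct_sum C x D"
  unfolding partial_sum_def is_direct_sum_def arr_def by (elim conjE) (intro conjI; force)

end

text \<open>The simple objects are given in advance, with Schur's lemma in the strong form that holds
  over an algebraically closed field.\<close>

locale schur_category = linear_category +
  fixes S :: "'a set"
  assumes S_ob: "S \<subseteq> ob C"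
    and S_ident: "\<And>s. s \<in> S \<Longrightarrow> \<iota> s \<noteq> 0"
    and S_end: "\<And>s f. s \<in> S \<Longrightarrow> f \<in> hom C s s \<Longrightarrow> \<exists>c. f = c *\<^sub>v \<iota> s"
    and S_orth: "\<And>s t f. s \<in> S \<Longrightarrow> t \<in> S \<Longrightarrow> s \<noteq> t \<Longrightarrow> f \<in> hom C s t \<Longrightarrow> f = 0"
    and S_decomp: "\<And>x. x \<in> ob C \<Longrightarrow> \<exists>D. is_direct_sum C x D \<and> fst ` set D \<subseteq> S"
    and zero_object: "\<exists>z\<in>ob C. \<forall>x\<in>ob C. hom C z x = {0} \<and> hom C x z = {0}"
    and binary_sums: "\<And>x y. x \<in> ob C \<Longrightarrow> y \<in> ob C \<Longrightarrow>
      \<exists>s\<in>ob C. \<exists>i p j q. is_direct_sum C s [(x, i, p), (y, j, q)]"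
begin

text \<open>Some component \<open>s \<rightarrow> t\<close> of \<open>g\<close> is nonzero, so \<open>t = s\<close> and the component is an invertible
  scalar.\<close>

lemma nonzero_arr_retract:
  assumes s: "s \<in> S" and g: "arr s y g" "g \<noteq> 0"
  shows "\<exists>q. arr y s q \<and> g \<Zsemi> q = \<iota> s"
proof -
  obtain D where D: "is_direct_sum C y D" "fst ` set D \<subseteq> S"
    using S_decomp g unfolding arr_def by blast
  obtain t j q where d: "(t, j, q) \<in> set D" "g \<Zsemi> q \<noteq> 0"
    using arr_eq_zero_target[OF D(1) g(1)] g(2) by blast
  note jq = direct_sum_arrs[OF D(1) d(1)]
  have gq: "arr s t (g \<Zsemi> q)" using arr_seq g(1) jq(2) by blast
  have "t \<in> S" using D(2) d(1) by force
  then have "t = s" using S_orth[OF s] gq d(2) by (auto simp: arr_def)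
  then obtain c where c: "g \<Zsemi> q = c *\<^sub>v \<iota> s" using S_end[OF s] gq by (auto simp: arr_def)
  then have "c \<noteq> 0" using d(2) by auto
  then have "g \<Zsemi> (inverse c *\<^sub>v q) = \<iota> s" using seq_scl[OF g(1) jq(2)] c by simp
  moreover have "arr y s (inverse c *\<^sub>v q)" using arr_scl jq(2) \<open>t = s\<close> by blast
  ultimately show ?thesis by blast
qed

text \<open>The measure for the two inductions below, which play the role of Gaussian elimination: each
  step kills one more summand of \<open>x\<close>.\<close>

lemma card_killed_less:
  assumes "(t, i, p) \<in> set D" "i \<Zsemi> f \<noteq> 0" "i \<Zsemi> f' = 0"
    and "\<And>t i p. (t, i, p) \<in> set D \<Longrightarrow> i \<Zsemi> f = 0 \<Longrightarrow> i \<Zsemi> f' = 0"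
  shows "card {(t, i, p) \<in> set D. i \<Zsemi> f' \<noteq> 0} < card {(t, i, p) \<in> set D. i \<Zsemi> f \<noteq> 0}"
proof (rule psubset_card_mono)
  have "{(t, i, p) \<in> set D. i \<Zsemi> f' \<noteq> 0} \<subseteq> {(t, i, p) \<in> set D. i \<Zsemi> f \<noteq> 0}"
    using assms(4) by auto
  moreover have "(t, i, p) \<in> {(t, i, p) \<in> set D. i \<Zsemi> f \<noteq> 0} - {(t, i, p) \<in> set D. i \<Zsemi> f' \<noteq> 0}"
    using assms by auto
  ultimately show "{(t, i, p) \<in> set D. i \<Zsemi> f' \<noteq> 0} \<subset> {(t, i, p) \<in> set D. i \<Zsemi> f \<noteq> 0}"
    by blast
  show "finite {(t, i, p) \<in> set D. i \<Zsemi> f \<noteq> 0}"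
    by (rule finite_subset[of _ "set D"]) auto
qed

text \<open>McCoy's lemma: if \<open>f - f u f\<close> has a generalized inverse \<open>g'\<close>, then \<open>u + (1 - u f) g' (1 - f
  u)\<close> is one of \<open>f\<close>. The morphism \<open>u\<close> inverts \<open>f\<close> on one summand of \<open>x\<close> on which \<open>f\<close> does not
  vanish, so that the difference vanishes on this summand.\<close>

lemma regular:
  assumes "arr x y f"
  shows "\<exists>g. arr y x g \<and> f \<Zsemi> g \<Zsemi> f = f"
proof -
  obtain D where D: "is_direct_sum C x D" "fst ` set D \<subseteq> S"
    using S_decomp assms unfolding arr_def by blast
  show ?thesis using assms
  proof (induction "card {(t, i, p) \<in> set D. i \<Zsemi> f \<noteq> 0}" arbitrary: f rule: less_induct)
    case less
    note f = less.prems
    show ?case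
    proof (cases "f = 0")
      case True
      then show ?thesis using arr_zero[of y x] f zero_seq[of x y f] zero_seq[of y x 0]
        by (metis arr_def)
    next
      case False
      then obtain t i p where d: "(t, i, p) \<in> set D" "i \<Zsemi> f \<noteq> 0"
        using arr_eq_zero_source[OF D(1) f] by blast
      note ip = direct_sum_arrs[OF D(1) d(1)]
      have "t \<in> S" using D(2) d(1) by force
      then obtain q where q: "arr y t q" "i \<Zsemi> f \<Zsemi> q = \<iota> t"
        using nonzero_arr_retract[OF _ arr_seq[OF ip(1) f] d(2)] by blast
      define u where "u = q \<Zsemi> i"
      have u: "arr y x u" unfolding u_def using arr_seq q ip by blast
      have x: "arr x x (\<iota> x)" and y: "arr y y (\<iota> y)" using f arr_ident by (auto simp: arr_def)
      have uf: "arr y y (u \<Zsemi> f)" and fu: "arr x x (f \<Zsemi> u)" using arr_seq u f by blast+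
      have fuf: "arr x y (f \<Zsemi> u \<Zsemi> f)" using arr_seq fu f by blast
      define f' where "f' = f - (f \<Zsemi> u \<Zsemi> f)"
      have f': "arr x y f'" unfolding f'_def using arr_diff f fuf by blast
      have "i \<Zsemi> (f \<Zsemi> u \<Zsemi> f) = i \<Zsemi> f \<Zsemi> q \<Zsemi> (i \<Zsemi> f)"
        unfolding u_def
        using seq_assoc[OF f u f] seq_assoc[OF q(1) ip(1) f]
          seq_assoc[OF arr_seq[OF ip(1) f] q(1) arr_seq[OF ip(1) f]]
          seq_assoc[OF ip(1) f arr_seq[OF q(1) arr_seq[OF ip(1) f]]] u_def by simp
      then have "i \<Zsemi> f' = 0"
        unfolding f'_def using seq_diff[OF ip(1) f fuf] q(2) ident_seq[OF arr_seq[OF ip(1) f]]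
          by simp
      moreover have "i' \<Zsemi> f' = 0" if d': "(t', i', p') \<in> set D" and 0: "i' \<Zsemi> f = 0" for t' i' p'
      proof -
        note i' = direct_sum_arrs(1)[OF D(1) d']
        have "i' \<Zsemi> (f \<Zsemi> u \<Zsemi> f) = i' \<Zsemi> f \<Zsemi> (u \<Zsemi> f)"
          using seq_assoc[OF f u f] seq_assoc[OF i' f uf] by simp
        also have "\<dots> = 0" using 0 zero_seq[OF uf] i' by (simp add: arr_def)
        finally show ?thesis unfolding f'_def using seq_diff[OF i' f fuf] 0 by simp
      qed
      ultimately obtain g' where g': "arr y x g'" "f' \<Zsemi> g' \<Zsemi> f' = f'"
        using less.hyps[OF card_killed_less[OF d] f'] by blast
      define a where "a = \<iota> y - (u \<Zsemi> f)"
      define b where "b = \<iota> x - (f \<Zsemi> u)"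
      have a: "arr y y a" and b: "arr x x b" unfolding a_def b_def using arr_diff x y uf fu
        by blast+
      have fa: "f \<Zsemi> a = f'"
        unfolding a_def f'_def using seq_diff[OF f y uf] seq_ident[OF f] seq_assoc[OF f u f] by simp
      have bf: "b \<Zsemi> f = f'"
        unfolding b_def f'_def using diff_seq[OF x fu f] ident_seq[OF f] by simp
      have agb: "arr y x (a \<Zsemi> g' \<Zsemi> b)" using arr_seq a g' b by blast
      have "f \<Zsemi> (u + (a \<Zsemi> g' \<Zsemi> b)) \<Zsemi> f = (f \<Zsemi> u \<Zsemi> f) + (f \<Zsemi> (a \<Zsemi> g' \<Zsemi> b) \<Zsemi> f)"
        using seq_add[OF f u agb] add_seq[OF fu arr_seq[OF f agb] f] by simp
      also have "f \<Zsemi> (a \<Zsemi> g' \<Zsemi> b) \<Zsemi> f = f \<Zsemi> a \<Zsemi> g' \<Zsemi> (b \<Zsemi> f)"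
        using seq_assoc[OF arr_seq[OF a g'(1)] b f] seq_assoc[OF f agb f]
          seq_assoc[OF f a g'(1)] seq_assoc[OF f arr_seq[OF a g'(1)] arr_seq[OF b f]] by simp
      also have "(f \<Zsemi> u \<Zsemi> f) + \<dots> = f" using fa bf g'(2) f'_def by simp
      finally show ?thesis using arr_add[OF u agb] by blast
    qed
  qed
qed

text \<open>An idempotent \<open>e \<noteq> 0\<close> has a simple summand \<open>t\<close>, embedded by \<open>j = i \<Zsemi> e\<close> and with projection
  \<open>r\<close>. The idempotent \<open>e - r \<Zsemi> j\<close> splits by induction through some \<open>n\<close>, and \<open>e\<close> splits through \<open>n
  \<oplus> t\<close>.\<close>

lemma split_idempotent:
  assumes "arr x x e" "e \<Zsemi> e = e"
  shows "\<exists>n i p. arr n x i \<and> arr x n p \<and> i \<Zsemi> p = \<iota> n \<and> p \<Zsemi> i = e"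
proof -
  obtain D where D: "is_direct_sum C x D" "fst ` set D \<subseteq> S"
    using S_decomp assms unfolding arr_def by blast
  show ?thesis using assms
  proof (induction "card {(t, i, p) \<in> set D. i \<Zsemi> e \<noteq> 0}" arbitrary: e rule: less_induct)
    case less
    note e = less.prems
    show ?case
    proof (cases "e = 0")
      case True
      obtain z where z: "z \<in> ob C" "hom C z x = {0}" "hom C x z = {0}" "hom C z z = {0}"
        using zero_object e by (auto simp: arr_def)
      have "\<iota> z = 0" using arr_ident[of z] z by (simp add: arr_def)
      moreover have "arr z x 0" "arr x z 0" using arr_zero z(1) e(1) by (auto simp: arr_def)
      ultimately show ?thesis using True zero_seq seq_zero by (metis arr_def)
    next
      case False
      then obtain t i p where d: "(t, i, p) \<in> set D" "i \<Zsemi> e \<noteq> 0"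
        using arr_eq_zero_source[OF D(1) e(1)] by blast
      note ip = direct_sum_arrs[OF D(1) d(1)]
      have "t \<in> S" using D(2) d(1) by force
      then obtain q where q: "arr x t q" "i \<Zsemi> e \<Zsemi> q = \<iota> t"
        using nonzero_arr_retract[OF _ arr_seq[OF ip(1) e(1)] d(2)] by blast
      define j where "j = i \<Zsemi> e"
      define r where "r = e \<Zsemi> q"
      have j: "arr t x j" and r: "arr x t r" unfolding j_def r_def using arr_seq ip q e by blast+
      have je: "j \<Zsemi> e = j" unfolding j_def using seq_assoc[OF ip(1) e(1) e(1)] e(2) by simp
      have er: "e \<Zsemi> r = r" unfolding r_def using seq_assoc[OF e(1) e(1) q(1)] e(2) by simp
      have jr: "j \<Zsemi> r = \<iota> t"
        unfolding r_def using seq_assoc[OF j e(1) q(1)] je q(2) j_def by simp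
      have rj: "arr x x (r \<Zsemi> j)" using arr_seq r j by blast
      define e' where "e' = e - (r \<Zsemi> j)"
      have e': "arr x x e'" unfolding e'_def using arr_diff e(1) rj by blast
      have je': "j \<Zsemi> e' = 0"
        unfolding e'_def using seq_diff[OF j e(1) rj] je seq_assoc[OF j r j] jr ident_seq[OF j]
          by simp
      have e'r: "e' \<Zsemi> r = 0"
        unfolding e'_def using diff_seq[OF e(1) rj r] er seq_assoc[OF r j r] jr seq_ident[OF r]
          by simp
      have ee': "e \<Zsemi> e' = e'"
        unfolding e'_def using seq_diff[OF e(1) e(1) rj] e(2) seq_assoc[OF e(1) r j] er by simp
      have "e' \<Zsemi> e' = (e \<Zsemi> e') - (r \<Zsemi> (j \<Zsemi> e'))"
        using diff_seq[OF e(1) rj e'] seq_assoc[OF r j e'] e'_def by simp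
      then have idem: "e' \<Zsemi> e' = e'"
        using ee' je' seq_zero[OF r] e(1) by (simp add: arr_def)
      have "i \<Zsemi> e' = i \<Zsemi> (e \<Zsemi> e')" using ee' by simp
      also have "\<dots> = 0" using seq_assoc[OF ip(1) e(1) e'] je' j_def by simp
      finally have "i \<Zsemi> e' = 0" .
      moreover have "i' \<Zsemi> e' = 0" if d': "(t', i', p') \<in> set D" and 0: "i' \<Zsemi> e = 0" for t' i' p'
      proof -
        note i' = direct_sum_arrs(1)[OF D(1) d']
        have "i' \<Zsemi> e' = i' \<Zsemi> e \<Zsemi> e'" using seq_assoc[OF i' e(1) e'] ee' by simp
        then show ?thesis using 0 zero_seq[OF e'] i' by (simp add: arr_def)
      qed
      ultimately obtain n i' p' where n: "arr n x i'" "arr x n p'" "i' \<Zsemi> p' = \<iota> n" "p' \<Zsemi> i' = e'"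
        using less.hyps[OF card_killed_less[OF d] e' idem] by blast
      obtain s i1 p1 i2 p2 where s: "is_direct_sum C s [(n, i1, p1), (t, i2, p2)]"
        using binary_sums n(1) j by (meson arr_def)
      have a1: "arr n s i1" "arr s n p1" "arr t s i2" "arr s t p2"
        using direct_sum_arrs[OF s, of n i1 p1] direct_sum_arrs[OF s, of t i2 p2] by auto
      have a2: "i1 \<Zsemi> p1 = \<iota> n" "i2 \<Zsemi> p2 = \<iota> t"
        using direct_sum_arrs[OF s, of n i1 p1] direct_sum_arrs[OF s, of t i2 p2] by auto
      have a3: "i1 \<Zsemi> p2 = 0" "i2 \<Zsemi> p1 = 0" "(p1 \<Zsemi> i1) + (p2 \<Zsemi> i2) = \<iota> s"
        using s unfolding is_direct_sum_def by (auto simp: All_less_Suc2)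
      have i'r: "i' \<Zsemi> r = 0"
      proof -
        have "i' \<Zsemi> r = i' \<Zsemi> p' \<Zsemi> i' \<Zsemi> r" using n(3) ident_seq[OF n(1)] by simp
        also have "\<dots> = i' \<Zsemi> (e' \<Zsemi> r)" using n(4) seq_assoc[OF n(1) n(2,1)]
          seq_assoc[OF n(1) arr_seq[OF n(2,1)] r] by simp
        finally show ?thesis using e'r seq_zero[OF n(1)] r by (simp add: arr_def)
      qed
      have jp': "j \<Zsemi> p' = 0"
      proof -
        have "j \<Zsemi> p' = j \<Zsemi> (p' \<Zsemi> i' \<Zsemi> p')" using n(3) seq_ident[OF n(2)] seq_assoc[OF n(2,1,2)]
          by simp
        also have "\<dots> = j \<Zsemi> e' \<Zsemi> p'" using n(4) seq_assoc[OF j arr_seq[OF n(2,1)] n(2)] by simp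
        finally show ?thesis using je' zero_seq[OF n(2)] j by (simp add: arr_def)
      qed
      define I where "I = (p1 \<Zsemi> i') + (p2 \<Zsemi> j)"
      define P where "P = (p' \<Zsemi> i1) + (r \<Zsemi> i2)"
      have arrs: "arr s x (p1 \<Zsemi> i')" "arr s x (p2 \<Zsemi> j)" "arr x s (p' \<Zsemi> i1)" "arr x s (r \<Zsemi> i2)"
        using arr_seq a1 n j r by blast+
      have I: "arr s x I" and P: "arr x s P" unfolding I_def P_def using arr_add arrs by blast+
      have i1I: "i1 \<Zsemi> I = i'"
        unfolding I_def using seq_add[OF a1(1) arrs(1,2)] seq_assoc[OF a1(1,2) n(1)]
          seq_assoc[OF a1(1,4) j] a2 a3 ident_seq[OF n(1)] zero_seq[OF j] n(1)
            by (simp add: arr_def)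
      have i2I: "i2 \<Zsemi> I = j"
        unfolding I_def using seq_add[OF a1(3) arrs(1,2)] seq_assoc[OF a1(3,2) n(1)]
          seq_assoc[OF a1(3,4) j] a2 a3 ident_seq[OF j] zero_seq[OF n(1)] j by (simp add: arr_def)
      have "P \<Zsemi> I = (p' \<Zsemi> i') + (r \<Zsemi> j)"
        unfolding P_def using add_seq[OF arrs(3,4) I] seq_assoc[OF n(2) a1(1) I]
          seq_assoc[OF r a1(3) I] i1I i2I by simp
      then have PI: "P \<Zsemi> I = e" using n(4) e'_def by simp
      have i'P: "i' \<Zsemi> P = i1"
        unfolding P_def using seq_add[OF n(1) arrs(3,4)] seq_assoc[OF n(1,2) a1(1)]
          seq_assoc[OF n(1) r a1(3)] n(3) i'r ident_seq[OF a1(1)] zero_seq[OF a1(3)] n(1)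
        by (simp add: arr_def)
      have jP: "j \<Zsemi> P = i2"
        unfolding P_def using seq_add[OF j arrs(3,4)] seq_assoc[OF j n(2) a1(1)]
          seq_assoc[OF j r a1(3)] jr jp' ident_seq[OF a1(3)] zero_seq[OF a1(1)] j
        by (simp add: arr_def)
      have "I \<Zsemi> P = (p1 \<Zsemi> i1) + (p2 \<Zsemi> i2)"
        unfolding I_def using add_seq[OF arrs(1,2) P] seq_assoc[OF a1(2) n(1) P]
          seq_assoc[OF a1(4) j P] i'P jP by simp
      then show ?thesis using a3(3) PI I P by metis
    qed
  qed
qed

lemma abelian: "abelian C"
  by (rule abelianI[OF zero_object binary_sums regular split_idempotent])

text \<open>A generalized inverse of a monomorphism \<open>i\<close> into \<open>s\<close> is a left inverse; the other composite
  is a scalar, and \<open>i\<close> is zero unless the scalar is \<open>1\<close>.\<close>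

lemma S_simple:
  assumes s: "s \<in> S"
  shows "simple C s"
proof -
  have "is_iso C u s i" if u: "u \<in> ob C" and m: "mono_mor C u s i" and i0: "i \<noteq> 0" for u i
  proof -
    have i: "arr u s i" using s S_ob that by (auto simp: mono_mor_def arr_def)
    obtain g where g: "arr s u g" "i \<Zsemi> g \<Zsemi> i = i" using regular[OF i] by blast
    have "i \<Zsemi> g = \<iota> u"
      using m g i arr_seq[OF i g(1)] arr_ident[OF u] ident_seq[OF i] unfolding mono_mor_def arr_def
      by metis
    moreover obtain c where c: "g \<Zsemi> i = c *\<^sub>v \<iota> s"
      using S_end[OF s] arr_seq[OF g(1) i] by (auto simp: arr_def)
    have ss: "arr s s (\<iota> s)" using s S_ob arr_ident by blast
    have "i = c *\<^sub>v i"
      using g(2) seq_assoc[OF i g(1) i] c seq_scl[OF i ss] seq_ident[OF i] by simp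
    then have "c = 1" using i0 vs.scale_right_imp_eq[of i c 1] by simp
    ultimately have "inverse_pair C u s i g"
      using i g c by (simp add: inverse_pair_def arr_def)
    then show ?thesis by (auto simp: is_iso_def)
  qed
  then show ?thesis using s S_ob S_ident by (auto simp: simple_def)
qed

lemma simple_isomorphic_S:
  assumes "simple C x"
  shows "\<exists>s\<in>S. isomorphic C s x"
proof -
  have x: "x \<in> ob C" "\<iota> x \<noteq> 0" using assms by (auto simp: simple_def)
  obtain D where D: "is_direct_sum C x D" "fst ` set D \<subseteq> S" using S_decomp x by blast
  then have "D \<noteq> []" using x(2) by (auto simp: is_direct_sum_def)
  then obtain t i p where d: "(t, i, p) \<in> set D" by (cases D) auto
  note ip = direct_sum_arrs[OF D(1) d]
  have t: "t \<in> S" using D(2) d by force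
  have cancel: "g = h" if gh: "arr u t g" "arr u t h" "g \<Zsemi> i = h \<Zsemi> i" for u g h
  proof -
    have "g = g \<Zsemi> i \<Zsemi> p" using seq_assoc[OF gh(1) ip(1,2)] ip(3) seq_ident[OF gh(1)] by simp
    also have "\<dots> = h \<Zsemi> i \<Zsemi> p" by (simp only: gh(3))
    also have "\<dots> = h" using seq_assoc[OF gh(2) ip(1,2)] ip(3) seq_ident[OF gh(2)] by simp
    finally show ?thesis .
  qed
  have "mono_mor C t x i"
    unfolding mono_mor_def using ip(1) by (auto simp: arr_def intro: cancel)
  moreover have "i \<noteq> 0" using ip(3) zero_seq[OF ip(2)] S_ident[OF t] ip(1) by (auto simp: arr_def)
  ultimately have "is_iso C t x i" using assms ip(1) by (auto simp: simple_def arr_def)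
  then show ?thesis using t by (auto simp: isomorphic_def)
qed

lemma S_isomorphic_eq:
  assumes "s \<in> S" "t \<in> S" "isomorphic C s t"
  shows "s = t"
proof (rule ccontr)
  assume "s \<noteq> t"
  obtain f g where "inverse_pair C s t f g" using assms by (auto simp: isomorphic_def is_iso_def)
  then have "arr t s g" "f = 0" "f \<Zsemi> g = \<iota> s"
    using S_orth[OF assms(1,2) \<open>s \<noteq> t\<close>] assms(1,2) S_ob by (auto simp: inverse_pair_def arr_def)
  then show False using zero_seq[of t s g] S_ident[OF assms(1)] by (simp add: arr_def)
qed

lemma S_complete: "complete_simples C S"
  unfolding complete_simples_def
proof (intro conjI ballI allI impI)
  show "simple C s" if "s \<in> S" for s using S_simple that .
  show "s = t" if "s \<in> S" "t \<in> S" "isomorphic C s t" for s t using S_isomorphic_eq that .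
  show "\<exists>s\<in>S. isomorphic C x s" if "simple C x" for x
    using simple_isomorphic_S[OF that] isomorphic_sym by blast
qed

lemma semisimple: "semisimple C"
  unfolding semisimple_def
proof (intro conjI ballI)
  show "abelian C" by (rule abelian)
  fix x assume "x \<in> ob C"
  then obtain D where "is_direct_sum C x D" "fst ` set D \<subseteq> S" using S_decomp by blast
  then show "\<exists>D. is_direct_sum C x D \<and> (\<forall>(t, i, p)\<in>set D. simple C t)"
    by (intro exI[of _ D]) (force intro: S_simple)
qed

end

section \<open>Representations of \<open>S\<^sub>3\<close> as graded spaces with an involution\<close>

text \<open>The constructors \<open>RTriv\<close>, \<open>RSign\<close>, \<open>RStd\<close> stand for the trivial, the sign and the
  two-dimensional irreducible representation.\<close>

datatype rep_expr = RZero | RTriv | RSign | RStd | RSum rep_expr rep_expr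
  | RTensor rep_expr rep_expr | RDual rep_expr

instance rep_expr :: countable
  by countable_datatype

definition fst_code :: "nat \<Rightarrow> nat" where "fst_code n = fst (prod_decode n)"
definition snd_code :: "nat \<Rightarrow> nat" where "snd_code n = snd (prod_decode n)"

abbreviation pair_code :: "nat \<Rightarrow> nat \<Rightarrow> nat" ("\<langle>_,/ _\<rangle>")
  where "\<langle>i, j\<rangle> \<equiv> prod_encode (i, j)"

lemma pair_code_simps [simp]: "fst_code \<langle>i, j\<rangle> = i" "snd_code \<langle>i, j\<rangle> = j"
  "\<langle>fst_code n, snd_code n\<rangle> = n"
  by (simp_all add: fst_code_def snd_code_def)

lemma prod_decode_code: "prod_decode n = (fst_code n, snd_code n)"
  by (simp add: fst_code_def snd_code_def)

lemma pair_eq_iff [simp]: "\<langle>i, j\<rangle> = \<langle>i', j'\<rangle> \<longleftrightarrow> i = i' \<and> j = j'"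
  by (simp add: prod_encode_eq)

lemma nat_eq_pair_iff:
  "n = \<langle>i, j\<rangle> \<longleftrightarrow> fst_code n = i \<and> snd_code n = j" "\<langle>i, j\<rangle> = n \<longleftrightarrow> fst_code n = i \<and> snd_code n = j"
  by (metis pair_code_simps)+

text \<open>A representation is recorded by a finite basis, the degrees of the basis vectors (integers,
  relevant modulo \<open>3\<close>), and the involution \<open>e\<^sub>i \<mapsto> s\<^sub>i e\<^sub>\<tau>\<^sub>(\<^sub>i\<^sub>)\<close> with a permutation \<open>\<tau>\<close> of the
  basis and signs \<open>s\<^sub>i\<close>. The four functions below give the basis, the degrees, \<open>\<tau>\<close> and the signs.
  Bases of tensor products consist of codes of pairs, not of positions in a Kronecker product: in
  this way the tensor product of two matrices depends only on the matrices and not on their sizes,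
  as the type of the tensor product of morphisms demands. The price is an associator that is not
  the identity.\<close>

primrec expr_basis :: "rep_expr \<Rightarrow> nat set" where
  "expr_basis RZero = {}"
| "expr_basis RTriv = {0}"
| "expr_basis RSign = {0}"
| "expr_basis RStd = {0, 1}"
| "expr_basis (RSum x y) = sum_encode ` (expr_basis x <+> expr_basis y)"
| "expr_basis (RTensor x y) = prod_encode ` (expr_basis x \<times> expr_basis y)"
| "expr_basis (RDual x) = expr_basis x"

primrec expr_grade :: "rep_expr \<Rightarrow> nat \<Rightarrow> int" where
  "expr_grade RZero = (\<lambda>n. 0)"
| "expr_grade RTriv = (\<lambda>n. 0)"
| "expr_grade RSign = (\<lambda>n. 0)"
| "expr_grade RStd = (\<lambda>n. if n = 0 then 1 else - 1)"
| "expr_grade (RSum x y) = (\<lambda>n. case_sum (expr_grade x) (expr_grade y) (sum_decode n))"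
| "expr_grade (RTensor x y) = (\<lambda>n. expr_grade x (fst_code n) + expr_grade y (snd_code n))"
| "expr_grade (RDual x) = (\<lambda>n. - expr_grade x n)"

primrec expr_invol :: "rep_expr \<Rightarrow> nat \<Rightarrow> nat" where
  "expr_invol RZero = (\<lambda>n. n)"
| "expr_invol RTriv = (\<lambda>n. n)"
| "expr_invol RSign = (\<lambda>n. n)"
| "expr_invol RStd = (\<lambda>n. 1 - n)"
| "expr_invol (RSum x y) = (\<lambda>n. sum_encode (map_sum (expr_invol x) (expr_invol y) (sum_decode n)))"
| "expr_invol (RTensor x y) = (\<lambda>n. \<langle>expr_invol x (fst_code n), expr_invol y (snd_code n)\<rangle>)"
| "expr_invol (RDual x) = expr_invol x"

primrec expr_sign :: "rep_expr \<Rightarrow> nat \<Rightarrow> 'k::field" where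
  "expr_sign RZero = (\<lambda>n. 1)"
| "expr_sign RTriv = (\<lambda>n. 1)"
| "expr_sign RSign = (\<lambda>n. - 1)"
| "expr_sign RStd = (\<lambda>n. 1)"
| "expr_sign (RSum x y) = (\<lambda>n. case_sum (expr_sign x) (expr_sign y) (sum_decode n))"
| "expr_sign (RTensor x y) = (\<lambda>n. expr_sign x (fst_code n) * expr_sign y (snd_code n))"
| "expr_sign (RDual x) = expr_sign x"

lemma finite_expr_basis: "finite (expr_basis x)"
  by (induction x) auto

lemma expr_invol_basis: "i \<in> expr_basis x \<Longrightarrow> expr_invol x i \<in> expr_basis x"
  by (induction x arbitrary: i) auto

lemma expr_invol_invol: "i \<in> expr_basis x \<Longrightarrow> expr_invol x (expr_invol x i) = i"
  by (induction x arbitrary: i) auto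

lemma expr_sign_invol: "i \<in> expr_basis x \<Longrightarrow> expr_sign x (expr_invol x i) = expr_sign x i"
  by (induction x arbitrary: i) auto

lemma expr_sign_sq: "expr_sign x i * expr_sign x i = 1"
  by (induction x arbitrary: i) (auto simp: algebra_simps split: sum.split)

lemma expr_grade_invol: "i \<in> expr_basis x \<Longrightarrow> 3 dvd expr_grade x (expr_invol x i) + expr_grade x i"
proof (induction x arbitrary: i)
  case (RTensor x y)
  then have "3 dvd expr_grade x (expr_invol x (fst_code i)) + expr_grade x (fst_code i)"
    "3 dvd expr_grade y (expr_invol y (snd_code i)) + expr_grade y (snd_code i)" by auto
  from dvd_add[OF this] show ?case by (simp add: add_ac)
next
  case (RDual x)
  then have "3 dvd - (expr_grade x (expr_invol x i) + expr_grade x i)"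
    by (simp only: dvd_minus_iff) simp
  then show ?case by (simp add: algebra_simps)
qed auto

text \<open>From here on objects are codes, and the equations below replace the expressions. Since every
  natural number decodes to an expression, all natural numbers are objects.\<close>

definition basis :: "nat \<Rightarrow> nat set" where "basis x = expr_basis (from_nat x)"
definition grade :: "nat \<Rightarrow> nat \<Rightarrow> int" where "grade x = expr_grade (from_nat x)"
definition invol :: "nat \<Rightarrow> nat \<Rightarrow> nat" where "invol x = expr_invol (from_nat x)"
definition sign :: "nat \<Rightarrow> nat \<Rightarrow> 'k::field" where "sign x = expr_sign (from_nat x)"

lemmas rep_defs = basis_def grade_def invol_def sign_def

definition zero_ob :: nat where "zero_ob = to_nat RZero"
definition triv_ob :: nat where "triv_ob = to_nat RTriv"
definition sign_ob :: nat where "sign_ob = to_nat RSign"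
definition std_ob :: nat where "std_ob = to_nat RStd"
definition sum_ob :: "nat \<Rightarrow> nat \<Rightarrow> nat" where "sum_ob x y = to_nat (RSum (from_nat x) (from_nat y))"
definition tensor_ob :: "nat \<Rightarrow> nat \<Rightarrow> nat" where "tensor_ob x y =
  to_nat (RTensor (from_nat x) (from_nat y))"
definition dual_ob :: "nat \<Rightarrow> nat" where "dual_ob x = to_nat (RDual (from_nat x))"

lemmas ob_defs = zero_ob_def triv_ob_def sign_ob_def std_ob_def sum_ob_def tensor_ob_def dual_ob_def

lemma basis_simps [simp]:
  "basis zero_ob = {}" "basis triv_ob = {0}" "basis sign_ob = {0}" "basis std_ob = {0, 1}"
  "basis (sum_ob x y) = sum_encode ` (basis x <+> basis y)"
  "basis (dual_ob x) = basis x"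
  unfolding rep_defs ob_defs by simp_all

lemma basis_ten: "basis (tensor_ob x y) = prod_encode ` (basis x \<times> basis y)"
  by (simp add: rep_defs ob_defs)

lemma in_basis_ten [simp]: "n \<in> basis (tensor_ob x y) \<longleftrightarrow> fst_code n \<in> basis x \<and> snd_code n \<in> basis y"
  by (auto simp: basis_ten) (metis image_iff mem_Sigma_iff pair_code_simps(3))

lemma grade_simps [simp]:
  "grade triv_ob n = 0" "grade sign_ob n = 0" "grade std_ob n = (if n = 0 then 1 else - 1)"
  "grade (sum_ob x y) n = case_sum (grade x) (grade y) (sum_decode n)"
  "grade (tensor_ob x y) n = grade x (fst_code n) + grade y (snd_code n)"
  "grade (dual_ob x) n = - grade x n"
  unfolding rep_defs ob_defs by simp_all

lemma invol_simps [simp]: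
  "invol triv_ob n = n" "invol sign_ob n = n" "invol std_ob n = 1 - n"
  "invol (sum_ob x y) n = sum_encode (map_sum (invol x) (invol y) (sum_decode n))"
  "invol (tensor_ob x y) n = \<langle>invol x (fst_code n), invol y (snd_code n)\<rangle>"
  "invol (dual_ob x) n = invol x n"
  unfolding rep_defs ob_defs by simp_all

lemma sign_simps [simp]:
  "sign triv_ob n = 1" "sign sign_ob n = - 1" "sign std_ob n = 1"
  "sign (sum_ob x y) n = case_sum (sign x) (sign y) (sum_decode n)"
  "sign (tensor_ob x y) n = sign x (fst_code n) * sign y (snd_code n)"
  "sign (dual_ob x) n = sign x n"
  unfolding rep_defs ob_defs by simp_all

lemma finite_basis [simp]: "finite (basis x)"
  by (simp add: rep_defs finite_expr_basis)

lemma invol_basis [simp]: "i \<in> basis x \<Longrightarrow> invol x i \<in> basis x"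
  by (simp add: rep_defs expr_invol_basis)

lemma invol_invol [simp]: "i \<in> basis x \<Longrightarrow> invol x (invol x i) = i"
  by (simp add: rep_defs expr_invol_invol)

lemma sign_invol [simp]: "i \<in> basis x \<Longrightarrow> sign x (invol x i) = sign x i"
  by (simp add: rep_defs expr_sign_invol)

lemma sign_sq [simp]: "sign x i * sign x i = 1" "sign x i * (sign x i * a) = a"
  by (simp_all add: rep_defs expr_sign_sq flip: mult.assoc)

lemma grade_invol: "i \<in> basis x \<Longrightarrow> 3 dvd grade x (invol x i) + grade x i"
  by (simp add: rep_defs expr_grade_invol)

lemma bij_invol: "bij_betw (invol x) (basis x) (basis x)"
  by (rule bij_betw_byWitness[where f' = "invol x"]) auto

lemma invol_inj: "i \<in> basis x \<Longrightarrow> j \<in> basis x \<Longrightarrow> invol x i = invol x j \<longleftrightarrow> i = j"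
  by (metis invol_invol)

definition mat :: "(nat \<Rightarrow> nat \<Rightarrow> 'k) \<Rightarrow> 'k vec"
  where "mat F = (\<lambda>n. F (fst_code n) (snd_code n))"

lemma mat_entry [simp]: "mat F \<langle>i, j\<rangle> = F i j"
  by (simp add: mat_def)

lemma mat_eqI:
  assumes "\<And>i j. f \<langle>i, j\<rangle> = g \<langle>i, j\<rangle>"
  shows "f = g"
  using assms by (metis pair_code_simps(3) ext)

lemma scl_apply [simp]: "(c *\<^sub>v f) n = c * f n"
  by (simp add: scl_def)

text \<open>Intertwiners: matrices that preserve degrees modulo \<open>3\<close> and commute with the involutions.
  Rows are indexed by the source, in accordance with diagrammatic composition.\<close>

definition Intw :: "nat \<Rightarrow> nat \<Rightarrow> 'k::field vec set"
  where "Intw x y = {f.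
    (\<forall>i j. f \<langle>i, j\<rangle> \<noteq> 0 \<longrightarrow> i \<in> basis x \<and> j \<in> basis y \<and> 3 dvd grade x i - grade y j) \<and>
    (\<forall>i\<in>basis x. \<forall>j\<in>basis y. f \<langle>invol x i, invol y j\<rangle> = sign x i * sign y j * f \<langle>i, j\<rangle>)}"

lemma IntwI:
  assumes "\<And>i j. f \<langle>i, j\<rangle> \<noteq> 0 \<Longrightarrow> i \<in> basis x \<and> j \<in> basis y \<and> 3 dvd grade x i - grade y j"
    and "\<And>i j. i \<in> basis x \<Longrightarrow> j \<in> basis y \<Longrightarrow> f \<langle>invol x i, invol y j\<rangle> =
      sign x i * sign y j * f \<langle>i, j\<rangle>"
  shows "f \<in> Intw x y"
  using assms unfolding Intw_def by blast

lemma Intw_entry: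
  assumes "f \<in> Intw x y"
  shows "f \<langle>i, j\<rangle> \<noteq> 0 \<Longrightarrow> i \<in> basis x" "f \<langle>i, j\<rangle> \<noteq> 0 \<Longrightarrow> j \<in> basis y"
    "f \<langle>i, j\<rangle> \<noteq> 0 \<Longrightarrow> 3 dvd grade x i - grade y j"
    "i \<in> basis x \<Longrightarrow> j \<in> basis y \<Longrightarrow> f \<langle>invol x i, invol y j\<rangle> = sign x i * sign y j * f \<langle>i, j\<rangle>"
  using assms unfolding Intw_def by blast+

lemma Intw_outside:
  assumes "f \<in> Intw x y"
  shows "i \<notin> basis x \<Longrightarrow> f \<langle>i, j\<rangle> = 0" "j \<notin> basis y \<Longrightarrow> f \<langle>i, j\<rangle> = 0"
  using Intw_entry[OF assms] by blast+

lemma Intw_eqI: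
  assumes "f \<in> Intw x y" "g \<in> Intw x y"
    and "\<And>i j. i \<in> basis x \<Longrightarrow> j \<in> basis y \<Longrightarrow> f \<langle>i, j\<rangle> = g \<langle>i, j\<rangle>"
  shows "f = g"
proof
  fix n
  have "f \<langle>fst_code n, snd_code n\<rangle> = g \<langle>fst_code n, snd_code n\<rangle>"
    using assms(3) Intw_outside[OF assms(1)] Intw_outside[OF assms(2)] by metis
  then show "f n = g n" by simp
qed

lemma subspace_Intw: "vs.subspace (Intw x y :: 'k::field vec set)"
proof (rule vs.subspaceI)
  show "0 \<in> (Intw x y :: 'k vec set)" by (rule IntwI) auto
  fix f g :: "'k vec" and c :: 'k
  assume f: "f \<in> Intw x y"
  show "c *\<^sub>v f \<in> Intw x y"
    by (rule IntwI) (use Intw_entry[OF f] in \<open>auto simp: scl_def\<close>)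
  assume g: "g \<in> Intw x y"
  show "f + g \<in> Intw x y"
  proof (rule IntwI)
    fix i j assume "(f + g) \<langle>i, j\<rangle> \<noteq> 0"
    then have "f \<langle>i, j\<rangle> \<noteq> 0 \<or> g \<langle>i, j\<rangle> \<noteq> 0" by auto
    then show "i \<in> basis x \<and> j \<in> basis y \<and> 3 dvd grade x i - grade y j"
      using Intw_entry[OF f] Intw_entry[OF g] by blast
  qed (use Intw_entry[OF f] Intw_entry[OF g] in \<open>auto simp: algebra_simps\<close>)
qed

text \<open>The span of a finite set contains a finite basis of each of its subspaces.\<close>

lemma fin_dim_subspaceI:
  assumes "vs.subspace V" "V \<subseteq> vs.span T" "finite T"
  shows "fin_dim_subspace V"
proof -
  obtain B where B: "B \<subseteq> V" "vs.independent B" "V \<subseteq> vs.span B"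
    using vs.basis_exists by metis
  have "finite B" using vs.independent_span_bound[OF assms(3) B(2)] B(1) assms(2) by auto
  moreover have "V = vs.span B" using B vs.span_minimal[OF B(1) assms(1)] by auto
  ultimately show ?thesis unfolding fin_dim_subspace_def by blast
qed

lemma finite_support_in_span:
  fixes f :: "'k::field vec"
  assumes "finite N" "\<And>n. n \<notin> N \<Longrightarrow> f n = 0"
  shows "f \<in> vs.span ((\<lambda>n m. if m = n then 1 else 0) ` N)"
proof -
  have "f = (\<Sum>n\<in>N. f n *\<^sub>v (\<lambda>m. if m = n then 1 else 0))"
  proof
    fix m
    have "(\<Sum>n\<in>N. f n *\<^sub>v (\<lambda>m. if m = n then 1 else 0)) m = (\<Sum>n\<in>N. if m = n then f n else 0)"
      by (simp add: scl_def if_distrib[of "(*) _"] cong: if_cong)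
        (induction N rule: infinite_finite_induct; simp)
    then show "f m = (\<Sum>n\<in>N. f n *\<^sub>v (\<lambda>m. if m = n then 1 else 0)) m"
      using assms by simp
  qed
  then show ?thesis
    by (metis (mono_tags, lifting) vs.span_sum vs.span_scale vs.span_base imageI)
qed

lemma fin_dim_Intw: "fin_dim_subspace (Intw x y :: 'k::field vec set)"
proof (rule fin_dim_subspaceI[OF subspace_Intw])
  let ?N = "basis (tensor_ob x y)"
  show "(Intw x y :: 'k vec set) \<subseteq> vs.span ((\<lambda>n m. if m = n then 1 else 0) ` ?N)"
  proof
    fix f :: "'k vec" assume f: "f \<in> Intw x y"
    have "f n = 0" if "n \<notin> ?N" for n
      using that Intw_outside[OF f, of "fst_code n" "snd_code n"] Intw_outside[OF f, of _
        "fst_code n"] by (metis in_basis_ten pair_code_simps(3) Intw_entry(1,2) f)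
    then show "f \<in> vs.span ((\<lambda>n m. if m = n then 1 else 0) ` ?N)"
      by (intro finite_support_in_span) auto
  qed
qed simp

text \<open>The sum runs over the support of a row because the composite cannot refer to the middle
  object.\<close>

definition mat_comp :: "'k::field vec \<Rightarrow> 'k vec \<Rightarrow> 'k vec"
  where "mat_comp f g = mat (\<lambda>i j. \<Sum>l | f \<langle>i, l\<rangle> \<noteq> 0. f \<langle>i, l\<rangle> * g \<langle>l, j\<rangle>)"

lemma mat_comp_entry:
  assumes "f \<in> Intw x y"
  shows "mat_comp f g \<langle>i, j\<rangle> = (\<Sum>l\<in>basis y. f \<langle>i, l\<rangle> * g \<langle>l, j\<rangle>)"
  unfolding mat_comp_def mat_entry
  by (rule sum.mono_neutral_left) (use Intw_entry[OF assms] in auto)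

lemma mat_comp_Intw:
  assumes f: "f \<in> Intw x y" and g: "g \<in> Intw y z"
  shows "mat_comp f g \<in> Intw x z"
proof (rule IntwI)
  fix i j assume "mat_comp f g \<langle>i, j\<rangle> \<noteq> 0"
  then obtain l where "f \<langle>i, l\<rangle> * g \<langle>l, j\<rangle> \<noteq> 0"
    unfolding mat_comp_entry[OF f] by (metis (mono_tags, lifting) sum.neutral)
  then have "f \<langle>i, l\<rangle> \<noteq> 0" "g \<langle>l, j\<rangle> \<noteq> 0" by auto
  then show "i \<in> basis x \<and> j \<in> basis z \<and> 3 dvd grade x i - grade z j"
    using Intw_entry(1,3)[OF f] Intw_entry(2,3)[OF g] dvd_add[of 3 "grade x i - grade y l"
      "grade y l - grade z j"] by simp
next
  fix i j assume ij: "i \<in> basis x" "j \<in> basis z"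
  have "mat_comp f g \<langle>invol x i, invol z j\<rangle> =
    (\<Sum>l\<in>basis y. f \<langle>invol x i, invol y l\<rangle> * g \<langle>invol y l, invol z j\<rangle>)"
    unfolding mat_comp_entry[OF f] by (rule sum.reindex_bij_betw[OF bij_invol, symmetric])
  also have "\<dots> = (\<Sum>l\<in>basis y. sign x i * sign z j * (f \<langle>i, l\<rangle> * g \<langle>l, j\<rangle>))"
    by (rule sum.cong) (use ij Intw_entry(4)[OF f] Intw_entry(4)[OF g] in \<open>auto simp: mult_ac\<close>)
  finally show "mat_comp f g \<langle>invol x i, invol z j\<rangle> = sign x i * sign z j * mat_comp f g \<langle>i, j\<rangle>"
    unfolding mat_comp_entry[OF f] by (simp add: sum_distrib_left)
qed

lemma mat_comp_assoc:
  assumes f: "f \<in> Intw w x" and g: "g \<in> Intw x y" and h: "h \<in> Intw y z"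
  shows "mat_comp (mat_comp f g) h = mat_comp f (mat_comp g h)"
proof (rule Intw_eqI)
  show "mat_comp (mat_comp f g) h \<in> Intw w z" "mat_comp f (mat_comp g h) \<in> Intw w z"
    using mat_comp_Intw f g h by blast+
  fix i j
  have "mat_comp (mat_comp f g) h \<langle>i, j\<rangle> = (\<Sum>l\<in>basis y. \<Sum>m\<in>basis x. f \<langle>i, m\<rangle> * g \<langle>m, l\<rangle> * h \<langle>l, j\<rangle>)"
    by (simp add: mat_comp_entry[OF mat_comp_Intw[OF f g]] mat_comp_entry[OF f] sum_distrib_right)
  also have "\<dots> = (\<Sum>m\<in>basis x. \<Sum>l\<in>basis y. f \<langle>i, m\<rangle> * g \<langle>m, l\<rangle> * h \<langle>l, j\<rangle>)"
    by (rule sum.swap)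
  also have "\<dots> = mat_comp f (mat_comp g h) \<langle>i, j\<rangle>"
    by (simp add: mat_comp_entry[OF f] mat_comp_entry[OF g] sum_distrib_left mult.assoc)
  finally show "mat_comp (mat_comp f g) h \<langle>i, j\<rangle> = mat_comp f (mat_comp g h) \<langle>i, j\<rangle>" .
qed

definition mat_tensor :: "'k::field vec \<Rightarrow> 'k vec \<Rightarrow> 'k vec"
  where "mat_tensor f g = mat (\<lambda>a b. f \<langle>fst_code a, fst_code b\<rangle> * g \<langle>snd_code a, snd_code b\<rangle>)"

lemma mat_tensor_entry: "mat_tensor f g \<langle>a, b\<rangle> = f \<langle>fst_code a, fst_code b\<rangle> * g
  \<langle>snd_code a, snd_code b\<rangle>"
  by (simp add: mat_tensor_def)

lemma mat_tensor_Intw: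
  assumes f: "f \<in> Intw x y" and g: "g \<in> Intw x' y'"
  shows "mat_tensor f g \<in> Intw (tensor_ob x x') (tensor_ob y y')"
proof (rule IntwI)
  fix a b assume "mat_tensor f g \<langle>a, b\<rangle> \<noteq> 0"
  then have nz: "f \<langle>fst_code a, fst_code b\<rangle> \<noteq> 0" "g \<langle>snd_code a, snd_code b\<rangle> \<noteq> 0"
    by (auto simp: mat_tensor_entry)
  have "3 dvd grade x (fst_code a) - grade y (fst_code b) +
    (grade x' (snd_code a) - grade y' (snd_code b))"
    using Intw_entry(3)[OF f nz(1)] Intw_entry(3)[OF g nz(2)] by (rule dvd_add)
  then show "a \<in> basis (tensor_ob x x') \<and> b \<in> basis (tensor_ob y y')
    \<and> 3 dvd grade (tensor_ob x x') a - grade (tensor_ob y y') b"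
    using Intw_entry(1,2)[OF f nz(1)] Intw_entry(1,2)[OF g nz(2)] by (simp add: algebra_simps)
qed (use Intw_entry(4)[OF f] Intw_entry(4)[OF g] in \<open>auto simp: mat_tensor_entry mult_ac\<close>)

lemma sum_basis_ten: "(\<Sum>n\<in>basis (tensor_ob x y). F n) = (\<Sum>i\<in>basis x. \<Sum>j\<in>basis y. F \<langle>i, j\<rangle>)"
  by (simp add: basis_ten sum.reindex inj_prod_encode sum.cartesian_product)

lemma mat_tensor_comp:
  assumes "f \<in> Intw x y" "g \<in> Intw y z" "f' \<in> Intw x' y'" "g' \<in> Intw y' z'"
  shows "mat_tensor (mat_comp f g) (mat_comp f' g') = mat_comp (mat_tensor f f') (mat_tensor g g')"
proof (rule Intw_eqI)
  show "mat_tensor (mat_comp f g) (mat_comp f' g') \<in> Intw (tensor_ob x x') (tensor_ob z z')"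
    "mat_comp (mat_tensor f f') (mat_tensor g g') \<in> Intw (tensor_ob x x') (tensor_ob z z')"
    using mat_comp_Intw mat_tensor_Intw assms by metis+
  show "mat_tensor (mat_comp f g) (mat_comp f' g') \<langle>a, b\<rangle> =
    mat_comp (mat_tensor f f') (mat_tensor g g') \<langle>a, b\<rangle>" for a b
    by (simp add: mat_tensor_entry mat_comp_entry[OF mat_tensor_Intw[OF assms(1,3)]]
      mat_comp_entry[OF assms(1)]
        mat_comp_entry[OF assms(3)] sum_basis_ten sum_product mult_ac)
qed

text \<open>The matrix of the linear map \<open>e\<^sub>i \<mapsto> e\<^sub>\<beta>\<^sub>(\<^sub>i\<^sub>)\<close>. Composites of such matrices are composites
  of functions, and composition with one of them is a change of index; this is how the coherence
  conditions are reduced to identities between functions on codes.\<close>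

definition map_mat :: "nat set \<Rightarrow> (nat \<Rightarrow> nat) \<Rightarrow> 'k::field vec"
  where "map_mat A \<beta> = mat (\<lambda>i j. if i \<in> A \<and> j = \<beta> i then 1 else 0)"

lemma map_mat_entry [simp]: "map_mat A \<beta> \<langle>i, j\<rangle> = (if i \<in> A \<and> j = \<beta> i then 1 else 0)"
  by (simp add: map_mat_def)

lemma map_mat_Intw:
  assumes "\<And>i. i \<in> basis x \<Longrightarrow> \<beta> i \<in> basis y \<and> grade y (\<beta> i) = grade x i \<and>
    invol y (\<beta> i) = \<beta> (invol x i) \<and> sign y (\<beta> i) = (sign x i :: 'k::field)"
  shows "(map_mat (basis x) \<beta> :: 'k vec) \<in> Intw x y"
proof (rule IntwI)
  fix i j assume ij: "i \<in> basis x" "j \<in> basis y"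
  then have "invol y j = \<beta> (invol x i) \<longleftrightarrow> j = \<beta> i" using assms[OF ij(1)] invol_inj by metis
  then show "map_mat (basis x) \<beta> \<langle>invol x i, invol y j\<rangle> =
    sign x i * sign y j * (map_mat (basis x) \<beta> \<langle>i, j\<rangle> :: 'k)"
    using ij assms[OF ij(1)] by simp
qed (use assms in \<open>auto split: if_splits\<close>)

lemma map_mat_cong: "(\<And>i. i \<in> A \<Longrightarrow> \<beta> i = \<gamma> i) \<Longrightarrow> map_mat A \<beta> = map_mat A \<gamma>"
  by (auto simp: map_mat_def mat_def fun_eq_iff)

lemma mat_comp_map_mat_left: "mat_comp (map_mat A \<beta>) f \<langle>i, j\<rangle> = (if i \<in> A then f \<langle>\<beta> i, j\<rangle> else 0)"
proof -
  have "{l. (map_mat A \<beta> \<langle>i, l\<rangle> :: 'a) \<noteq> 0} = (if i \<in> A then {\<beta> i} else {})" by auto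
  then show ?thesis unfolding mat_comp_def by simp
qed

lemma mat_comp_map_mat_right:
  assumes f: "f \<in> Intw x y" and \<delta>: "\<And>l. l \<in> basis y \<Longrightarrow> \<delta> (\<beta> l) = l"
    and j: "\<delta> j \<in> basis y" "\<beta> (\<delta> j) = j"
  shows "mat_comp f (map_mat (basis y) \<beta>) \<langle>i, j\<rangle> = f \<langle>i, \<delta> j\<rangle>"
proof -
  have "(\<Sum>l\<in>basis y. f \<langle>i, l\<rangle> * map_mat (basis y) \<beta> \<langle>l, j\<rangle>) =
    (\<Sum>l\<in>basis y. if l = \<delta> j then f \<langle>i, l\<rangle> else 0)"
    by (rule sum.cong) (use \<delta> j in auto)
  then show ?thesis using j by (simp add: mat_comp_entry[OF f])
qed

lemma map_mat_comp:
  assumes "\<And>i. i \<in> A \<Longrightarrow> \<beta> i \<in> B"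
  shows "mat_comp (map_mat A \<beta>) (map_mat B \<gamma>) = map_mat A (\<lambda>i. \<gamma> (\<beta> i))"
  by (rule mat_eqI) (use assms in \<open>auto simp: mat_comp_map_mat_left\<close>)

lemma map_mat_tensor:
  "mat_tensor (map_mat (basis x) \<beta>) (map_mat (basis y) \<gamma>) =
    map_mat (basis (tensor_ob x y)) (\<lambda>n. \<langle>\<beta> (fst_code n), \<gamma> (snd_code n)\<rangle>)"
  by (rule mat_eqI) (auto simp: mat_tensor_entry nat_eq_pair_iff)

definition id_mat :: "nat \<Rightarrow> 'k::field vec" where "id_mat x = map_mat (basis x) (\<lambda>i. i)"

definition assoc_idx :: "nat \<Rightarrow> nat" where "assoc_idx n =
  \<langle>fst_code (fst_code n), \<langle>snd_code (fst_code n), snd_code n\<rangle>\<rangle>"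
definition unassoc_idx :: "nat \<Rightarrow> nat" where "unassoc_idx n =
  \<langle>\<langle>fst_code n, fst_code (snd_code n)\<rangle>, snd_code (snd_code n)\<rangle>"

definition assoc_mat :: "nat \<Rightarrow> nat \<Rightarrow> nat \<Rightarrow> 'k::field vec"
  where "assoc_mat x y z = map_mat (basis (tensor_ob (tensor_ob x y) z)) assoc_idx"
definition unassoc_mat :: "nat \<Rightarrow> nat \<Rightarrow> nat \<Rightarrow> 'k::field vec"
  where "unassoc_mat x y z = map_mat (basis (tensor_ob x (tensor_ob y z))) unassoc_idx"
definition lunit_mat :: "nat \<Rightarrow> 'k::field vec" where "lunit_mat x =
  map_mat (basis (tensor_ob triv_ob x)) snd_code"
definition lunit_inv_mat :: "nat \<Rightarrow> 'k::field vec" where "lunit_inv_mat x =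
  map_mat (basis x) (\<lambda>i. \<langle>0, i\<rangle>)"
definition runit_mat :: "nat \<Rightarrow> 'k::field vec" where "runit_mat x =
  map_mat (basis (tensor_ob x triv_ob)) fst_code"
definition runit_inv_mat :: "nat \<Rightarrow> 'k::field vec" where "runit_inv_mat x =
  map_mat (basis x) (\<lambda>i. \<langle>i, 0\<rangle>)"

lemmas struct_defs = id_mat_def assoc_mat_def unassoc_mat_def lunit_mat_def lunit_inv_mat_def
  runit_mat_def runit_inv_mat_def

lemma struct_Intw:
  "id_mat x \<in> Intw x x"
  "assoc_mat x y z \<in> Intw (tensor_ob (tensor_ob x y) z) (tensor_ob x (tensor_ob y z))"
  "unassoc_mat x y z \<in> Intw (tensor_ob x (tensor_ob y z)) (tensor_ob (tensor_ob x y) z)"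
  "lunit_mat x \<in> Intw (tensor_ob triv_ob x) x" "lunit_inv_mat x \<in> Intw x (tensor_ob triv_ob x)"
  "runit_mat x \<in> Intw (tensor_ob x triv_ob) x" "runit_inv_mat x \<in> Intw x (tensor_ob x triv_ob)"
  unfolding struct_defs by (rule map_mat_Intw; simp add: assoc_idx_def unassoc_idx_def mult.assoc)+

lemma id_mat_comp: "f \<in> Intw x y \<Longrightarrow> mat_comp (id_mat x) f = f"
  by (rule Intw_eqI[OF mat_comp_Intw[OF struct_Intw(1)]])
    (auto simp: id_mat_def mat_comp_map_mat_left)

lemma comp_id_mat: "f \<in> Intw x y \<Longrightarrow> mat_comp f (id_mat y) = f"
  by (rule Intw_eqI[OF mat_comp_Intw[OF _ struct_Intw(1)]])
    (auto simp: id_mat_def mat_comp_map_mat_right[where \<delta> = "\<lambda>i. i"])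

lemma tensor_id_mat: "mat_tensor (id_mat x) (id_mat y) = id_mat (tensor_ob x y)"
  unfolding id_mat_def map_mat_tensor by simp

lemma struct_inverse:
  "mat_comp (assoc_mat x y z) (unassoc_mat x y z) = id_mat (tensor_ob (tensor_ob x y) z)"
  "mat_comp (unassoc_mat x y z) (assoc_mat x y z) = id_mat (tensor_ob x (tensor_ob y z))"
  "mat_comp (lunit_mat x) (lunit_inv_mat x) = id_mat (tensor_ob triv_ob x)"
    "mat_comp (lunit_inv_mat x) (lunit_mat x) = id_mat x"
  "mat_comp (runit_mat x) (runit_inv_mat x) = id_mat (tensor_ob x triv_ob)"
    "mat_comp (runit_inv_mat x) (runit_mat x) = id_mat x"
  unfolding struct_defs
  by (subst map_mat_comp; force intro!: map_mat_cong simp: assoc_idx_def unassoc_idx_def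
    nat_eq_pair_iff)+

lemma pentagon:
  "mat_comp (mat_comp (mat_tensor (assoc_mat w x y) (id_mat z)) (assoc_mat w (tensor_ob x y) z))
    (mat_tensor (id_mat w) (assoc_mat x y z)) =
   mat_comp (assoc_mat (tensor_ob w x) y z) (assoc_mat w x (tensor_ob y z))"
  unfolding struct_defs map_mat_tensor
  by ((subst map_mat_comp, force simp: assoc_idx_def)+)
    (auto simp: assoc_idx_def intro!: map_mat_cong)

lemma triangle: "mat_comp (assoc_mat x triv_ob y) (mat_tensor (id_mat x) (lunit_mat y)) =
  mat_tensor (runit_mat x) (id_mat y)"
  unfolding struct_defs map_mat_tensor
  by (subst map_mat_comp) (auto simp: assoc_idx_def intro!: map_mat_cong)

lemma assoc_mat_natural:
  assumes "f \<in> Intw x x'" "g \<in> Intw y y'" "h \<in> Intw z z'"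
  shows "mat_comp (mat_tensor (mat_tensor f g) h) (assoc_mat x' y' z') =
    mat_comp (assoc_mat x y z) (mat_tensor f (mat_tensor g h))"
proof (rule Intw_eqI)
  note fgh = mat_tensor_Intw[OF mat_tensor_Intw[OF assms(1,2)] assms(3)]
  show "mat_comp (mat_tensor (mat_tensor f g) h) (assoc_mat x' y' z')
    \<in> Intw (tensor_ob (tensor_ob x y) z) (tensor_ob x' (tensor_ob y' z'))"
    "mat_comp (assoc_mat x y z) (mat_tensor f (mat_tensor g h))
      \<in> Intw (tensor_ob (tensor_ob x y) z) (tensor_ob x' (tensor_ob y' z'))"
    using mat_comp_Intw[OF fgh struct_Intw(2)] mat_comp_Intw[OF struct_Intw(2)
      mat_tensor_Intw[OF assms(1) mat_tensor_Intw[OF assms(2,3)]]] .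
  fix a b
  assume "a \<in> basis (tensor_ob (tensor_ob x y) z)" "b \<in> basis (tensor_ob x' (tensor_ob y' z'))"
  then show "mat_comp (mat_tensor (mat_tensor f g) h) (assoc_mat x' y' z') \<langle>a, b\<rangle> =
    mat_comp (assoc_mat x y z) (mat_tensor f (mat_tensor g h)) \<langle>a, b\<rangle>"
    unfolding assoc_mat_def mat_comp_map_mat_left
    by (subst mat_comp_map_mat_right[where \<delta> = unassoc_idx, OF fgh])
      (auto simp: assoc_idx_def unassoc_idx_def mat_tensor_entry)
qed

lemma lunit_mat_natural:
  assumes f: "f \<in> Intw x y"
  shows "mat_comp (mat_tensor (id_mat triv_ob) f) (lunit_mat y) = mat_comp (lunit_mat x) f"
proof (rule Intw_eqI)
  note 1 = mat_tensor_Intw[OF struct_Intw(1)[of triv_ob] f]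
  show "mat_comp (mat_tensor (id_mat triv_ob) f) (lunit_mat y) \<in> Intw (tensor_ob triv_ob x) y"
    "mat_comp (lunit_mat x) f \<in> Intw (tensor_ob triv_ob x) y"
    using mat_comp_Intw[OF 1 struct_Intw(4)] mat_comp_Intw[OF struct_Intw(4) f] .
  fix a b
  assume "a \<in> basis (tensor_ob triv_ob x)" "b \<in> basis y"
  then show "mat_comp (mat_tensor (id_mat triv_ob) f) (lunit_mat y) \<langle>a, b\<rangle> =
    mat_comp (lunit_mat x) f \<langle>a, b\<rangle>"
    unfolding lunit_mat_def mat_comp_map_mat_left
    by (subst mat_comp_map_mat_right[where \<delta> = "\<lambda>i. \<langle>0, i\<rangle>", OF 1])
      (auto simp: mat_tensor_entry id_mat_def nat_eq_pair_iff)
qed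

lemma runit_mat_natural:
  assumes f: "f \<in> Intw x y"
  shows "mat_comp (mat_tensor f (id_mat triv_ob)) (runit_mat y) = mat_comp (runit_mat x) f"
proof (rule Intw_eqI)
  note 1 = mat_tensor_Intw[OF f struct_Intw(1)[of triv_ob]]
  show "mat_comp (mat_tensor f (id_mat triv_ob)) (runit_mat y) \<in> Intw (tensor_ob x triv_ob) y"
    "mat_comp (runit_mat x) f \<in> Intw (tensor_ob x triv_ob) y"
    using mat_comp_Intw[OF 1 struct_Intw(6)] mat_comp_Intw[OF struct_Intw(6) f] .
  fix a b
  assume "a \<in> basis (tensor_ob x triv_ob)" "b \<in> basis y"
  then show "mat_comp (mat_tensor f (id_mat triv_ob)) (runit_mat y) \<langle>a, b\<rangle> =
    mat_comp (runit_mat x) f \<langle>a, b\<rangle>"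
    unfolding runit_mat_def mat_comp_map_mat_left
    by (subst mat_comp_map_mat_right[where \<delta> = "\<lambda>i. \<langle>i, 0\<rangle>", OF 1])
      (auto simp: mat_tensor_entry id_mat_def nat_eq_pair_iff)
qed

definition RepS3 :: "(nat, 'k::field vec) moncat"
  where "RepS3 = \<lparr>ob = UNIV, hom = Intw, ident = id_mat, seq = mat_comp, ten = tensor_ob, tmor =
    mat_tensor,
    unt = triv_ob, asc = assoc_mat, lun = lunit_mat, run = runit_mat\<rparr>"

lemma RepS3_simps [simp]:
  "ob RepS3 = UNIV" "hom RepS3 = Intw" "ident RepS3 = id_mat" "seq RepS3 = mat_comp" "ten RepS3 =
    tensor_ob"
  "tmor RepS3 = mat_tensor" "unt RepS3 = triv_ob" "asc RepS3 = assoc_mat" "lun RepS3 = lunit_mat"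
    "run RepS3 = runit_mat"
  by (simp_all add: RepS3_def)

lemma category_RepS3: "category RepS3"
  unfolding category_def
  by (auto simp: struct_Intw id_mat_comp comp_id_mat intro: mat_comp_Intw mat_comp_assoc)

lemma inv_mor_RepS3:
  assumes "f \<in> Intw x y" "g \<in> Intw y x" "mat_comp f g = id_mat x" "mat_comp g f = id_mat y"
  shows "inv_mor RepS3 x y f = g"
  unfolding inv_mor_def
proof (rule the_equality)
  show "inverse_pair RepS3 x y f g" using assms by (simp add: inverse_pair_def)
  fix h assume "inverse_pair RepS3 x y f h"
  then have h: "h \<in> Intw y x" "mat_comp h f = id_mat y" by (auto simp: inverse_pair_def)
  have "h = mat_comp h (mat_comp f g)" using assms(3) comp_id_mat[OF h(1)] by simp
  also have "\<dots> = mat_comp (mat_comp h f) g" using mat_comp_assoc[OF h(1) assms(1,2)] by simp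
  finally show "h = g" using h(2) id_mat_comp[OF assms(2)] by simp
qed

lemma struct_inv_RepS3 [simp]:
  "asc_inv RepS3 x y z = unassoc_mat x y z" "lun_inv RepS3 x = lunit_inv_mat x" "run_inv RepS3 x =
    runit_inv_mat x"
  by (simp_all add: asc_inv_def lun_inv_def run_inv_def inv_mor_RepS3 struct_Intw struct_inverse)

lemma is_isoI: "f \<in> Intw x y \<Longrightarrow> g \<in> Intw y x \<Longrightarrow> mat_comp f g = id_mat x \<Longrightarrow> mat_comp g f =
  id_mat y \<Longrightarrow> is_iso RepS3 x y f"
  by (auto simp: is_iso_def inverse_pair_def)

lemma struct_iso:
  "is_iso RepS3 (tensor_ob (tensor_ob x y) z) (tensor_ob x (tensor_ob y z)) (assoc_mat x y z)"
  "is_iso RepS3 (tensor_ob triv_ob x) x (lunit_mat x)"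
    "is_iso RepS3 (tensor_ob x triv_ob) x (runit_mat x)"
  by (rule is_isoI[OF struct_Intw(2,3) struct_inverse(1,2)]
    is_isoI[OF struct_Intw(4,5) struct_inverse(3,4)]
      is_isoI[OF struct_Intw(6,7) struct_inverse(5,6)])+

lemma monoidal_RepS3: "monoidal_category RepS3"
  unfolding monoidal_category_def RepS3_simps
  by (intro conjI ballI category_RepS3 UNIV_I tensor_id_mat mat_tensor_Intw mat_tensor_comp
    struct_iso assoc_mat_natural
      lunit_mat_natural runit_mat_natural pentagon triangle)

lemma linear_on_mat_comp: "f \<in> Intw x y \<Longrightarrow> linear_on (Intw y z) (mat_comp f)"
  by (auto simp: linear_on_def fun_eq_iff mat_comp_def mat_def scl_def algebra_simps sum.distrib
    sum_distrib_left)

lemma mat_comp_linear_on: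
  fixes g :: "'k::field vec"
  shows "linear_on (Intw x y) (\<lambda>f. mat_comp f g)"
  unfolding linear_on_def
proof (intro conjI ballI allI)
    fix f f' :: "'k vec" and c assume f: "f \<in> Intw x y"
    show "mat_comp (c *\<^sub>v f) g = c *\<^sub>v mat_comp f g"
      by (rule mat_eqI)
        (simp add: mat_comp_entry[OF f] mat_comp_entry[OF vs.subspace_scale[OF subspace_Intw f]]
        sum_distrib_left mult.assoc)
    assume f': "f' \<in> Intw x y"
    show "mat_comp (f + f') g = mat_comp f g + mat_comp f' g"
      by (rule mat_eqI)
        (simp add: mat_comp_entry[OF f] mat_comp_entry[OF f']
          mat_comp_entry[OF vs.subspace_add[OF subspace_Intw f f']]
        sum.distrib distrib_right)
qed

lemma linear_RepS3: "linear_monoidal RepS3"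
  unfolding linear_monoidal_def RepS3_simps
proof (intro conjI ballI monoidal_RepS3 fin_dim_Intw)
  show "bilinear_on (Intw x y) (Intw y z) mat_comp" for x y z
    by (simp add: bilinear_on_def mat_comp_linear_on linear_on_mat_comp)
  show "bilinear_on (Intw x y) (Intw x' y') mat_tensor" for x y x' y'
    by (auto simp: bilinear_on_def linear_on_def fun_eq_iff mat_tensor_def mat_def scl_def
      algebra_simps)
qed

section \<open>Decomposition into irreducible representations\<close>

interpretation RepS3: linear_category RepS3
  by unfold_locales (rule linear_RepS3)

lemma arr_RepS3 [simp]: "RepS3.arr x y f \<longleftrightarrow> f \<in> Intw x y"
  by (simp add: RepS3.arr_def)

text \<open>Since the involutions are orthogonal matrices, the transpose of an intertwiner is an
  intertwiner. This gives projections from inclusions and coevaluations from evaluations.\<close>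

definition transp :: "'k vec \<Rightarrow> 'k vec"
  where "transp f = mat (\<lambda>i j. f \<langle>j, i\<rangle>)"

lemma transp_entry [simp]: "transp f \<langle>i, j\<rangle> = f \<langle>j, i\<rangle>"
  by (simp add: transp_def)

lemma transp_transp [simp]: "transp (transp f) = f"
  by (rule mat_eqI) simp

lemma transp_Intw: "f \<in> Intw x y \<Longrightarrow> transp f \<in> Intw y x"
  by (rule IntwI) (use Intw_entry[of f x y] in \<open>auto simp: mult_ac dvd_diff_commute\<close>)

lemma zero_Intw: "0 \<in> Intw x y"
  by (rule vs.subspace_0[OF subspace_Intw])

lemma Intw_zero_object: "Intw zero_ob x = ({0} :: 'k::field vec set)" "Intw x zero_ob =
  ({0} :: 'k vec set)"
proof -
  have "f = 0" if "f \<in> Intw zero_ob x" for f :: "'k vec"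
    by (rule Intw_eqI[OF that zero_Intw]) simp
  then show "Intw zero_ob x = ({0} :: 'k vec set)" using zero_Intw by blast
  have "f = 0" if "f \<in> Intw x zero_ob" for f :: "'k vec"
    by (rule Intw_eqI[OF that zero_Intw]) simp
  then show "Intw x zero_ob = ({0} :: 'k vec set)" using zero_Intw by blast
qed

lemma binary_sum_RepS3:
  "\<exists>s i p j q. is_direct_sum RepS3 s [(x, i :: 'k::field vec, p), (y, j, q)]"
proof -
  let ?s = "sum_ob x y"
  let ?i = "map_mat (basis x) (\<lambda>a. sum_encode (Inl a)) :: 'k vec"
  let ?j = "map_mat (basis y) (\<lambda>a. sum_encode (Inr a)) :: 'k vec"
  have H: "?i \<in> Intw x ?s" "?j \<in> Intw y ?s" by (rule map_mat_Intw; auto)+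
  note T = H[THEN transp_Intw]
  have enc: "sum_encode a = sum_encode b \<longleftrightarrow> a = b" for a b
    by (simp add: inj_eq[OF inj_sum_encode])
  have Z: "(0 :: 'k vec) \<in> Intw a b" for a b by (rule vs.subspace_0[OF subspace_Intw])
  have "mat_comp ?i (transp ?i) = id_mat x"
    by (rule Intw_eqI[OF mat_comp_Intw[OF H(1) T(1)] struct_Intw(1)])
      (auto simp: mat_comp_map_mat_left id_mat_def enc)
  moreover have "mat_comp ?j (transp ?j) = id_mat y"
    by (rule Intw_eqI[OF mat_comp_Intw[OF H(2) T(2)] struct_Intw(1)])
      (auto simp: mat_comp_map_mat_left id_mat_def enc)
  moreover have "mat_comp ?i (transp ?j) = 0"
    by (rule Intw_eqI[OF mat_comp_Intw[OF H(1) T(2)] Z]) (auto simp: mat_comp_map_mat_left enc)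
  moreover have "mat_comp ?j (transp ?i) = 0"
    by (rule Intw_eqI[OF mat_comp_Intw[OF H(2) T(1)] Z]) (auto simp: mat_comp_map_mat_left enc)
  moreover have "mat_comp (transp ?i) ?i + mat_comp (transp ?j) ?j = id_mat ?s"
  proof (rule
    Intw_eqI[OF vs.subspace_add[OF subspace_Intw mat_comp_Intw[OF T(1) H(1)]
      mat_comp_Intw[OF T(2) H(2)]] struct_Intw(1)])
    fix m n assume mn: "m \<in> basis ?s" "n \<in> basis ?s"
    have 1: "mat_comp (transp ?i) ?i \<langle>m, n\<rangle> = (\<Sum>l\<in>basis x. if m =
      sum_encode (Inl l) then (if n = m then 1 else 0) else 0)"
      unfolding mat_comp_entry[OF T(1)] by (rule sum.cong) auto
    have 2: "mat_comp (transp ?j) ?j \<langle>m, n\<rangle> = (\<Sum>l\<in>basis y. if m =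
      sum_encode (Inr l) then (if n = m then 1 else 0) else 0)"
      unfolding mat_comp_entry[OF T(2)] by (rule sum.cong) auto
    show "(mat_comp (transp ?i) ?i + mat_comp (transp ?j) ?j) \<langle>m, n\<rangle> = (id_mat ?s \<langle>m, n\<rangle> :: 'k)"
      using mn unfolding plus_fun_apply 1 2 by (auto simp: id_mat_def enc)
  qed
  ultimately have "is_direct_sum RepS3 ?s [(x, ?i, transp ?i), (y, ?j, transp ?j)]"
    using H T unfolding is_direct_sum_def by (simp add: All_less_Suc2)
  then show ?thesis by blast
qed

lemma mat_comp_map_mat_id_right:
  assumes f: "f \<in> Intw x y" and A: "A \<subseteq> basis y"
  shows "mat_comp f (map_mat A (\<lambda>i. i)) \<langle>i, j\<rangle> = (if j \<in> A then f \<langle>i, j\<rangle> else 0)"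
proof -
  have "mat_comp f (map_mat A (\<lambda>i. i)) \<langle>i, j\<rangle> = (\<Sum>l\<in>basis y. if l =
    j then (if j \<in> A then f \<langle>i, j\<rangle> else 0) else 0)"
    unfolding mat_comp_entry[OF f] by (rule sum.cong) auto
  then show ?thesis using A by auto
qed

lemma sign_cases: "sign x i = (1 :: 'k::field) \<or> sign x i = (- 1 :: 'k)"
proof -
  have "(sign x i - 1) * (sign x i + 1) = (0 :: 'k)" by (simp add: algebra_simps)
  then have "sign x i - 1 = (0 :: 'k) \<or> sign x i + 1 = (0 :: 'k)" by (simp only: mult_eq_0_iff)
  then show ?thesis by (simp add: eq_neg_iff_add_eq_0)
qed

text \<open>The one-dimensional representation on which the involution acts by \<open>\<eta> \<in> {1, -1}\<close>.\<close>

definition char_ob :: "'k::field \<Rightarrow> nat"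
  where "char_ob \<eta> = (if \<eta> = 1 then triv_ob else sign_ob)"

lemma char_ob_simps:
  assumes "\<eta> = 1 \<or> \<eta> = (- 1 :: 'k::field_char_0)"
  shows "basis (char_ob \<eta>) = {0}" "grade (char_ob \<eta>) n = 0" "invol (char_ob \<eta>) n = n"
    "sign (char_ob \<eta>) n = \<eta>"
  using assms by (auto simp: char_ob_def)

definition row_mat :: "(nat \<Rightarrow> 'k::zero) \<Rightarrow> 'k vec"
  where "row_mat v = mat (\<lambda>a l. if a = 0 then v l else 0)"

lemma row_mat_entry [simp]: "row_mat v \<langle>a, l\<rangle> = (if a = 0 then v l else 0)"
  by (simp add: row_mat_def)

lemma row_mat_Intw:
  assumes \<eta>: "\<eta> = 1 \<or> \<eta> = (- 1 :: 'k::field_char_0)"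
    and "\<And>l. v l \<noteq> 0 \<Longrightarrow> l \<in> basis x \<and> 3 dvd grade x l"
    and "\<And>l. l \<in> basis x \<Longrightarrow> v (invol x l) = \<eta> * sign x l * v l"
  shows "row_mat v \<in> Intw (char_ob \<eta>) x"
  by (rule IntwI) (use assms in \<open>auto simp: char_ob_simps[OF \<eta>] split: if_splits\<close>)

definition simples :: "nat set" where "simples = {triv_ob, sign_ob, std_ob}"

lemma simples_distinct: "triv_ob \<noteq> sign_ob" "triv_ob \<noteq> std_ob" "sign_ob \<noteq> std_ob"
  by (simp_all add: ob_defs)

text \<open>The span of an orbit \<open>{j, \<tau>(j)}\<close> is irreducible of dimension two if the degree of \<open>j\<close> is not
  divisible by \<open>3\<close>. If it is divisible, \<open>\<tau>\<close> preserves the degree: a fixed point \<open>j\<close> spans the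
  character given by its sign, and an orbit of size two is the sum of both characters, spanned by
  \<open>e\<^sub>j + \<eta> s\<^sub>j e\<^sub>\<tau>\<^sub>(\<^sub>j\<^sub>)\<close> for \<open>\<eta> = 1, -1\<close>.\<close>

lemma orbit_decomposition:
  fixes x :: nat
  assumes A: "A \<subseteq> basis x" and j: "j \<in> basis x" "j \<notin> A" "invol x j \<notin> A"
    and D: "RepS3.partial_sum x D (map_mat A (\<lambda>i. i) :: 'k::field_char_0 vec)"
      "fst ` set D \<subseteq> simples"
  shows "\<exists>D. RepS3.partial_sum x D (map_mat (insert j (insert (invol x j) A)) (\<lambda>i. i) :: 'k vec) \<and>
    fst ` set D \<subseteq> simples"
proof -
  let ?k = "invol x j"
  let ?e = "map_mat A (\<lambda>i. i) :: 'k vec"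
  have k: "?k \<in> basis x" "invol x ?k = j" using j by auto
  have e: "?e \<in> Intw x x" using D(1) by (simp add: RepS3.partial_sum_def)
  have Z: "(0 :: 'k vec) \<in> Intw a b" for a b by (rule vs.subspace_0[OF subspace_Intw])
  have kill: "mat_comp f ?e = 0" "mat_comp ?e (c *\<^sub>v transp f) = 0"
    if f: "f \<in> Intw t x" and supp: "\<And>a l. l \<in> A \<Longrightarrow> f \<langle>a, l\<rangle> = 0" for f :: "'k vec" and t c
  proof -
    show "mat_comp f ?e = 0"
      by (rule Intw_eqI[OF mat_comp_Intw[OF f e] Z])
        (use supp in \<open>auto simp: mat_comp_map_mat_id_right[OF f A]\<close>)
    show "mat_comp ?e (c *\<^sub>v transp f) = 0"
      by (rule Intw_eqI[OF
        mat_comp_Intw[OF e vs.subspace_scale[OF subspace_Intw transp_Intw[OF f]]] Z])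
        (use supp in \<open>auto simp: mat_comp_map_mat_left\<close>)
  qed
  consider "3 dvd grade x j" "?k = j" | "3 dvd grade x j" "?k \<noteq> j" | "\<not> 3 dvd grade x j" by blast
  then show ?thesis
  proof cases
    case 1
    let ?\<eta> = "sign x j :: 'k"
    let ?i = "row_mat (\<lambda>l. if l = j then 1 else 0) :: 'k vec"
    have \<eta>: "?\<eta> = 1 \<or> ?\<eta> = - 1" by (rule sign_cases)
    have i: "?i \<in> Intw (char_ob ?\<eta>) x"
      by (rule row_mat_Intw[OF \<eta>]) (use 1 j k in \<open>auto split: if_splits\<close>)
    note p = transp_Intw[OF i]
    have ip: "mat_comp ?i (transp ?i) = id_mat (char_ob ?\<eta>)"
      by (rule Intw_eqI[OF mat_comp_Intw[OF i p] struct_Intw(1)])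
        (use j in \<open>auto simp: mat_comp_entry[OF i] id_mat_def char_ob_simps[OF \<eta>] if_distrib[of
          "\<lambda>a. _ * a"] cong: if_cong\<close>)
    have pi: "mat_comp (transp ?i) ?i + ?e = map_mat (insert j (insert ?k A)) (\<lambda>i. i)"
      by (rule mat_eqI) (use 1 j in \<open>auto simp: mat_comp_entry[OF p] char_ob_simps[OF \<eta>]\<close>)
    have supp: "\<And>a l. l \<in> A \<Longrightarrow> ?i \<langle>a, l\<rangle> = 0" using j by auto
    have "RepS3.partial_sum x ((char_ob ?\<eta>, ?i, transp ?i) # D) (mat_comp (transp ?i) ?i + ?e)"
      using RepS3.partial_sum_Cons[OF D(1), of "char_ob ?\<eta>" ?i
        "transp ?i"] i p ip kill(1)[OF i supp] kill(2)[OF i supp, of 1] by simp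
    moreover have "fst ` set ((char_ob ?\<eta>, ?i, transp ?i) # D) \<subseteq> simples"
      using D(2) by (auto simp: char_ob_def simples_def)
    ultimately show ?thesis unfolding pi by blast
  next
    case 2
    let ?i = "\<lambda>\<eta>. row_mat (\<lambda>l. if l = j then 1 else if l = ?k then \<eta> * sign x j else 0) :: 'k vec"
    let ?p = "\<lambda>\<eta>. (1 / 2) *\<^sub>v transp (?i \<eta>)"
    have gk: "3 dvd grade x ?k" using grade_invol[OF j(1)] 2(1) by (simp add: dvd_add_left_iff)
    have i: "?i \<eta> \<in> Intw (char_ob \<eta>) x" if \<eta>: "\<eta> = 1 \<or> \<eta> = - 1" for \<eta>
    proof (rule row_mat_Intw[OF \<eta>])
      fix l assume l: "l \<in> basis x"
      have "invol x l = j \<longleftrightarrow> l = ?k" "invol x l = ?k \<longleftrightarrow> l = j" using l j k invol_invol by metis+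
      then show "(if invol x l = j then 1 else if invol x l = ?k then \<eta> * sign x j else 0) =
          \<eta> * sign x l * (if l = j then 1 else if l = ?k then \<eta> * sign x j else 0)"
        using 2 j \<eta> by (auto simp: algebra_simps)
    qed (use 2 gk j k in \<open>auto split: if_splits\<close>)
    have p: "?p \<eta> \<in> Intw x (char_ob \<eta>)" if \<eta>: "\<eta> = 1 \<or> \<eta> = - 1" for \<eta>
      by (rule vs.subspace_scale[OF subspace_Intw transp_Intw[OF i[OF \<eta>]]])
    have ip: "mat_comp (?i \<eta>) (?p \<theta>) \<langle>a, b\<rangle> = (if a = 0 \<and> b = 0 then (1 + \<eta> * \<theta>) / 2 else 0)"
      if \<eta>: "\<eta> = 1 \<or> \<eta> = - 1" for \<eta> \<theta> a b
    proof -
      have "mat_comp (?i \<eta>) (?p \<theta>) \<langle>a, b\<rangle> = (\<Sum>l\<in>basis x. if l =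
        j then (if a = 0 \<and> b = 0 then 1 / 2 else 0) else 0) +
          (\<Sum>l\<in>basis x. if l = ?k then (if a = 0 \<and> b = 0 then \<eta> * \<theta> / 2 else 0) else 0)"
        unfolding mat_comp_entry[OF i[OF \<eta>]] sum.distrib[symmetric]
        by (rule sum.cong) (use 2 in \<open>auto simp: field_simps\<close>)
      then show ?thesis using j k by (simp add: add_divide_distrib)
    qed
    have ip1: "mat_comp (?i \<eta>) (?p \<eta>) = id_mat (char_ob \<eta>)" if \<eta>: "\<eta> = 1 \<or> \<eta> = - 1" for \<eta>
      by (rule Intw_eqI[OF mat_comp_Intw[OF i[OF \<eta>] p[OF \<eta>]] struct_Intw(1)])
        (use \<eta> in \<open>auto simp: ip[OF \<eta>] id_mat_def char_ob_simps[OF \<eta>]\<close>)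
    have ip0: "mat_comp (?i \<eta>) (?p \<theta>) = 0" if \<eta>: "\<eta> = 1 \<or> \<eta> = - 1" and \<theta>: "\<theta> = - \<eta>" for \<eta> \<theta>
      by (rule mat_eqI) (use \<eta> \<theta> in \<open>auto simp: ip[OF \<eta>]\<close>)
    have kill': "mat_comp (?i \<eta>) ?e = 0" "mat_comp ?e (?p \<eta>) = 0" if \<eta>: "\<eta> = 1 \<or> \<eta> = - 1" for \<eta>
    proof -
      have supp: "\<And>a l. l \<in> A \<Longrightarrow> ?i \<eta> \<langle>a, l\<rangle> = 0" using j by auto
      show "mat_comp (?i \<eta>) ?e = 0" by (rule kill(1)[OF i[OF \<eta>] supp])
      show "mat_comp ?e (?p \<eta>) = 0" by (rule kill(2)[OF i[OF \<eta>] supp])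
    qed
    have m: "(1::'k) = 1 \<or> (1::'k) = - 1" "(- 1::'k) = 1 \<or> (- 1::'k) = - 1" by auto
    let ?e1 = "mat_comp (?p 1) (?i 1) + ?e"
    have D1: "RepS3.partial_sum x ((char_ob (1::'k), ?i 1, ?p 1) # D) ?e1"
      using RepS3.partial_sum_Cons[OF D(1), of "char_ob (1::'k)" "?i 1"
        "?p 1"] i[OF m(1)] p[OF m(1)]
        ip1[OF m(1)] kill'[OF m(1)] by simp
    have pi: "mat_comp (?p 1) (?i 1) \<in> Intw x x" using mat_comp_Intw p i m by blast
    have "mat_comp (?i (- 1)) ?e1 = mat_comp (mat_comp (?i (- 1)) (?p 1)) (?i 1) + mat_comp
      (?i (- 1)) ?e"
      using RepS3.seq_add[of "char_ob (-1::'k)" x "?i (-1)" x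
        "mat_comp (?p 1) (?i 1)" ?e] i[OF m(2)] pi e
        mat_comp_assoc[OF i[OF m(2)] p[OF m(1)] i[OF m(1)]] by simp
    then have k1: "mat_comp (?i (- 1)) ?e1 = 0"
      using ip0[OF m(2), of 1] kill'(1)[OF m(2)] RepS3.zero_seq[of "char_ob (1::'k)" x
        "?i 1"] i[OF m(1)] by simp
    have "mat_comp ?e1 (?p (- 1)) = mat_comp (?p 1) (mat_comp (?i 1) (?p (- 1))) + mat_comp ?e
      (?p (- 1))"
      using RepS3.add_seq[of x x "mat_comp (?p 1) (?i 1)" ?e "char_ob (-1::'k)"
        "?p (-1)"] p[OF m(2)] pi e
        mat_comp_assoc[OF p[OF m(1)] i[OF m(1)] p[OF m(2)]] by simp
    then have k2: "mat_comp ?e1 (?p (- 1)) = 0"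
      using ip0[OF m(1), of "- 1"] kill'(2)[OF m(2)] RepS3.seq_zero[of x "char_ob (1::'k)"
        "?p 1"] p[OF m(1)] by simp
    have D2: "RepS3.partial_sum x ((char_ob (- 1::'k), ?i (- 1), ?p (- 1)) #
      (char_ob (1::'k), ?i 1, ?p 1) # D)
        (mat_comp (?p (- 1)) (?i (- 1)) + ?e1)"
      using RepS3.partial_sum_Cons[OF D1, of "char_ob (- 1::'k)" "?i (- 1)"
        "?p (- 1)"] i[OF m(2)] p[OF m(2)]
        ip1[OF m(2)] k1 k2 by simp
    have "mat_comp (?p (- 1)) (?i (- 1)) + ?e1 = map_mat (insert j (insert ?k A)) (\<lambda>i. i)"
      by (rule mat_eqI)
        (use 2 j in \<open>auto simp: mat_comp_entry[OF p[OF m(1)]] mat_comp_entry[OF p[OF m(2)]]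
          char_ob_simps[OF m(1)] char_ob_simps[OF m(2)]\<close>)
    note D2[unfolded this]
    moreover have
      "fst ` set ((char_ob (- 1::'k), ?i (- 1), ?p (- 1)) # (char_ob (1::'k), ?i 1, ?p 1) # D) \<subseteq>
        simples"
      using D(2) by (auto simp: char_ob_def simples_def)
    ultimately show ?thesis by blast
  next
    case 3
    \<comment> \<open>One of the two basis vectors of the orbit has degree \<open>1\<close>; it becomes the image of \<open>e\<^sub>0\<close>.\<close>
    obtain m where m: "m \<in> {j, ?k}" "3 dvd grade x m - 1"
    proof (cases "3 dvd grade x j - 1")
      case False
      then have "3 dvd grade x ?k - 1" using 3 grade_invol[OF j(1)] by presburger
      then show ?thesis using that by blast
    qed (use that in blast)
    let ?n = "invol x m"
    have mn: "{m, ?n} = {j, ?k}" "m \<in> basis x" "?n \<in> basis x" "m \<notin> A" "?n \<notin> A" using m j k by auto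
    have gn: "3 dvd grade x ?n + 1" using grade_invol[OF mn(2)] m(2) by presburger
    have ne: "m \<noteq> ?n"
    proof
      assume "m = ?n"
      then have "grade x ?n = grade x m" by simp
      then show False using gn m(2) by presburger
    qed
    have g: "3 dvd 1 - grade x m" "3 dvd - 1 - grade x ?n" using m(2) gn by presburger+
    let ?i = "mat (\<lambda>a l. if a = 0 \<and> l = m then 1 else if a = 1 \<and> l =
      ?n then sign x m else 0) :: 'k vec"
    have i: "?i \<in> Intw std_ob x"
    proof (rule IntwI)
      fix a l assume "?i \<langle>a, l\<rangle> \<noteq> 0"
      then have "a = 0 \<and> l = m \<or> a = 1 \<and> l = ?n" by (auto split: if_splits)
      then show "a \<in> basis std_ob \<and> l \<in> basis x \<and> 3 dvd grade std_ob a - grade x l"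
        using mn g by auto
    next
      fix a l assume al: "a \<in> basis std_ob" "l \<in> basis x"
      have "invol x l = m \<longleftrightarrow> l = ?n" "invol x l = ?n \<longleftrightarrow> l = m" using al mn invol_invol by metis+
      then show "?i \<langle>invol std_ob a, invol x l\<rangle> = sign std_ob a * sign x l * ?i \<langle>a, l\<rangle>"
        using al mn by auto
    qed
    note p = transp_Intw[OF i]
    have ip: "mat_comp ?i (transp ?i) = id_mat std_ob"
    proof (rule Intw_eqI[OF mat_comp_Intw[OF i p] struct_Intw(1)])
      fix a b assume ab: "a \<in> basis std_ob" "b \<in> basis std_ob"
      have "mat_comp ?i (transp ?i) \<langle>a, b\<rangle> = (\<Sum>l\<in>basis x. if l =
        m then (if a = 0 \<and> b = 0 then 1 else 0) else 0) +
          (\<Sum>l\<in>basis x. if l = ?n then (if a = 1 \<and> b = 1 then 1 else 0) else 0)"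
        unfolding mat_comp_entry[OF i] sum.distrib[symmetric]
        by (rule sum.cong) (use ne in auto)
      then show "mat_comp ?i (transp ?i) \<langle>a, b\<rangle> = id_mat std_ob \<langle>a, b\<rangle>" using mn ab
        by (auto simp: id_mat_def)
    qed
    have pi: "mat_comp (transp ?i) ?i + ?e = map_mat (insert m (insert ?n A)) (\<lambda>i. i)"
      by (rule mat_eqI) (use ne mn in \<open>auto simp: mat_comp_entry[OF p]\<close>)
    have A': "insert m (insert ?n A) = insert j (insert ?k A)" using mn(1) by auto
    have "\<And>a l. l \<in> A \<Longrightarrow> ?i \<langle>a, l\<rangle> = 0" using mn by auto
    note kill3 = kill(1)[OF i this] kill(2)[OF i this, of 1]
    have "RepS3.partial_sum x ((std_ob, ?i, transp ?i) # D) (mat_comp (transp ?i) ?i + ?e)"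
      using RepS3.partial_sum_Cons[OF D(1), of std_ob ?i "transp ?i"] i p ip kill3 by simp
    moreover have "fst ` set ((std_ob, ?i, transp ?i) # D) \<subseteq> simples"
      using D(2) by (auto simp: simples_def)
    ultimately show ?thesis unfolding pi A' by blast
  qed
qed

lemma decomposition_RepS3:
  "\<exists>D. is_direct_sum RepS3 x (D :: (nat \<times> 'k::field_char_0 vec \<times> _) list) \<and> fst ` set D \<subseteq> simples"
proof -
  have "\<exists>D. RepS3.partial_sum x D (map_mat A (\<lambda>i. i) :: 'k vec) \<and> fst ` set D \<subseteq> simples"
    if "A \<subseteq> basis x" "invol x ` A \<subseteq> A" for A
    using that
  proof (induction "card A" arbitrary: A rule: less_induct)
    case less
    show ?case
    proof (cases "A = {}")
      case True
      have "(map_mat {} (\<lambda>i. i) :: 'k vec) = 0" by (rule mat_eqI) simp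
      then show ?thesis using True RepS3.partial_sum_Nil[of x] by (intro exI[of _ "[]"]) simp
    next
      case False
      then obtain j where j: "j \<in> A" by blast
      let ?k = "invol x j"
      let ?A = "A - {j, ?k}"
      have k: "?k \<in> A" using j less.prems by blast
      have b: "j \<in> basis x" using j less.prems by blast
      have A: "insert j (insert ?k ?A) = A" using j k by blast
      have "invol x l \<in> ?A" if l: "l \<in> ?A" for l
      proof -
        have "l \<in> basis x" "invol x l \<in> A" using l less.prems by auto
        moreover have "invol x l \<noteq> j" "invol x l \<noteq> ?k"
          using l b \<open>l \<in> basis x\<close> invol_invol by (metis DiffD2 insertCI)+
        ultimately show ?thesis by blast
      qed
      then have inv: "invol x ` ?A \<subseteq> ?A" by (rule image_subsetI)
      have "finite A" using less.prems(1) finite_basis finite_subset by blast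
      then have "card ?A < card A" using j by (intro psubset_card_mono) auto
      then obtain D where "RepS3.partial_sum x D (map_mat ?A (\<lambda>i. i) :: 'k vec)"
        "fst ` set D \<subseteq> simples"
        using less.hyps[of ?A] less.prems(1) inv by blast
      then show ?thesis
        using orbit_decomposition[of ?A x j D] less.prems(1) b unfolding A by auto
    qed
  qed
  from this[of "basis x"] show ?thesis
    using RepS3.partial_sum_direct_sum[of x] by (fastforce simp: id_mat_def)
qed

text \<open>Degrees leave only the entries on the diagonal, or none; between the two characters the
  involution turns the remaining entry into its negative, and on the two-dimensional
  representation it identifies the two diagonal entries.\<close>

lemma Intw_simples:
  assumes "s \<in> simples" "t \<in> simples" "(f :: 'k::field_char_0 vec) \<in> Intw s t"
  shows "s \<noteq> t \<Longrightarrow> f = 0" "s = t \<Longrightarrow> f = f \<langle>0, 0\<rangle> *\<^sub>v id_mat s"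
proof -
  have Z: "(0 :: 'k vec) \<in> Intw s t" by (rule vs.subspace_0[OF subspace_Intw])
  note E = Intw_entry[OF assms(3)]
  have N: "\<not> 3 dvd grade s i - grade t j \<Longrightarrow> f \<langle>i, j\<rangle> = 0" for i j using E(3) by blast
  have twice: "a = - a \<Longrightarrow> a = 0" for a :: 'k by (simp add: eq_neg_iff_add_eq_0 flip: mult_2)
  show "f = 0" if "s \<noteq> t"
    by (rule Intw_eqI[OF assms(3) Z])
      (use assms(1,2) that N[of 0 0] N[of 0 1] N[of 1 0] E(4)[of 0 0] in
        \<open>auto simp: simples_def intro: twice\<close>)
  show "f = f \<langle>0, 0\<rangle> *\<^sub>v id_mat s" if "s = t"
    by (rule Intw_eqI[OF assms(3)])
      (use assms(1,2) that N[of 0 0] N[of 0 1] N[of 1 0] E(4)[of 0 0] in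
        \<open>auto simp: simples_def id_mat_def intro: vs.subspace_scale[OF subspace_Intw] map_mat_Intw\<close>)
qed

interpretation RepS3: schur_category "RepS3 :: (nat, 'k::field_char_0 vec) moncat" simples
proof unfold_locales
  show "simples \<subseteq> ob RepS3" by (auto simp: simples_def)
  show "ident RepS3 s \<noteq> (0 :: 'k vec)" if "s \<in> simples" for s
  proof
    assume "ident RepS3 s = (0 :: 'k vec)"
    then have "id_mat s \<langle>0, 0\<rangle> = (0 :: 'k)" by simp
    then show False using that by (auto simp: id_mat_def simples_def)
  qed
  show "\<exists>c. f = c *\<^sub>v ident RepS3 s" if "s \<in> simples" "f \<in> hom RepS3 s s" for s and f :: "'k vec"
    using Intw_simples(2)[of s s f] that by auto
  show "f = 0" if "s \<in> simples" "t \<in> simples" "s \<noteq> t" "f \<in> hom RepS3 s t" for s t and f :: "'k vec"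
    using Intw_simples(1)[of s t f] that by auto
  show "\<exists>D. is_direct_sum RepS3 x (D :: (nat \<times> 'k vec \<times> 'k vec) list) \<and> fst ` set D \<subseteq> simples" for x
    by (rule decomposition_RepS3)
  show "\<exists>z\<in>ob RepS3. \<forall>x\<in>ob RepS3. hom RepS3 z x = {0 :: 'k vec} \<and> hom RepS3 x z = {0 :: 'k vec}"
    using Intw_zero_object by (intro bexI[of _ zero_ob]) auto
  show "\<exists>s\<in>ob RepS3. \<exists>i p j q. is_direct_sum RepS3 s [(x, i :: 'k vec, p), (y, j, q)]" for x y
    using binary_sum_RepS3 by auto
qed

section \<open>Duals and the pivotal structure\<close>

text \<open>Both \<open>dual_ob x\<close> as a dual of \<open>x\<close> and \<open>x\<close> as a dual of \<open>dual_ob x\<close> are of this form, so one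
  relation serves for left and right duals. The type argument fixes the field of the signs.\<close>

definition dual_pair :: "'k::field itself \<Rightarrow> nat \<Rightarrow> nat \<Rightarrow> bool"
  where "dual_pair _ x u \<longleftrightarrow> basis u = basis x \<and> (\<forall>i. grade u i = - grade x i \<and> invol u i =
    invol x i \<and>
    sign u i = (sign x i :: 'k))"

lemma dual_pair_dual: "dual_pair T x (dual_ob x)" "dual_pair T (dual_ob x) x"
  by (simp_all add: dual_pair_def)

definition ev_mat :: "nat \<Rightarrow> 'k::field vec"
  where "ev_mat x = mat (\<lambda>n a. if a = 0 \<and> fst_code n =
    snd_code n \<and> fst_code n \<in> basis x then 1 else 0)"

lemma ev_mat_entry [simp]: "ev_mat x \<langle>n, a\<rangle> = (if a = 0 \<and> fst_code n =
  snd_code n \<and> fst_code n \<in> basis x then 1 else 0)"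
  by (simp add: ev_mat_def)

lemma ev_mat_Intw:
  assumes "dual_pair TYPE('k::field) x u"
  shows "(ev_mat x :: 'k vec) \<in> Intw (tensor_ob x u) triv_ob"
  by (rule IntwI) (use assms in \<open>auto simp: dual_pair_def invol_inj split: if_splits\<close>)

lemma coev_mat_Intw:
  assumes "dual_pair TYPE('k::field) x u"
  shows "(transp (ev_mat x) :: 'k vec) \<in> Intw triv_ob (tensor_ob u x)"
proof -
  have d: "dual_pair TYPE('k) u x" and eq: "ev_mat u = (ev_mat x :: 'k vec)"
    using assms by (auto simp: dual_pair_def ev_mat_def)
  show ?thesis using transp_Intw[OF ev_mat_Intw[OF d]] by (simp add: eq)
qed

lemma mat_comp_runit_mat: "f \<in> Intw z (tensor_ob x triv_ob) \<Longrightarrow> j \<in> basis x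
  \<Longrightarrow> mat_comp f (runit_mat x) \<langle>i, j\<rangle> = f \<langle>i, \<langle>j, 0\<rangle>\<rangle>"
  unfolding runit_mat_def by (rule mat_comp_map_mat_right[where \<delta> = "\<lambda>i. \<langle>i, 0\<rangle>"])
    (auto simp: nat_eq_pair_iff)

lemma mat_comp_lunit_mat: "f \<in> Intw z (tensor_ob triv_ob x) \<Longrightarrow> j \<in> basis x
  \<Longrightarrow> mat_comp f (lunit_mat x) \<langle>i, j\<rangle> = f \<langle>i, \<langle>0, j\<rangle>\<rangle>"
  unfolding lunit_mat_def by (rule mat_comp_map_mat_right[where \<delta> = "\<lambda>i. \<langle>0, i\<rangle>"])
    (auto simp: nat_eq_pair_iff)

lemma id_mat_entry: "id_mat x \<langle>i, j\<rangle> = (if i \<in> basis x \<and> j = i then 1 else 0)"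
  by (simp add: id_mat_def)

text \<open>All duality morphisms in the definition of a pivotal structure are mates, so this formula
  computes all of them. It contracts the two indices of \<open>f\<close> with \<open>c\<close> and \<open>e\<close>.\<close>

lemma mate_Intw_entry:
  fixes f :: "'k::field vec"
  assumes c: "c \<in> Intw triv_ob (tensor_ob u x)" and e: "e \<in> Intw (tensor_ob y v) triv_ob"
    and f: "f \<in> Intw x y"
  shows "mate RepS3 u y v c e f \<in> Intw v u"
    and "l \<in> basis v \<Longrightarrow> i \<in> basis u \<Longrightarrow> mate RepS3 u y v c e f \<langle>l, i\<rangle> =
      (\<Sum>b\<in>basis x. \<Sum>b'\<in>basis y. c \<langle>0, \<langle>i, b\<rangle>\<rangle> * f \<langle>b, b'\<rangle> * e \<langle>\<langle>b', l\<rangle>, 0\<rangle>)"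
proof -
  define A :: "'k vec" where "A = lunit_inv_mat v"
  define B where "B = mat_tensor c (id_mat v)"
  define D where "D = mat_tensor (mat_tensor (id_mat u) f) (id_mat v)"
  define E :: "'k vec" where "E = assoc_mat u y v"
  define F where "F = mat_tensor (id_mat u) e"
  define G :: "'k vec" where "G = runit_mat u"
  have A: "A \<in> Intw v (tensor_ob triv_ob v)" and B:
    "B \<in> Intw (tensor_ob triv_ob v) (tensor_ob (tensor_ob u x) v)"
    and D: "D \<in> Intw (tensor_ob (tensor_ob u x) v) (tensor_ob (tensor_ob u y) v)"
    and E: "E \<in> Intw (tensor_ob (tensor_ob u y) v) (tensor_ob u (tensor_ob y v))"
    and F: "F \<in> Intw (tensor_ob u (tensor_ob y v)) (tensor_ob u triv_ob)"
      and G: "G \<in> Intw (tensor_ob u triv_ob) u"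
    unfolding A_def B_def D_def E_def F_def G_def using struct_Intw mat_tensor_Intw c e f by metis+
  have m: "mate RepS3 u y v c e f = mat_comp (mat_comp (mat_comp (mat_comp (mat_comp A B) D) E) F)
    G"
    unfolding mate_def A_def B_def D_def E_def F_def G_def by simp
  have AB: "mat_comp A B \<in> Intw v (tensor_ob (tensor_ob u x) v)" using mat_comp_Intw A B by blast
  have ABD: "mat_comp (mat_comp A B) D \<in> Intw v (tensor_ob (tensor_ob u y) v)"
    using mat_comp_Intw AB D by blast
  have ABDE: "mat_comp (mat_comp (mat_comp A B) D) E \<in> Intw v (tensor_ob u (tensor_ob y v))"
    using mat_comp_Intw ABD E by blast
  have all: "mat_comp (mat_comp (mat_comp (mat_comp A B) D) E) F \<in> Intw v (tensor_ob u triv_ob)"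
    using mat_comp_Intw ABDE F by blast
  show "mate RepS3 u y v c e f \<in> Intw v u" unfolding m using mat_comp_Intw all G by blast
  assume l: "l \<in> basis v" and i: "i \<in> basis u"
  have AB_e: "mat_comp A B \<langle>l, \<langle>\<langle>a, b\<rangle>, d\<rangle>\<rangle> = (if d = l then c \<langle>0, \<langle>a, b\<rangle>\<rangle> else 0)" for a b d
    using l by (simp add: A_def B_def lunit_inv_mat_def mat_comp_map_mat_left mat_tensor_entry
      id_mat_entry)
  have ABD_e: "mat_comp (mat_comp A B) D \<langle>l, \<langle>\<langle>a, b'\<rangle>, d\<rangle>\<rangle> =
      (if d = l then \<Sum>b\<in>basis x. c \<langle>0, \<langle>a, b\<rangle>\<rangle> * f \<langle>b, b'\<rangle> else 0)" if a: "a \<in> basis u" for a b' d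
  proof -
    have "mat_comp (mat_comp A B) D \<langle>l, \<langle>\<langle>a, b'\<rangle>, d\<rangle>\<rangle> =
      (\<Sum>a'\<in>basis u. \<Sum>b\<in>basis x. \<Sum>d'\<in>basis v. if d' = l then (if a' = a then
        (if d = l then c \<langle>0, \<langle>a, b\<rangle>\<rangle> * f \<langle>b, b'\<rangle> else 0) else 0) else 0)"
      unfolding mat_comp_entry[OF AB] sum_basis_ten AB_e D_def
      by (intro sum.cong refl) (auto simp: mat_tensor_entry id_mat_entry)
    also have "\<dots> = (\<Sum>a'\<in>basis u. if a' = a then
        (\<Sum>b\<in>basis x. if d = l then c \<langle>0, \<langle>a, b\<rangle>\<rangle> * f \<langle>b, b'\<rangle> else 0) else 0)"
      using l by (intro sum.cong refl) auto
    finally show ?thesis using a by simp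
  qed
  have ABDE_e: "mat_comp (mat_comp (mat_comp A B) D) E \<langle>l, \<langle>a, \<langle>b', d\<rangle>\<rangle>\<rangle> =
    mat_comp (mat_comp A B) D \<langle>l, \<langle>\<langle>a, b'\<rangle>, d\<rangle>\<rangle>"
    if "a \<in> basis u" "b' \<in> basis y" "d \<in> basis v" for a b' d
    unfolding E_def assoc_mat_def
    by (subst mat_comp_map_mat_right[OF ABD, where \<delta> = unassoc_idx])
      (use that in \<open>auto simp: unassoc_idx_def assoc_idx_def\<close>)
  have "mate RepS3 u y v c e f \<langle>l, i\<rangle> = mat_comp (mat_comp (mat_comp (mat_comp A B) D) E) F
    \<langle>l, \<langle>i, 0\<rangle>\<rangle>"
    unfolding m G_def by (rule mat_comp_runit_mat[OF all i])
  also have "\<dots> = (\<Sum>a\<in>basis u. \<Sum>b'\<in>basis y. \<Sum>d\<in>basis v. if d = l then (if a = i then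
      (\<Sum>b\<in>basis x. c \<langle>0, \<langle>i, b\<rangle>\<rangle> * f \<langle>b, b'\<rangle>) * e \<langle>\<langle>b', l\<rangle>, 0\<rangle> else 0) else 0)"
    unfolding mat_comp_entry[OF ABDE] sum_basis_ten F_def
    by (intro sum.cong refl) (auto simp: mat_tensor_entry id_mat_entry ABDE_e ABD_e)
  also have "\<dots> = (\<Sum>a\<in>basis u. if a = i then (\<Sum>b'\<in>basis y.
      (\<Sum>b\<in>basis x. c \<langle>0, \<langle>i, b\<rangle>\<rangle> * f \<langle>b, b'\<rangle>) * e \<langle>\<langle>b', l\<rangle>, 0\<rangle>) else 0)"
    using l by (intro sum.cong refl) auto
  also have "\<dots> = (\<Sum>b'\<in>basis y. \<Sum>b\<in>basis x. c \<langle>0, \<langle>i, b\<rangle>\<rangle> * f \<langle>b, b'\<rangle> * e \<langle>\<langle>b', l\<rangle>, 0\<rangle>)"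
    using i by (simp add: sum_distrib_right)
  also have "\<dots> = (\<Sum>b\<in>basis x. \<Sum>b'\<in>basis y. c \<langle>0, \<langle>i, b\<rangle>\<rangle> * f \<langle>b, b'\<rangle> * e \<langle>\<langle>b', l\<rangle>, 0\<rangle>)"
    by (rule sum.swap)
  finally show "mate RepS3 u y v c e f \<langle>l, i\<rangle> = \<dots>" .
qed

lemma mate_coev_mat_entry:
  fixes f :: "'k::field vec"
  assumes d: "dual_pair TYPE('k) x u" and e: "e \<in> Intw (tensor_ob y v) triv_ob"
    and f: "f \<in> Intw x y"
    and l: "l \<in> basis v" and i: "i \<in> basis u"
  shows "mate RepS3 u y v (transp (ev_mat x)) e f \<langle>l, i\<rangle> = (\<Sum>b\<in>basis y. f \<langle>i, b\<rangle> * e \<langle>\<langle>b, l\<rangle>, 0\<rangle>)"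
proof -
  have i': "i \<in> basis x" using d i by (simp add: dual_pair_def)
  have "mate RepS3 u y v (transp (ev_mat x)) e f \<langle>l, i\<rangle> =
      (\<Sum>b\<in>basis x. if b = i then (\<Sum>b'\<in>basis y. f \<langle>i, b'\<rangle> * e \<langle>\<langle>b', l\<rangle>, 0\<rangle>) else 0)"
    unfolding mate_Intw_entry(2)[OF coev_mat_Intw[OF d] e f l i]
    by (intro sum.cong refl) (use i' in auto)
  then show ?thesis using i' by simp
qed

lemma mate_ev_mat_entry:
  fixes f :: "'k::field vec"
  assumes d: "dual_pair TYPE('k) y v" and c: "c \<in> Intw triv_ob (tensor_ob u x)"
    and f: "f \<in> Intw x y"
    and l: "l \<in> basis v" and i: "i \<in> basis u"
  shows "mate RepS3 u y v c (ev_mat y) f \<langle>l, i\<rangle> = (\<Sum>b\<in>basis x. c \<langle>0, \<langle>i, b\<rangle>\<rangle> * f \<langle>b, l\<rangle>)"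
proof -
  have l': "l \<in> basis y" using d l by (simp add: dual_pair_def)
  have "mate RepS3 u y v c (ev_mat y) f \<langle>l, i\<rangle> =
      (\<Sum>b\<in>basis x. \<Sum>b'\<in>basis y. if b' = l then c \<langle>0, \<langle>i, b\<rangle>\<rangle> * f \<langle>b, l\<rangle> else 0)"
    unfolding mate_Intw_entry(2)[OF c ev_mat_Intw[OF d] f l i]
    by (intro sum.cong refl) auto
  then show ?thesis using l' by simp
qed

lemma mate_transpose:
  fixes f :: "'k::field vec"
  assumes du: "dual_pair TYPE('k) x u" and dv: "dual_pair TYPE('k) y v" and f: "f \<in> Intw x y"
  shows "mate RepS3 u y v (transp (ev_mat x)) (ev_mat y) f = transp f"
proof (rule Intw_eqI)
  show "mate RepS3 u y v (transp (ev_mat x)) (ev_mat y) f \<in> Intw v u"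
    by (rule mate_Intw_entry(1)[OF coev_mat_Intw[OF du] ev_mat_Intw[OF dv] f])
  have "transp f \<in> Intw y x" by (rule transp_Intw[OF f])
  then show "transp f \<in> Intw v u"
    using du dv unfolding Intw_def dual_pair_def by (auto simp: dvd_diff_commute)
  fix l i assume "l \<in> basis v" "i \<in> basis u"
  then show "mate RepS3 u y v (transp (ev_mat x)) (ev_mat y) f \<langle>l, i\<rangle> = transp f \<langle>l, i\<rangle>"
    using dv by
      (simp add: mate_coev_mat_entry[OF du ev_mat_Intw[OF dv] f] dual_pair_def if_distrib[of
        "\<lambda>a. _ * a"] cong: if_cong)
qed

text \<open>The second zigzag is the mate of an identity. The first one is computed in the same way as
  mates.\<close>

lemma is_dual_RepS3:
  assumes d: "dual_pair TYPE('k::field) x u"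
  shows "is_dual RepS3 x u (ev_mat x) (transp (ev_mat x) :: 'k vec)"
proof -
  note e = ev_mat_Intw[OF d] and c = coev_mat_Intw[OF d]
  define A :: "'k vec" where "A = runit_inv_mat x"
  define B :: "'k vec" where "B = mat_tensor (id_mat x) (transp (ev_mat x))"
  define E :: "'k vec" where "E = unassoc_mat x u x"
  define F :: "'k vec" where "F = mat_tensor (ev_mat x) (id_mat x)"
  define G :: "'k vec" where "G = lunit_mat x"
  have A: "A \<in> Intw x (tensor_ob x triv_ob)" and B:
    "B \<in> Intw (tensor_ob x triv_ob) (tensor_ob x (tensor_ob u x))"
    and E: "E \<in> Intw (tensor_ob x (tensor_ob u x)) (tensor_ob (tensor_ob x u) x)"
    and F: "F \<in> Intw (tensor_ob (tensor_ob x u) x) (tensor_ob triv_ob x)"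
      and G: "G \<in> Intw (tensor_ob triv_ob x) x"
    unfolding A_def B_def E_def F_def G_def using struct_Intw mat_tensor_Intw c e by metis+
  have AB: "mat_comp A B \<in> Intw x (tensor_ob x (tensor_ob u x))" using mat_comp_Intw A B by blast
  have ABE: "mat_comp (mat_comp A B) E \<in> Intw x (tensor_ob (tensor_ob x u) x)"
    using mat_comp_Intw AB E by blast
  have all: "mat_comp (mat_comp (mat_comp A B) E) F \<in> Intw x (tensor_ob triv_ob x)"
    using mat_comp_Intw ABE F by blast
  have "mat_comp (mat_comp (mat_comp (mat_comp A B) E) F) G = id_mat x"
  proof (rule Intw_eqI[OF mat_comp_Intw[OF all G] struct_Intw(1)])
    fix i j assume i: "i \<in> basis x" and j: "j \<in> basis x"
    have ABE_e: "mat_comp (mat_comp A B) E \<langle>i, \<langle>\<langle>a, b\<rangle>, d\<rangle>\<rangle> = (if a = i \<and> b = d then 1 else 0)"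
      if "a \<in> basis x" "b \<in> basis u" "d \<in> basis x" for a b d
      unfolding E_def unassoc_mat_def
      by (subst mat_comp_map_mat_right[OF AB, where \<delta> = assoc_idx])
        (use that i in \<open>auto simp: unassoc_idx_def assoc_idx_def A_def B_def runit_inv_mat_def
          mat_comp_map_mat_left mat_tensor_entry id_mat_entry\<close>)
    have "mat_comp (mat_comp (mat_comp (mat_comp A B) E) F) G \<langle>i, j\<rangle> =
      mat_comp (mat_comp (mat_comp A B) E) F \<langle>i, \<langle>0, j\<rangle>\<rangle>"
      unfolding G_def by (rule mat_comp_lunit_mat[OF all j])
    also have "\<dots> = (\<Sum>a\<in>basis x. \<Sum>b\<in>basis u. \<Sum>d\<in>basis x. if d = j then (if b = j then (if a = j then
        (if i = j then 1 else 0) else 0) else 0) else 0)"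
      unfolding mat_comp_entry[OF ABE] sum_basis_ten F_def
      by (intro sum.cong refl) (auto simp: mat_tensor_entry id_mat_entry ABE_e)
    also have "\<dots> = id_mat x \<langle>i, j\<rangle>"
      using i j d by (simp add: id_mat_entry dual_pair_def)
    finally show "mat_comp (mat_comp (mat_comp (mat_comp A B) E) F) G \<langle>i, j\<rangle> = id_mat x \<langle>i, j\<rangle>" .
  qed
  then have zig1:
    "mat_comp (mat_comp
      (mat_comp (mat_comp (runit_inv_mat x) (mat_tensor (id_mat x) (transp (ev_mat x))))
        (unassoc_mat x u x)) (mat_tensor (ev_mat x) (id_mat x))) (lunit_mat x) =
          (id_mat x :: 'k vec)"
    by (simp only: A_def B_def E_def F_def G_def)
  have c': "mat_tensor (transp (ev_mat x)) (id_mat u :: 'k vec)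
    \<in> Intw (tensor_ob triv_ob u) (tensor_ob (tensor_ob u x) u)"
    by (rule mat_tensor_Intw[OF c struct_Intw(1)])
  have "transp (id_mat x) = (id_mat u :: 'k vec)"
    by (rule mat_eqI) (use d in \<open>auto simp: id_mat_entry dual_pair_def\<close>)
  then have "mate RepS3 u x u (transp (ev_mat x)) (ev_mat x) (id_mat x) = (id_mat u :: 'k vec)"
    using mate_transpose[OF d d struct_Intw(1)] by simp
  then have zig2:
    "mat_comp (mat_comp
      (mat_comp (mat_comp (lunit_inv_mat u) (mat_tensor (transp (ev_mat x)) (id_mat u)))
        (assoc_mat u x u)) (mat_tensor (id_mat u) (ev_mat x))) (runit_mat u) = (id_mat u :: 'k vec)"
    unfolding mate_def
      by (simp add: tensor_id_mat comp_id_mat[OF mat_comp_Intw[OF struct_Intw(5) c']])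
  show ?thesis
    unfolding is_dual_def using e c zig1 zig2 by simp
qed

text \<open>Passing to the dual negates degrees, hence the double dual is the same representation and
  the identity matrices are a pivotal structure.\<close>

definition dual_data :: "(nat, 'k::field vec) pivotal_data"
  where "dual_data = \<lparr>rdual = dual_ob, ev_r = ev_mat, coev_r = \<lambda>x. transp (ev_mat x),
    ldual = dual_ob, ev_l = ev_mat, coev_l = \<lambda>x. transp (ev_mat x), piv = id_mat\<rparr>"

lemma dual_data_simps [simp]:
  "rdual dual_data = dual_ob" "ev_r dual_data = ev_mat" "coev_r dual_data = (\<lambda>x. transp (ev_mat x))"
  "ldual dual_data = dual_ob" "ev_l dual_data = ev_mat" "coev_l dual_data = (\<lambda>x. transp (ev_mat x))"
  "piv dual_data = id_mat"
  by (simp_all add: dual_data_def)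

lemma ev_mat_dual [simp]: "ev_mat (dual_ob x) = ev_mat x"
  by (simp add: ev_mat_def)

lemma Intw_dual_dual: "Intw (dual_ob (dual_ob x)) y = Intw x y" "Intw y (dual_ob (dual_ob x)) =
  Intw y x"
  "id_mat (dual_ob (dual_ob x)) = id_mat x"
  by (simp_all add: Intw_def id_mat_def)

lemma rdual_mor_RepS3: "f \<in> Intw x y \<Longrightarrow> rdual_mor RepS3 dual_data x y f = transp f"
  unfolding rdual_mor_def dual_data_simps
  by (rule mate_transpose[OF dual_pair_dual(1) dual_pair_dual(1)])

definition swap_idx :: "nat \<Rightarrow> nat" where "swap_idx n = \<langle>snd_code n, fst_code n\<rangle>"

lemma swap_idx_pair [simp]: "fst_code (swap_idx n) = snd_code n" "snd_code (swap_idx n) =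
  fst_code n" "swap_idx \<langle>i, j\<rangle> = \<langle>j, i\<rangle>" "swap_idx (swap_idx n) = n"
  by (simp_all add: swap_idx_def)

lemma ev_ten_RepS3:
  shows "ev_ten RepS3 dual_data x y
    \<in> (Intw (tensor_ob (tensor_ob x y) (tensor_ob (dual_ob y) (dual_ob x))) triv_ob :: 'k::field
      vec set)"
    and "i \<in> basis x \<Longrightarrow> j \<in> basis y \<Longrightarrow> j' \<in> basis y \<Longrightarrow> i' \<in> basis x \<Longrightarrow>
      ev_ten RepS3 dual_data x y \<langle>\<langle>\<langle>i, j\<rangle>, \<langle>j', i'\<rangle>\<rangle>, 0\<rangle> = (if i = i' \<and> j = j' then 1 else 0 :: 'k)"
proof -
  let ?x = "dual_ob x" and ?y = "dual_ob y"
  define A :: "'k vec" where "A = unassoc_mat y ?y ?x"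
  define B :: "'k vec" where "B = mat_tensor (ev_mat y) (id_mat ?x)"
  define D :: "'k vec" where "D = lunit_mat ?x"
  have A: "A \<in> Intw (tensor_ob y (tensor_ob ?y ?x)) (tensor_ob (tensor_ob y ?y) ?x)"
    and B: "B \<in> Intw (tensor_ob (tensor_ob y ?y) ?x) (tensor_ob triv_ob ?x)"
      and D: "D \<in> Intw (tensor_ob triv_ob ?x) ?x"
    unfolding A_def B_def D_def
    by (rule struct_Intw mat_tensor_Intw[OF ev_mat_Intw[OF dual_pair_dual(1)] struct_Intw(1)])+
  have AB: "mat_comp A B \<in> Intw (tensor_ob y (tensor_ob ?y ?x)) (tensor_ob triv_ob ?x)"
    using mat_comp_Intw A B by blast
  have ABD: "mat_comp (mat_comp A B) D \<in> Intw (tensor_ob y (tensor_ob ?y ?x)) ?x"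
    using mat_comp_Intw AB D by blast
  define T where "T = mat_tensor (id_mat x) (mat_comp (mat_comp A B) D)"
  have T: "T \<in> Intw (tensor_ob x (tensor_ob y (tensor_ob ?y ?x))) (tensor_ob x ?x)"
    unfolding T_def by (rule mat_tensor_Intw[OF struct_Intw(1) ABD])
  define E :: "'k vec" where "E = assoc_mat x y (tensor_ob ?y ?x)"
  have E: "E \<in> Intw (tensor_ob (tensor_ob x y) (tensor_ob ?y ?x))
    (tensor_ob x (tensor_ob y (tensor_ob ?y ?x)))"
    unfolding E_def by (rule struct_Intw)
  have ET: "mat_comp E T \<in> Intw (tensor_ob (tensor_ob x y) (tensor_ob ?y ?x)) (tensor_ob x ?x)"
    using mat_comp_Intw E T by blast
  have ev: "ev_ten RepS3 dual_data x y = mat_comp (mat_comp E T) (ev_mat x)"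
    unfolding ev_ten_def A_def B_def D_def E_def T_def by (simp add: Let_def)
  show "ev_ten RepS3 dual_data x y
    \<in> (Intw (tensor_ob (tensor_ob x y) (tensor_ob ?y ?x)) triv_ob :: 'k vec set)"
    unfolding ev by (rule mat_comp_Intw[OF ET ev_mat_Intw[OF dual_pair_dual(1)]])
  assume ij: "i \<in> basis x" "j \<in> basis y" "j' \<in> basis y" "i' \<in> basis x"
  have ABD_e: "mat_comp (mat_comp A B) D \<langle>\<langle>j, \<langle>j', i'\<rangle>\<rangle>, l\<rangle> = (if j = j' \<and> l = i' then 1 else 0)"
    if "l \<in> basis x" for l
    unfolding D_def
    by (subst mat_comp_lunit_mat[OF AB])
      (use ij that in \<open>auto simp: A_def B_def unassoc_mat_def unassoc_idx_def
        mat_comp_map_mat_left mat_tensor_entry id_mat_entry\<close>)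
  have ET_e: "mat_comp E T \<langle>\<langle>\<langle>i, j\<rangle>, \<langle>j', i'\<rangle>\<rangle>, \<langle>a, l\<rangle>\<rangle> =
    (if a = i \<and> j = j' \<and> l = i' then 1 else 0)"
    if "l \<in> basis x" for a l
    using ij that
      by (auto simp: E_def T_def assoc_mat_def assoc_idx_def mat_comp_map_mat_left
        mat_tensor_entry id_mat_entry ABD_e)
  have "mat_comp (mat_comp E T) (ev_mat x) \<langle>\<langle>\<langle>i, j\<rangle>, \<langle>j', i'\<rangle>\<rangle>, 0\<rangle> =
      (\<Sum>a\<in>basis x. \<Sum>l\<in>basis x.
        if l = i' then (if a = i' then (if i = i' \<and> j = j' then 1 else 0) else 0) else 0)"
    unfolding mat_comp_entry[OF ET] sum_basis_ten basis_simps
    by (intro sum.cong refl) (auto simp: ET_e)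
  then show "ev_ten RepS3 dual_data x y \<langle>\<langle>\<langle>i, j\<rangle>, \<langle>j', i'\<rangle>\<rangle>, 0\<rangle> =
    (if i = i' \<and> j = j' then 1 else 0 :: 'k)"
    unfolding ev using ij by simp
qed

lemma coev_ten_RepS3:
  shows "coev_ten RepS3 dual_data x y
    \<in> (Intw triv_ob (tensor_ob (tensor_ob (dual_ob y) (dual_ob x))
      (tensor_ob x y)) :: 'k::field vec set)"
    and "i \<in> basis x \<Longrightarrow> j \<in> basis y \<Longrightarrow> j' \<in> basis y \<Longrightarrow> i' \<in> basis x \<Longrightarrow>
      coev_ten RepS3 dual_data x y \<langle>0, \<langle>\<langle>j', i'\<rangle>, \<langle>i, j\<rangle>\<rangle>\<rangle> =
        (if i = i' \<and> j = j' then 1 else 0 :: 'k)"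
proof -
  let ?x = "dual_ob x" and ?y = "dual_ob y"
  define A :: "'k vec" where "A = lunit_inv_mat y"
  define B :: "'k vec" where "B = mat_tensor (transp (ev_mat x)) (id_mat y)"
  define D :: "'k vec" where "D = assoc_mat ?x x y"
  have A: "A \<in> Intw y (tensor_ob triv_ob y)" and B:
    "B \<in> Intw (tensor_ob triv_ob y) (tensor_ob (tensor_ob ?x x) y)"
    and D: "D \<in> Intw (tensor_ob (tensor_ob ?x x) y) (tensor_ob ?x (tensor_ob x y))"
    unfolding A_def B_def D_def
    by (rule struct_Intw mat_tensor_Intw[OF coev_mat_Intw[OF dual_pair_dual(1)] struct_Intw(1)])+
  have AB: "mat_comp A B \<in> Intw y (tensor_ob (tensor_ob ?x x) y)" using mat_comp_Intw A B by blast
  have ABD: "mat_comp (mat_comp A B) D \<in> Intw y (tensor_ob ?x (tensor_ob x y))"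
    using mat_comp_Intw AB D by blast
  define T where "T = mat_tensor (id_mat ?y) (mat_comp (mat_comp A B) D)"
  have T: "T \<in> Intw (tensor_ob ?y y) (tensor_ob ?y (tensor_ob ?x (tensor_ob x y)))"
    unfolding T_def by (rule mat_tensor_Intw[OF struct_Intw(1) ABD])
  define E :: "'k vec" where "E = unassoc_mat ?y ?x (tensor_ob x y)"
  have E: "E \<in> Intw (tensor_ob ?y (tensor_ob ?x (tensor_ob x y)))
    (tensor_ob (tensor_ob ?y ?x) (tensor_ob x y))"
    unfolding E_def by (rule struct_Intw)
  note c = coev_mat_Intw[OF dual_pair_dual(1), of y, where ?'k = 'k]
  have cT: "mat_comp (transp (ev_mat y)) T \<in> Intw triv_ob
    (tensor_ob ?y (tensor_ob ?x (tensor_ob x y)))" using mat_comp_Intw c T by blast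
  have ev: "coev_ten RepS3 dual_data x y = mat_comp (mat_comp (transp (ev_mat y)) T) E"
    unfolding coev_ten_def A_def B_def D_def E_def T_def by (simp add: Let_def)
  show "coev_ten RepS3 dual_data x y
    \<in> (Intw triv_ob (tensor_ob (tensor_ob ?y ?x) (tensor_ob x y)) :: 'k vec set)"
    unfolding ev by (rule mat_comp_Intw[OF cT E])
  assume ij: "i \<in> basis x" "j \<in> basis y" "j' \<in> basis y" "i' \<in> basis x"
  have ABD_e: "mat_comp (mat_comp A B) D \<langle>l, \<langle>i', \<langle>i, j\<rangle>\<rangle>\<rangle> = (if i = i' \<and> l = j then 1 else 0)"
    if "l \<in> basis y" for l
    unfolding D_def assoc_mat_def
    by (subst mat_comp_map_mat_right[OF AB, where \<delta> = unassoc_idx])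
      (use ij that in \<open>auto simp: A_def B_def lunit_inv_mat_def unassoc_idx_def assoc_idx_def
        mat_comp_map_mat_left mat_tensor_entry id_mat_entry\<close>)
  have "mat_comp (mat_comp (transp (ev_mat y)) T) E \<langle>0, \<langle>\<langle>j', i'\<rangle>, \<langle>i, j\<rangle>\<rangle>\<rangle> =
    mat_comp (transp (ev_mat y)) T \<langle>0, \<langle>j', \<langle>i', \<langle>i, j\<rangle>\<rangle>\<rangle>\<rangle>"
    unfolding E_def unassoc_mat_def
    by (subst mat_comp_map_mat_right[OF cT, where \<delta> = assoc_idx])
      (use ij in \<open>auto simp: unassoc_idx_def assoc_idx_def\<close>)
  also have "\<dots> =
    (\<Sum>a\<in>basis y. \<Sum>l\<in>basis y.
      if l = j then (if a = j then (if i = i' \<and> j = j' then 1 else 0) else 0) else 0)"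
    unfolding mat_comp_entry[OF c] sum_basis_ten basis_simps
    by (intro sum.cong refl) (auto simp: T_def mat_tensor_entry id_mat_entry ABD_e)
  finally show "coev_ten RepS3 dual_data x y \<langle>0, \<langle>\<langle>j', i'\<rangle>, \<langle>i, j\<rangle>\<rangle>\<rangle> =
    (if i = i' \<and> j = j' then 1 else 0 :: 'k)"
    unfolding ev using ij by simp
qed

lemma swap_idx_Intw: "map_mat (basis (tensor_ob x y)) swap_idx
  \<in> Intw (tensor_ob x y) (tensor_ob y x)"
  by (rule map_mat_Intw) (simp add: swap_idx_def mult.commute)

lemma rdual_ten_RepS3:
  "rdual_ten RepS3 dual_data x y =
    (map_mat (basis (tensor_ob (dual_ob y) (dual_ob x))) swap_idx :: 'k::field vec)"
proof -
  let ?xy = "tensor_ob x y" and ?d = "tensor_ob (dual_ob y) (dual_ob x)"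
  note d = dual_pair_dual(1)[of "TYPE('k)" ?xy]
  note e = ev_ten_RepS3(1)[of x y, where ?'k = 'k]
  have H: "rdual_ten RepS3 dual_data x y \<in> (Intw ?d (dual_ob ?xy) :: 'k vec set)"
    unfolding rdual_ten_def using mate_Intw_entry(1)[OF coev_mat_Intw[OF d] e struct_Intw(1)]
      by simp
  show ?thesis
  proof (rule Intw_eqI[OF H])
    show "map_mat (basis ?d) swap_idx \<in> (Intw ?d (dual_ob ?xy) :: 'k vec set)"
      by (rule map_mat_Intw) (simp add: swap_idx_def mult.commute)
    fix l m assume lm: "l \<in> basis ?d" "m \<in> basis (dual_ob ?xy)"
    have "rdual_ten RepS3 dual_data x y \<langle>l, m\<rangle> =
      (\<Sum>b\<in>basis ?xy. id_mat ?xy \<langle>m, b\<rangle> * (ev_ten RepS3 dual_data x y \<langle>\<langle>b, l\<rangle>, 0\<rangle> :: 'k))"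
      unfolding rdual_ten_def using mate_coev_mat_entry[OF d e struct_Intw(1) lm] by simp
    also have "\<dots> = (\<Sum>b\<in>basis ?xy. if b = m then ev_ten RepS3 dual_data x y \<langle>\<langle>m, l\<rangle>, 0\<rangle> else 0)"
      by (intro sum.cong refl) (auto simp: id_mat_entry)
    also have "\<dots> = ev_ten RepS3 dual_data x y \<langle>\<langle>m, l\<rangle>, 0\<rangle>" using lm by simp
    also have "\<dots> = map_mat (basis ?d) swap_idx \<langle>l, m\<rangle>"
      using lm ev_ten_RepS3(2)[of "fst_code m" x "snd_code m" y "fst_code l"
        "snd_code l", where ?'k = 'k]
      by (auto simp: nat_eq_pair_iff swap_idx_def)
    finally show "rdual_ten RepS3 dual_data x y \<langle>l, m\<rangle> =
      (map_mat (basis ?d) swap_idx \<langle>l, m\<rangle> :: 'k)" .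
  qed
qed

lemma rdual_ten_inv_RepS3:
  "rdual_ten_inv RepS3 dual_data x y = (map_mat (basis (tensor_ob x y)) swap_idx :: 'k::field vec)"
  "rdual_ten_inv RepS3 dual_data x y
    \<in> (Intw (dual_ob (tensor_ob x y)) (tensor_ob (dual_ob y) (dual_ob x)) :: 'k::field vec set)"
proof -
  let ?xy = "tensor_ob x y" and ?d = "tensor_ob (dual_ob y) (dual_ob x)"
  note d = dual_pair_dual(1)[of "TYPE('k)" ?xy]
  note c = coev_ten_RepS3(1)[of x y, where ?'k = 'k]
  show H: "rdual_ten_inv RepS3 dual_data x y \<in> (Intw (dual_ob ?xy) ?d :: 'k vec set)"
    unfolding rdual_ten_inv_def using mate_Intw_entry(1)[OF c ev_mat_Intw[OF d] struct_Intw(1)]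
      by simp
  show "rdual_ten_inv RepS3 dual_data x y = (map_mat (basis ?xy) swap_idx :: 'k vec)"
  proof (rule Intw_eqI[OF H])
    show "map_mat (basis ?xy) swap_idx \<in> (Intw (dual_ob ?xy) ?d :: 'k vec set)"
      using map_mat_Intw[of "dual_ob ?xy" swap_idx ?d, where ?'k = 'k]
        by (simp add: swap_idx_def mult.commute)
    fix l m assume lm: "l \<in> basis (dual_ob ?xy)" "m \<in> basis ?d"
    have "rdual_ten_inv RepS3 dual_data x y \<langle>l, m\<rangle> =
      (\<Sum>b\<in>basis ?xy. coev_ten RepS3 dual_data x y \<langle>0, \<langle>m, b\<rangle>\<rangle> * (id_mat ?xy \<langle>b, l\<rangle> :: 'k))"
      unfolding rdual_ten_inv_def using mate_ev_mat_entry[OF d c struct_Intw(1) lm] by simp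
    also have "\<dots> = (\<Sum>b\<in>basis ?xy. if b = l then coev_ten RepS3 dual_data x y \<langle>0, \<langle>m, l\<rangle>\<rangle> else 0)"
      by (intro sum.cong refl) (auto simp: id_mat_entry)
    also have "\<dots> = coev_ten RepS3 dual_data x y \<langle>0, \<langle>m, l\<rangle>\<rangle>" using lm by simp
    also have "\<dots> = map_mat (basis ?xy) swap_idx \<langle>l, m\<rangle>"
      using lm coev_ten_RepS3(2)[of "fst_code l" x "snd_code l" y "fst_code m"
        "snd_code m", where ?'k = 'k]
      by (auto simp: nat_eq_pair_iff swap_idx_def)
    finally show "rdual_ten_inv RepS3 dual_data x y \<langle>l, m\<rangle> =
      (map_mat (basis ?xy) swap_idx \<langle>l, m\<rangle> :: 'k)" .
  qed
qed

text \<open>The isomorphism is a composite of two matrices that exchange the tensor factors.\<close>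

lemma rr_mu_RepS3: "rr_mu RepS3 dual_data x y = (id_mat (tensor_ob x y) :: 'k::field vec)"
proof -
  have "transp (rdual_ten_inv RepS3 dual_data x y) =
    (map_mat (basis (tensor_ob (dual_ob y) (dual_ob x))) swap_idx :: 'k vec)"
    unfolding rdual_ten_inv_RepS3 by (rule mat_eqI) (auto simp: nat_eq_pair_iff)
  then show ?thesis
    unfolding rr_mu_def using rdual_mor_RepS3[OF rdual_ten_inv_RepS3(2)[of x y, where ?'k = 'k]]
    by (simp add: rdual_ten_RepS3, subst map_mat_comp)
      (auto simp: id_mat_def map_mat_def mat_def fun_eq_iff)
qed

lemma rr_eta_RepS3: "rr_eta RepS3 dual_data = (id_mat triv_ob :: 'k::field vec)"
proof -
  note d = dual_pair_dual(1)[of "TYPE('k)" triv_ob]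
  have H: "Intw triv_ob (dual_ob triv_ob) = (Intw triv_ob triv_ob :: 'k vec set)"
    "Intw (dual_ob triv_ob) triv_ob = (Intw triv_ob triv_ob :: 'k vec set)"
    by (simp_all add: Intw_def)
  have lunit_mat: "lunit_mat triv_ob = (ev_mat triv_ob :: 'k vec)" "lunit_inv_mat triv_ob =
    (transp (ev_mat triv_ob) :: 'k vec)"
    by (rule mat_eqI; auto simp: lunit_mat_def lunit_inv_mat_def nat_eq_pair_iff)+
  have d': "dual_pair TYPE('k) triv_ob triv_ob" by (simp add: dual_pair_def)
  have transp: "transp (id_mat triv_ob) = (id_mat triv_ob :: 'k vec)"
    by (rule mat_eqI) (auto simp: id_mat_entry)
  have "rdual_unit RepS3 dual_data = (id_mat triv_ob :: 'k vec)"
    unfolding rdual_unit_def using mate_transpose[OF d d' struct_Intw(1)]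
      by (simp add: lunit_mat transp)
  moreover have "rdual_unit_inv RepS3 dual_data = (id_mat triv_ob :: 'k vec)"
    unfolding rdual_unit_inv_def using mate_transpose[OF d' d struct_Intw(1)]
      by (simp add: lunit_mat transp)
  moreover have "rdual_mor RepS3 dual_data (dual_ob triv_ob) triv_ob (id_mat triv_ob) =
    (id_mat triv_ob :: 'k vec)"
    using rdual_mor_RepS3[of "id_mat triv_ob :: 'k vec"
      "dual_ob triv_ob" triv_ob] struct_Intw(1)[of triv_ob, where ?'a = 'k] H transp by simp
  ultimately show ?thesis
    unfolding rr_eta_def using id_mat_comp[OF struct_Intw(1)[of triv_ob, where ?'a = 'k]] by simp
qed

lemma pivotal_RepS3: "pivotal_structure (RepS3 :: (nat, 'k::field vec) moncat) dual_data"
proof -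
  have iso: "is_iso RepS3 x (dual_ob (dual_ob x)) (id_mat x :: 'k vec)" for x
    by (rule is_isoI[of _ _ _ "id_mat x"])
      (simp_all add: Intw_dual_dual struct_Intw id_mat_comp[OF struct_Intw(1)])
  have nat: "mat_comp f (id_mat y) = mat_comp (id_mat x)
    (rdual_mor RepS3 dual_data (dual_ob y) (dual_ob x)
      (rdual_mor RepS3 dual_data x y f))" if f: "f \<in> Intw x y" for x y and f :: "'k vec"
  proof -
    have "transp f \<in> Intw (dual_ob y) (dual_ob x)"
      using transp_Intw[OF f] unfolding Intw_def by (auto simp: dvd_diff_commute)
    then show ?thesis
      by (simp add: rdual_mor_RepS3[OF f] rdual_mor_RepS3 id_mat_comp[OF f] comp_id_mat[OF f])
  qed
  show ?thesis
    unfolding pivotal_structure_def is_monoidal_nat_iso_def rr_functor_def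
    using is_dual_RepS3[OF dual_pair_dual(1), where ?'k = 'k]
      is_dual_RepS3[OF dual_pair_dual(2), where ?'k = 'k] iso nat
    by (simp add: rr_mu_RepS3 rr_eta_RepS3 tensor_id_mat id_mat_comp[OF struct_Intw(1)])
qed

lemma pivotal_fusion_RepS3:
  "pivotal_fusion_category (RepS3 :: (nat, 'k::field_char_0 vec) moncat) dual_data"
proof -
  have "rigid (RepS3 :: (nat, 'k vec) moncat)"
    unfolding rigid_def
      using is_dual_RepS3[OF dual_pair_dual(1)] is_dual_RepS3[OF dual_pair_dual(2)] by blast
  moreover have "finite simples" "triv_ob \<in> simples" by (auto simp: simples_def)
  ultimately show ?thesis
    unfolding pivotal_fusion_category_def fusion_category_def
    using linear_RepS3 RepS3.semisimple RepS3.S_complete RepS3.S_simple pivotal_RepS3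
    by (metis RepS3_simps(7))
qed

section \<open>The length of an object and the obstruction\<close>

definition swap_braiding :: "nat \<Rightarrow> nat \<Rightarrow> 'k::field vec"
  where "swap_braiding z w = map_mat (basis (tensor_ob w z)) swap_idx"

lemma swap_braiding_Intw: "swap_braiding z w \<in> Intw (tensor_ob w z) (tensor_ob z w)"
  unfolding swap_braiding_def by (rule swap_idx_Intw)

text \<open>The exchange of factors is a morphism because degrees are added in the commutative group
  \<open>\<int>/3\<close>.\<close>

lemma half_braiding_swap_braiding: "half_braiding RepS3 z (swap_braiding z :: nat \<Rightarrow> 'k::field vec)"
proof -
  have inv: "mat_comp (swap_braiding z w) (swap_braiding w z) = id_mat (tensor_ob w z)" for w z
    unfolding swap_braiding_def id_mat_def by (subst map_mat_comp) auto
  have iso: "is_iso RepS3 (tensor_ob w z) (tensor_ob z w) (swap_braiding z w :: 'k vec)" for w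
    by (rule is_isoI[OF swap_braiding_Intw swap_braiding_Intw inv inv])
  have nat: "mat_comp (mat_tensor f (id_mat z)) (swap_braiding z w') =
    mat_comp (swap_braiding z w) (mat_tensor (id_mat z) f)"
    if f: "f \<in> Intw w w'" for w w' and f :: "'k vec"
  proof (rule Intw_eqI)
    note fz = mat_tensor_Intw[OF f struct_Intw(1)[of z]]
      and zf = mat_tensor_Intw[OF struct_Intw(1)[of z] f]
    show "mat_comp (mat_tensor f (id_mat z)) (swap_braiding z w')
      \<in> Intw (tensor_ob w z) (tensor_ob z w')"
      "mat_comp (swap_braiding z w) (mat_tensor (id_mat z) f)
        \<in> Intw (tensor_ob w z) (tensor_ob z w')"
      by (rule mat_comp_Intw[OF fz swap_braiding_Intw] mat_comp_Intw[OF swap_braiding_Intw zf])+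
    fix a b assume "a \<in> basis (tensor_ob w z)" "b \<in> basis (tensor_ob z w')"
    then show "mat_comp (mat_tensor f (id_mat z)) (swap_braiding z w') \<langle>a, b\<rangle> =
      mat_comp (swap_braiding z w) (mat_tensor (id_mat z) f) \<langle>a, b\<rangle>"
      unfolding swap_braiding_def by (subst mat_comp_map_mat_right[OF fz, where \<delta> = swap_idx])
        (auto simp: mat_comp_map_mat_left mat_tensor_entry id_mat_entry)
  qed
  have hexagon: "(swap_braiding z (tensor_ob w w') :: 'k vec) =
      mat_comp (mat_comp
        (mat_comp (mat_comp (assoc_mat w w' z) (mat_tensor (id_mat w) (swap_braiding z w')))
          (unassoc_mat w z w')) (mat_tensor (swap_braiding z w) (id_mat w'))) (assoc_mat z w w')"
    for w w'
    unfolding swap_braiding_def struct_defs map_mat_tensor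
    by ((subst map_mat_comp, force simp: assoc_idx_def unassoc_idx_def)+)
      (auto simp: assoc_idx_def unassoc_idx_def swap_idx_def intro!: map_mat_cong)
  show ?thesis
    unfolding half_braiding_def using iso nat hexagon by (simp add: extensional_def)
qed

lemma proj_inj: "proj_at i (inj_at j v) = (if i = j then v else 0)"
  by (auto simp: proj_at_def inj_at_def fun_eq_iff)

lemma direct_sum_eqI:
  assumes "\<And>i. proj_at i u = proj_at i v"
  shows "u = v"
proof
  fix n
  have "proj_at (fst_code n) u (snd_code n) = proj_at (fst_code n) v (snd_code n)" using assms
    by simp
  then show "u n = v n" by (simp add: proj_at_def)
qed

lemma proj_linear: "proj_at i (u + v) = proj_at i u + proj_at i v" "proj_at i (c *\<^sub>v v) =
  c *\<^sub>v proj_at i v"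
  "proj_at i 0 = 0"
  by (auto simp: proj_at_def fun_eq_iff)

lemma in_direct_sum: "v \<in> direct_sum I V \<longleftrightarrow> (\<forall>i. proj_at i v \<in> (if i \<in> I then V i else {0}))"
  by (simp add: direct_sum_def zero_fun_def)

lemma subspace_direct_sum:
  assumes "\<And>i. i \<in> I \<Longrightarrow> vs.subspace (V i)"
  shows "vs.subspace (direct_sum I V)"
proof (rule vs.subspaceI)
  show "0 \<in> direct_sum I V" using vs.subspace_0[OF assms] by (auto simp: in_direct_sum proj_linear)
  fix u v c assume u: "u \<in> direct_sum I V"
  show "c *\<^sub>v u \<in> direct_sum I V"
    unfolding in_direct_sum proj_linear
  proof
    fix i show "c *\<^sub>v proj_at i u \<in> (if i \<in> I then V i else {0})"
      using u[unfolded in_direct_sum, rule_format, of i] vs.subspace_scale[OF assms, of i]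
        by (auto split: if_splits)
  qed
  assume v: "v \<in> direct_sum I V"
  show "u + v \<in> direct_sum I V"
    unfolding in_direct_sum proj_linear
  proof
    fix i show "proj_at i u + proj_at i v \<in> (if i \<in> I then V i else {0})"
      using u[unfolded in_direct_sum, rule_format, of i]
        v[unfolded in_direct_sum, rule_format, of i]
        vs.subspace_add[OF assms, of i] by (auto split: if_splits)
  qed
qed

lemma inj_in_direct_sum:
  assumes "i \<in> I" "f \<in> V i" "\<And>i. i \<in> I \<Longrightarrow> 0 \<in> V i"
  shows "inj_at i f \<in> direct_sum I V"
  using assms by (auto simp: in_direct_sum proj_inj)

lemma tube_space_RepS3:
  "tube_space RepS3 I = direct_sum {pos w x y | w x y. w \<in> I \<and> x \<in> I \<and> y \<in> I}
    (\<lambda>n. Intw (tensor_ob (fst_code (snd_code n)) (fst_code n))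
      (tensor_ob (fst_code n) (snd_code (snd_code n))))"
  by (simp add: tube_space_def prod_decode_code)

lemma subspace_tube_space: "vs.subspace (tube_space RepS3 I)"
  unfolding tube_space_RepS3 by (rule subspace_direct_sum) (rule subspace_Intw)

lemma unit_in_tube_space:
  assumes "triv_ob \<in> I"
  shows "aone (Tube RepS3 I) \<in> (acar (Tube RepS3 I) :: 'k::field vec set)"
proof -
  have "inj_at (pos triv_ob x x) (mat_comp (runit_mat x) (lunit_inv_mat x))
    \<in> (tube_space RepS3 I :: 'k vec set)" if x: "x \<in> I" for x
    unfolding tube_space_RepS3
  proof (rule inj_in_direct_sum)
    show "pos triv_ob x x \<in> {pos w x y |w x y. w \<in> I \<and> x \<in> I \<and> y \<in> I}" using x assms by blast
  qed (use mat_comp_Intw[OF struct_Intw(6,5), of x] zero_Intw in \<open>simp_all add: pos_def\<close>)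
  then have "(\<Sum>x\<in>I. inj_at (pos triv_ob x x) (mat_comp (runit_mat x) (lunit_inv_mat x)))
    \<in> (tube_space RepS3 I :: 'k vec set)"
    by (rule vs.subspace_sum[OF subspace_tube_space])
  then show ?thesis by (simp add: Tube_def)
qed

text \<open>Scalars can be absorbed in the first factor, so sums of pure tensors suffice.\<close>

lemma tens_space_list:
  assumes U: "vs.subspace U" and t: "t \<in> U \<otimes>\<^sub>V W"
  shows "\<exists>L. set L \<subseteq> U \<times> W \<and> t = (\<Sum>(v, w)\<leftarrow>L. v \<otimes>\<^sub>v w)"
  using t unfolding tens_space_def
proof (induction rule: vs.span_induct_alt)
  case base
  show ?case by (rule exI[of _ "[]"]) (simp add: zero_fun_def)
next
  case (step c x y)
  obtain v w where vw: "x = v \<otimes>\<^sub>v w" "v \<in> U" "w \<in> W" using step by blast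
  obtain L where L: "set L \<subseteq> U \<times> W" "y = (\<Sum>(v, w)\<leftarrow>L. v \<otimes>\<^sub>v w)" using step by blast
  have "c *\<^sub>v x = (c *\<^sub>v v) \<otimes>\<^sub>v w" unfolding vw by
    (auto simp: tens_def fun_eq_iff split: prod.split)
  then have "c *\<^sub>v x + y = (\<Sum>(v, w)\<leftarrow>(c *\<^sub>v v, w) # L. v \<otimes>\<^sub>v w)"
    by (simp only: L(2) list.map sum_list.Cons prod.case)
  moreover have "set ((c *\<^sub>v v, w) # L) \<subseteq> U \<times> W" using vw L(1) vs.subspace_scale[OF U] by auto
  ultimately show ?case by blast
qed

text \<open>This holds for the representation of \<open>t\<close> by pure tensors that the choice operator picks,
  without reference to the independence of the choice.\<close>

lemma sweedler_in_subspace: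
  assumes U: "vs.subspace U" and t: "t \<in> U \<otimes>\<^sub>V W" and S: "vs.subspace S"
    and b: "\<And>v w. v \<in> U \<Longrightarrow> w \<in> W \<Longrightarrow> b v w \<in> S"
  shows "sweedler U W b t \<in> S"
proof -
  define L where "L = (SOME L. set L \<subseteq> U \<times> W \<and> t = (\<Sum>(v, w)\<leftarrow>L. v \<otimes>\<^sub>v w))"
  have "set L \<subseteq> U \<times> W" using someI_ex[OF tens_space_list[OF U t]] unfolding L_def by blast
  then have "(\<Sum>(v, w)\<leftarrow>L. b v w) \<in> S"
  proof (induction L)
    case Nil
    show ?case using vs.subspace_0[OF S] by (simp add: zero_fun_def)
  next
    case (Cons d L)
    obtain v w where d: "d = (v, w)" by (cases d)
    have "b v w + (\<Sum>(v, w)\<leftarrow>L. b v w) \<in> S" using Cons d b by (intro vs.subspace_add[OF S]) auto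
    then show ?case by (simp only: d list.map sum_list.Cons prod.case)
  qed
  then show ?thesis by (simp add: sweedler_def L_def)
qed

text \<open>The tensor product of modules is the image of \<open>\<Delta>(1)\<close> acting on \<open>M \<otimes> M\<close>, and this action does
  not leave \<open>M \<otimes> M\<close>.\<close>

lemma rep_ten_line:
  assumes w: "weak_bialgebra_structure A \<Delta> \<epsilon>" and A: "vs.subspace (acar A)"
    and one: "aone A \<in> acar A"
    and M: "is_module A M" "fst M \<subseteq> range (\<lambda>c. c *\<^sub>v v0)"
  shows "fst (rep_ten A \<Delta> M M) \<subseteq> range (\<lambda>c. c *\<^sub>v (v0 \<otimes>\<^sub>v v0))"
proof
  fix u assume "u \<in> fst (rep_ten A \<Delta> M M)"
  then obtain t where t: "t \<in> fst M \<otimes>\<^sub>V fst M" and u: "u = act2 A M M (\<Delta> (aone A)) t"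
    by (auto simp: rep_ten_def Let_def)
  have \<Delta>: "\<Delta> (aone A) \<in> acar A \<otimes>\<^sub>V acar A"
    using w one by (auto simp: weak_bialgebra_structure_def coalgebra_on_def Let_def)
  have sub: "vs.subspace (fst M)"
    using M(1) by (auto simp: is_module_def fin_dim_subspace_def split: prod.splits)
  have act: "snd M a v \<in> fst M" if "a \<in> acar A" "v \<in> fst M" for a v
    using M(1) that by (auto simp: is_module_def split: prod.splits)
  let ?S = "vs.span {v0 \<otimes>\<^sub>v v0}"
  have in_line: "x \<otimes>\<^sub>v y \<in> ?S" if xy: "x \<in> fst M" "y \<in> fst M" for x y
  proof -
    obtain c d where "x = c *\<^sub>v v0" "y = d *\<^sub>v v0" using M(2) xy by blast
    then have "x \<otimes>\<^sub>v y = (c * d) *\<^sub>v (v0 \<otimes>\<^sub>v v0)"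
      by (auto simp: tens_def fun_eq_iff split: prod.split)
    then show ?thesis by (simp add: vs.span_scale vs.span_base)
  qed
  have "u \<in> ?S"
    unfolding u act2_def
    by (intro sweedler_in_subspace[OF A \<Delta>] sweedler_in_subspace[OF sub t] vs.subspace_span in_line
      act)
  then show "u \<in> range (\<lambda>c. c *\<^sub>v (v0 \<otimes>\<^sub>v v0))" by (simp add: vs.span_singleton)
qed

lemma iso_in_complete_simples:
  assumes I: "complete_simples (RepS3 :: (nat, 'k::field_char_0 vec) moncat) I" and s: "s \<in> simples"
  shows "\<exists>x\<in>I. \<exists>i j. (i :: 'k vec) \<in> Intw s x \<and> j \<in> Intw x s \<and> mat_comp i j =
    id_mat s \<and> mat_comp j i = id_mat x"
proof -
  have "simple (RepS3 :: (nat, 'k vec) moncat) s" by (rule RepS3.S_simple[OF s])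
  then obtain x where "x \<in> I" "isomorphic (RepS3 :: (nat, 'k vec) moncat) s x"
    using I unfolding complete_simples_def by blast
  then show ?thesis unfolding isomorphic_def is_iso_def inverse_pair_def by auto
qed

text \<open>By Schur's lemma only the summand of the simple object isomorphic to the two-dimensional
  representation contributes to \<open>J\<close>.\<close>

lemma hom_to_std_line:
  assumes I: "complete_simples (RepS3 :: (nat, 'k::field_char_0 vec) moncat) I"
  shows "\<exists>v0. direct_sum I (\<lambda>x. Intw x std_ob :: 'k vec set) \<subseteq> range (\<lambda>c. c *\<^sub>v v0)"
proof -
  have std: "std_ob \<in> simples" by (simp add: simples_def)
  obtain x0 i0 j0 where x0: "x0 \<in> I" and ij0: "(i0 :: 'k vec) \<in> Intw std_ob x0"
    "j0 \<in> Intw x0 std_ob"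
    "mat_comp i0 j0 = id_mat std_ob" "mat_comp j0 i0 = id_mat x0"
    using iso_in_complete_simples[OF I std] by blast
  have "isomorphic (RepS3 :: (nat, 'k vec) moncat) std_ob x0"
    using ij0 unfolding isomorphic_def is_iso_def inverse_pair_def by auto
  note iso0 = this
  have "v \<in> range (\<lambda>c. c *\<^sub>v inj_at x0 j0)"
    if v: "v \<in> direct_sum I (\<lambda>x. Intw x std_ob :: 'k vec set)" for v
  proof -
    have zero: "proj_at x v = 0" if x: "x \<noteq> x0" for x
    proof (cases "x \<in> I")
      case True
      then have "simple (RepS3 :: (nat, 'k vec) moncat) x" using I unfolding complete_simples_def
        by blast
      then obtain s where s: "s \<in> simples" "isomorphic (RepS3 :: (nat, 'k vec) moncat) s x"
        using RepS3.simple_isomorphic_S by blast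
      have "s \<noteq> std_ob"
      proof
        assume "s = std_ob"
        then have "isomorphic (RepS3 :: (nat, 'k vec) moncat) x x0"
          using RepS3.isomorphic_trans[OF _ _ _ RepS3.isomorphic_sym[OF s(2)]] iso0 by simp
        then show False using I x True x0 unfolding complete_simples_def by blast
      qed
      obtain i j where ij: "(i :: 'k vec) \<in> Intw s x" "j \<in> Intw x s" "mat_comp j i = id_mat x"
        using s(2) unfolding isomorphic_def is_iso_def inverse_pair_def by auto
      have f: "proj_at x v \<in> Intw x std_ob" using v True
        by (auto simp: in_direct_sum split: if_splits dest: spec[of _ x])
      have "mat_comp i (proj_at x v) = 0"
        using Intw_simples(1)[OF s(1) std mat_comp_Intw[OF ij(1) f] \<open>s \<noteq> std_ob\<close>] .
      moreover have "proj_at x v = mat_comp j (mat_comp i (proj_at x v))"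
        using mat_comp_assoc[OF ij(2,1) f] ij(3) id_mat_comp[OF f] by simp
      moreover have "mat_comp j 0 = 0" using RepS3.seq_zero[of x s j] ij(2) by simp
      ultimately show ?thesis by simp
    next
      case False
      then show ?thesis using v by (auto simp: in_direct_sum split: if_splits dest: spec[of _ x])
    qed
    have f: "proj_at x0 v \<in> Intw x0 std_ob" using v x0
      by (auto simp: in_direct_sum split: if_splits dest: spec[of _ x0])
    obtain c where c: "mat_comp i0 (proj_at x0 v) = c *\<^sub>v id_mat std_ob"
      using Intw_simples(2)[OF std std mat_comp_Intw[OF ij0(1) f]] by blast
    have "proj_at x0 v = mat_comp j0 (mat_comp i0 (proj_at x0 v))"
      using mat_comp_assoc[OF ij0(2,1) f] ij0(4) id_mat_comp[OF f] by simp
    also have "\<dots> = c *\<^sub>v j0"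
      using RepS3.seq_scl[of x0 std_ob j0 std_ob "id_mat std_ob" c] struct_Intw(1)[of std_ob]
        ij0(2) c comp_id_mat[OF ij0(2)] by simp
    finally have x0: "proj_at x0 v = c *\<^sub>v j0" .
    have "v = c *\<^sub>v inj_at x0 j0"
    proof (rule direct_sum_eqI)
      show "proj_at i v = proj_at i (c *\<^sub>v inj_at x0 j0)" for i
        using x0 zero[of i] by (cases "i = x0") (simp_all add: proj_linear proj_inj)
    qed
    then show ?thesis by blast
  qed
  then show ?thesis by blast
qed

text \<open>The vectors \<open>e\<^sub>0 \<otimes> e\<^sub>1 + \<eta> e\<^sub>1 \<otimes> e\<^sub>0\<close> have degree \<open>0\<close>, and the involution multiplies them by
  \<open>\<eta>\<close>.\<close>

lemma char_ob_in_std_squared: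
  fixes \<eta> :: "'k::field_char_0"
  assumes \<eta>: "\<eta> = 1 \<or> \<eta> = - 1"
  shows "\<exists>h \<in> Intw (char_ob \<eta>) (tensor_ob std_ob std_ob). h \<noteq> (0 :: 'k vec)"
proof -
  let ?h = "row_mat (\<lambda>l. if l = \<langle>0, 1\<rangle> then 1 else if l = \<langle>1, 0\<rangle> then \<eta> else 0) :: 'k vec"
  have "?h \<in> Intw (char_ob \<eta>) (tensor_ob std_ob std_ob)"
    by (rule row_mat_Intw[OF \<eta>]) (use \<eta> in \<open>auto simp: nat_eq_pair_iff split: if_splits\<close>)
  moreover have "?h \<langle>0, \<langle>0, 1\<rangle>\<rangle> \<noteq> 0 \<langle>0, \<langle>0, 1\<rangle>\<rangle>" by simp
  then have "?h \<noteq> 0" by metis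
  ultimately show ?thesis by blast
qed

lemma two_summands_of_std_squared:
  assumes I: "complete_simples (RepS3 :: (nat, 'k::field_char_0 vec) moncat) I"
  shows "\<exists>x\<in>I. \<exists>y\<in>I. \<exists>f\<in>Intw x (tensor_ob std_ob std_ob). \<exists>g\<in>Intw y (tensor_ob std_ob std_ob).
    x \<noteq> y \<and> f \<noteq> (0 :: 'k vec) \<and> g \<noteq> (0 :: 'k vec)"
proof -
  have *: "\<exists>x\<in>I. isomorphic (RepS3 :: (nat, 'k vec) moncat) (char_ob \<eta>) x \<and>
      (\<exists>f\<in>Intw x (tensor_ob std_ob std_ob). f \<noteq> (0 :: 'k vec))"
    if \<eta>: "\<eta> = 1 \<or> \<eta> = - 1" for \<eta> :: 'k
  proof -
    obtain h where h: "h \<in> Intw (char_ob \<eta>) (tensor_ob std_ob std_ob)" "h \<noteq> (0 :: 'k vec)"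
      using char_ob_in_std_squared[OF \<eta>] by blast
    have "char_ob \<eta> \<in> simples" by (simp add: char_ob_def simples_def)
    then obtain x i j where x: "x \<in> I" and ij: "(i :: 'k vec) \<in> Intw (char_ob \<eta>) x"
      "j \<in> Intw x (char_ob \<eta>)"
      "mat_comp i j = id_mat (char_ob \<eta>)" "mat_comp j i = id_mat x"
      using iso_in_complete_simples[OF I] by blast
    have "mat_comp i (mat_comp j h) = h"
      using mat_comp_assoc[OF ij(1,2) h(1)] ij(3) id_mat_comp[OF h(1)] by simp
    moreover have "mat_comp i 0 = 0" using RepS3.seq_zero[of "char_ob \<eta>" x i] ij(1) by simp
    ultimately have "mat_comp j h \<noteq> 0" using h(2) by metis
    moreover have "isomorphic (RepS3 :: (nat, 'k vec) moncat) (char_ob \<eta>) x"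
      using ij unfolding isomorphic_def is_iso_def inverse_pair_def by auto
    ultimately show ?thesis using x mat_comp_Intw[OF ij(2) h(1)] by blast
  qed
  obtain x f where x: "x \<in> I" "isomorphic (RepS3 :: (nat, 'k vec) moncat) (char_ob (1 :: 'k)) x"
    "f \<in> Intw x (tensor_ob std_ob std_ob)" "f \<noteq> (0 :: 'k vec)" using *[of 1] by blast
  obtain y g where y: "y \<in> I" "isomorphic (RepS3 :: (nat, 'k vec) moncat) (char_ob (- 1 :: 'k)) y"
    "g \<in> Intw y (tensor_ob std_ob std_ob)" "g \<noteq> (0 :: 'k vec)" using *[of "- 1"] by blast
  have "x \<noteq> y"
  proof
    assume "x = y"
    then have "isomorphic (RepS3 :: (nat, 'k vec) moncat) (char_ob (1 :: 'k)) (char_ob (- 1 :: 'k))"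
      using RepS3.isomorphic_trans[OF _ _ _ x(2)] RepS3.isomorphic_sym[OF y(2)] by simp
    then have "char_ob (1 :: 'k) = char_ob (- 1 :: 'k)"
      by (intro RepS3.S_isomorphic_eq) (auto simp: char_ob_def simples_def)
    then show False using simples_distinct(1) by (simp add: char_ob_def)
  qed
  then show ?thesis using x y by blast
qed

theorem propositionB9:
  "\<exists>(C :: (nat, nat \<Rightarrow> 'k::{alg_closed_field, field_char_0}) moncat) P.
    pivotal_fusion_category C P \<and>
    (\<forall>I. complete_simples C I \<and> unt C \<in> I \<longrightarrow>
      \<not> (\<exists>\<Delta> \<epsilon>. weak_bialgebra_structure (Tube C I) \<Delta> \<epsilon> \<and>
        (\<exists>\<mu> \<eta>. is_monoidal_equivalence (center C) (Rep (Tube C I) \<Delta> \<epsilon>) (J_functor C P I) \<mu> \<eta>)))"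
proof (intro exI conjI allI impI notI)
  let ?C = "RepS3 :: (nat, 'k vec) moncat"
  show "pivotal_fusion_category ?C dual_data" by (rule pivotal_fusion_RepS3)
  fix I
  assume I: "complete_simples ?C I \<and> unt ?C \<in> I"
  let ?A = "Tube ?C I"
  assume "\<exists>\<Delta> \<epsilon>. weak_bialgebra_structure ?A \<Delta> \<epsilon> \<and>
    (\<exists>\<mu> \<eta>. is_monoidal_equivalence (center ?C) (Rep ?A \<Delta> \<epsilon>) (J_functor ?C dual_data I) \<mu> \<eta>)"
  then obtain \<Delta> \<epsilon> \<mu> \<eta> where w: "weak_bialgebra_structure ?A \<Delta> \<epsilon>"
    and eq: "is_monoidal_equivalence (center ?C) (Rep ?A \<Delta> \<epsilon>) (J_functor ?C dual_data I) \<mu> \<eta>"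
    by blast
  define Z where "Z = (std_ob, swap_braiding std_ob :: nat \<Rightarrow> 'k vec)"
  define ZZ where "ZZ = Z \<otimes>\<^bsub>center ?C\<^esub> Z"
  define M where "M = J_ob ?C dual_data I Z"
  define N where "N = J_ob ?C dual_data I ZZ"
  have Z: "Z \<in> ob (center ?C)" unfolding Z_def center_def using half_braiding_swap_braiding by simp
  have "is_monoidal_functor (center ?C) (Rep ?A \<Delta> \<epsilon>) (J_functor ?C dual_data I) \<mu> \<eta>"
    using eq unfolding is_monoidal_equivalence_def by blast
  note F = this[unfolded is_monoidal_functor_def]
  have "fob (J_functor ?C dual_data I) Z \<in> ob (Rep ?A \<Delta> \<epsilon>)"
    using F[THEN conjunct1] Z unfolding is_functor_def by blast
  then have M: "is_module ?A M" by (simp add: M_def J_functor_def Rep_def Let_def)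
  have M_space: "fst M = direct_sum I (\<lambda>x. Intw x std_ob)"
    by (simp add: M_def J_ob_def Z_def Let_def)
  have N_space: "fst N = direct_sum I (\<lambda>x. Intw x (tensor_ob std_ob std_ob))"
    by (simp add: N_def ZZ_def J_ob_def Z_def Let_def center_def)
  obtain v0 where v0: "fst M \<subseteq> range (\<lambda>c. c *\<^sub>v v0)"
    using hom_to_std_line I unfolding M_space by blast
  have "vs.subspace (acar ?A)" using subspace_tube_space[of I] by (simp add: Tube_def)
  moreover have "aone ?A \<in> acar ?A" using unit_in_tube_space[of I] I by simp
  ultimately have small: "fst (rep_ten ?A \<Delta> M M) \<subseteq> range (\<lambda>c. c *\<^sub>v (v0 \<otimes>\<^sub>v v0))"
    using rep_ten_line[OF w _ _ M v0] by blast
  have "is_iso (Rep ?A \<Delta> \<epsilon>) (rep_ten ?A \<Delta> M M) N (\<mu> Z Z)"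
    using F[THEN conjunct2, THEN conjunct1, rule_format, OF Z Z]
    by (simp add: M_def N_def ZZ_def J_functor_def Rep_def Let_def)
  then obtain G where G: "inverse_pair (Rep ?A \<Delta> \<epsilon>) (rep_ten ?A \<Delta> M M) N (\<mu> Z Z) G"
    unfolding is_iso_def by blast
  then obtain m g where m: "\<mu> Z Z = (rep_ten ?A \<Delta> M M, N, m)" and g: "G = (N, rep_ten ?A \<Delta> M M, g)"
    and g_in: "g \<in> fst N \<rightarrow>\<^sub>E fst (rep_ten ?A \<Delta> M M)" and g_lin: "linear_on (fst N) g"
    unfolding inverse_pair_def by (auto simp: Rep_def Let_def)
  have "compose (fst N) m g = (\<lambda>v\<in>fst N. v)"
    using G unfolding inverse_pair_def m g by (simp add: Rep_def Let_def)
  then have mg: "m (g u) = u" if "u \<in> fst N" for u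
    using that by (metis compose_eq restrict_apply')
  obtain x y f h where xy: "x \<in> I" "y \<in> I" "x \<noteq> y" and f: "f \<in> Intw x (tensor_ob std_ob std_ob)" "f \<noteq> (0 :: 'k vec)"
    and h: "h \<in> Intw y (tensor_ob std_ob std_ob)" "h \<noteq> (0 :: 'k vec)"
    using two_summands_of_std_squared I by blast
  define u where "u = inj_at x f"
  define v where "v = inj_at y h"
  have u: "u \<in> fst N" and v: "v \<in> fst N"
    unfolding u_def v_def N_space using xy f h zero_Intw by (auto intro!: inj_in_direct_sum)
  have N_sub: "vs.subspace (fst N)" unfolding N_space by (rule subspace_direct_sum) (rule subspace_Intw)
  \<comment> \<open>The inverse \<open>g\<close> of the monoidal constraint embeds \<open>J(V \<otimes> V)\<close> into a line, so the images of \<open>u\<close>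
    and \<open>v\<close> are proportional, whereas \<open>u\<close> and \<open>v\<close> live in different summands.\<close>
  obtain a b where ab: "g u = a *\<^sub>v (v0 \<otimes>\<^sub>v v0)" "g v = b *\<^sub>v (v0 \<otimes>\<^sub>v v0)"
    using g_in u v small by blast
  have g_scl: "g (c *\<^sub>v r) = c *\<^sub>v g r" if "r \<in> fst N" for c r
    using g_lin that unfolding linear_on_def by blast
  have "g (b *\<^sub>v u) = g (a *\<^sub>v v)" using g_scl u v ab by (simp add: mult.commute)
  then have bu: "b *\<^sub>v u = a *\<^sub>v v"
    using mg vs.subspace_scale[OF N_sub] u v by metis
  have "proj_at y (b *\<^sub>v u) = proj_at y (a *\<^sub>v v)" using bu by simp
  then have "a *\<^sub>v h = 0" using xy by (simp add: proj_linear u_def v_def proj_inj)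
  then have "a = 0" using h by simp
  then have "g u = g (0 *\<^sub>v u)" using ab(1) g_scl[OF u, of 0] by simp
  then have "u = 0 *\<^sub>v u" using mg u vs.subspace_scale[OF N_sub u] by metis
  then have "proj_at x u = 0" by (simp add: proj_linear)
  then show False using f by (simp add: u_def proj_inj)
qed

end
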